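(* Let $\Phi$ be the action of orthogonal similarity on complex symmetric matrices, $\Phi(Q,A)=Q^{-1}AQ$ for $Q\in O_n(\mathbb{C})$, $A\in\mathbb{C}^{n\times n}_S$. Let $A$ be a complex symmetric $n\times n$ matrix with Jordan canonical form $\mathcal{J}(A)=\bigoplus_j J_{\alpha_j}(\lambda_j)$ and symmetric canonical form $\mathcal{S}(A)=\bigoplus_j S_{\alpha_j}(\lambda_j)$. Write $\mathcal{S}(A)=\bigoplus_{r=1}^{N}\mathcal{S}(A,\rho_r)$, where $\rho_1,\dots,\rho_N$ are the pairwise distinct eigenvalues of $A$ and $\mathcal{S}(A,\rho_r)$ collects all blocks of $\mathcal{S}(A)$ corresponding to the eigenvalue $\rho_r$. Then $$\dim_{\mathbb{C}}\operatorname{Stab}_{\Phi}(\mathcal{S}(A))=\sum_{r=1}^{N}\dim_{\mathbb{C}}\operatorname{Stab}_{\Phi}(\mathcal{S}(A,\rho_r)).$$ Moreover, if $\mathcal{S}(A)=\bigoplus_{r=1}^{N}\Big(\bigoplus_{j=1}^{m_r}S_{\alpha_r}(\lambda)\Big)$ for a single $\lambda\in\mathbb{C}$ and $\alpha_1>\alpha_2>\dots>\alpha_N$, then $$\dim_{\mathbb{C}}\operatorname{Stab}_{\Phi}(\mathcal{S}(A))=\sum_{r=1}^{N}\alpha_r m_r\Big(\tfrac12(m_r-1)+\sum_{s=1}^{r-1}m_s\Big).$$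
   Context: $\mathbb{C}^{n\times n}_S$ is the space of symmetric complex $n\times n$ matrices and $O_n(\mathbb{C})=\{Q\in\mathbb{C}^{n\times n}: Q^TQ=I\}$. For a symmetric matrix $B$ of any size $k$, $\operatorname{Stab}_\Phi(B)=\{Q\in O_k(\mathbb{C}): Q^{-1}BQ=B\}$, a closed complex Lie subgroup of $O_k(\mathbb{C})$ (the action is taken in the size of $B$). $J_m(z)$ is the $m\times m$ upper-triangular Jordan block with eigenvalue $z$ (ones on the superdiagonal), $E_m$ is the $m\times m$ matrix with ones on the anti-diagonal and zeros elsewhere, and $$S_m(z)=\tfrac12\big(J_m(z)+J_m(z)^T\big)+\tfrac{i}{2}\big(E_mJ_m(z)-J_m(z)E_m\big),$$ which is symmetric and similar to $J_m(z)$. Every complex symmetric matrix $A$ with Jordan form $\bigoplus_j J_{\alpha_j}(\lambda_j)$ is orthogonally similar to $\mathcal{S}(A)=\bigoplus_j S_{\alpha_j}(\lambda_j)$. *)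

theory Defs
  imports
    Jordan_Normal_Form.Spectral_Radius
    "HOL-Analysis.L2_Norm"
begin

section \<open>Complex submanifolds of $\mathbb{C}^n$ and their dimension\<close>

text \<open>
  The sizes of the matrices below vary inside one statement, so $\mathbb{C}^n$ is
  \<^term>\<open>carrier_vec n :: complex vec set\<close>. The type \<^typ>\<open>complex vec\<close> carries no topology,
  hence the explicit Euclidean norm and the epsilon-delta form of complex (Frechet)
  differentiability; the derivative is given by its complex Jacobian matrix \<open>D\<close>.
\<close>

definition cvec_norm :: "complex vec \<Rightarrow> real" where
  "cvec_norm v = L2_set (\<lambda>i. cmod (v $ i)) {..<dim_vec v}"

definition cvec_open :: "nat \<Rightarrow> complex vec set \<Rightarrow> bool" where
  "cvec_open n U \<longleftrightarrow>
     U \<subseteq> carrier_vec n \<and>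
     (\<forall>p\<in>U. \<exists>e>0. \<forall>q\<in>carrier_vec n. cvec_norm (q - p) < e \<longrightarrow> q \<in> U)"

definition cvec_holomorphic :: "nat \<Rightarrow> (complex vec \<Rightarrow> complex vec) \<Rightarrow> complex vec set \<Rightarrow> bool" where
  "cvec_holomorphic n f U \<longleftrightarrow>
     (\<forall>p\<in>U. \<exists>D\<in>carrier_mat n n. \<forall>e>0. \<exists>d>0. \<forall>q\<in>U. cvec_norm (q - p) < d \<longrightarrow>
        cvec_norm (f q - f p - D *\<^sub>v (q - p)) \<le> e * cvec_norm (q - p))"

definition cvec_biholomorphic ::
  "nat \<Rightarrow> (complex vec \<Rightarrow> complex vec) \<Rightarrow> complex vec set \<Rightarrow> complex vec set \<Rightarrow> bool" where
  "cvec_biholomorphic n f U V \<longleftrightarrow>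
     cvec_open n U \<and> cvec_open n V \<and> bij_betw f U V \<and>
     cvec_holomorphic n f U \<and> cvec_holomorphic n (inv_into U f) V"

text \<open>
  Embedded \<open>d\<close>-dimensional complex submanifolds: near each point, a biholomorphic change of
  coordinates of the ambient space straightens \<open>M\<close> to $\mathbb{C}^d \times \{0\}$. The condition
  \<open>d \<le> n\<close> is needed: every \<open>d \<ge> n\<close> would describe the same (full) slice.
\<close>

definition complex_submanifold :: "nat \<Rightarrow> nat \<Rightarrow> complex vec set \<Rightarrow> bool" where
  "complex_submanifold n d M \<longleftrightarrow>
     d \<le> n \<and> M \<subseteq> carrier_vec n \<and>
     (\<forall>p\<in>M. \<exists>U V f. p \<in> U \<and> cvec_biholomorphic n f U V \<and>
        f ` (M \<inter> U) = {v \<in> V. \<forall>i\<in>{d..<n}. v $ i = 0})"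

definition complex_dim :: "nat \<Rightarrow> complex vec set \<Rightarrow> nat" where
  "complex_dim n M = (THE d. complex_submanifold n d M)"

text \<open>The row-by-row identification of $k \times k$ matrices with $\mathbb{C}^{k^2}$.\<close>

definition vec_of_square :: "nat \<Rightarrow> complex mat \<Rightarrow> complex vec" where
  "vec_of_square k M = vec (k * k) (\<lambda>l. M $$ (l div k, l mod k))"

definition complex_dim_mat :: "nat \<Rightarrow> complex mat set \<Rightarrow> nat" where
  "complex_dim_mat k G = complex_dim (k * k) (vec_of_square k ` G)"


section \<open>Orthogonal similarity\<close>

definition complex_orthogonal :: "nat \<Rightarrow> complex mat set" where
  "complex_orthogonal n = {Q \<in> carrier_mat n n. Q\<^sup>T * Q = 1\<^sub>m n}"

definition orth_sim :: "complex mat \<Rightarrow> complex mat \<Rightarrow> complex mat" where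
  "orth_sim Q A = the (mat_inverse Q) * A * Q"

definition orth_stab :: "complex mat \<Rightarrow> complex mat set" where
  "orth_stab B = {Q \<in> complex_orthogonal (dim_row B). orth_sim Q B = B}"

definition dim_stab :: "complex mat \<Rightarrow> nat" where
  "dim_stab B = complex_dim_mat (dim_row B) (orth_stab B)"


section \<open>The symmetric canonical form\<close>

definition exchange_mat :: "nat \<Rightarrow> complex mat" where
  "exchange_mat m = mat m m (\<lambda>(i, j). if i + j + 1 = m then 1 else 0)"

definition sym_block :: "nat \<Rightarrow> complex \<Rightarrow> complex mat" where
  "sym_block m z =
     (1/2) \<cdot>\<^sub>m (jordan_block m z + (jordan_block m z)\<^sup>T) +
     (\<i>/2) \<cdot>\<^sub>m (exchange_mat m * jordan_block m z - jordan_block m z * exchange_mat m)"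

text \<open>
  As for \<^const>\<open>jordan_matrix\<close>, the blocks are given by a list of pairs (size, eigenvalue). The
  order of the list is the order of the direct summands.
\<close>

definition sym_canonical :: "(nat \<times> complex) list \<Rightarrow> complex mat" where
  "sym_canonical n_as = diag_block_mat (map (\<lambda>(m, z). sym_block m z) n_as)"

definition sym_canonical_part :: "(nat \<times> complex) list \<Rightarrow> complex \<Rightarrow> complex mat" where
  "sym_canonical_part n_as \<rho> = sym_canonical (filter (\<lambda>(m, z). z = \<rho>) n_as)"

end

theory Submission
  imports Defs
begin

text \<open>
  Near an orthogonal matrix \<open>Q\<^sub>0\<close> commuting with \<open>B\<close>, the Cayley chart
  \<open>Q \<mapsto> 2 (Q + Q\<^sub>0)\<^sup>-\<^sup>1 Q\<^sub>0 - I\<close> is biholomorphic and carries the stabilizer of \<open>B\<close> to the linear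
  space of skew-symmetric matrices commuting with \<open>B\<close>. The stabilizer is therefore a submanifold
  whose dimension is that of this space; the dimension is well defined because the derivative of a
  change of charts is invertible.

  For a direct sum of symmetric blocks, a skew matrix commuting with it is determined by the
  intertwiners above the diagonal, since the matrices commuting with a single block are symmetric.
  The intertwiners of two blocks correspond to those of the Jordan blocks, which vanish for distinct
  eigenvalues and otherwise are Toeplitz matrices with as many parameters as the smaller size. Hence
  the dimension is the sum of \<open>min(\<alpha>\<^sub>i, \<alpha>\<^sub>j)\<close> over the pairs \<open>i < j\<close> of blocks with the same
  eigenvalue, and both formulas follow by counting pairs.
\<close>

section \<open>Holomorphic maps and the dimension of submanifolds\<close>

text \<open>The chart at \<open>Q0\<close> is the classical Cayley transform (I - P)(I + P)^-1 of P
  = Q0^-1 Q. Rewritten as 2 (I + P)^-1 - I it contains a single inverse, so it is a composition of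
  affine maps with matrix inversion. It is thus a chart of the whole matrix space, as the definition
  of a submanifold asks, and its one nonlinear ingredient is inversion, whose derivative -R H R at R
  = W^-1 comes from an explicit estimate. Its domain, where Q + Q0 is invertible, contains
  \<open>Q0\<close> but varies with it, hence one chart per point.

  Jordan and symmetric blocks are linked by conjugation with I + i E, where E is the exchange
  matrix; as E^2 = I, the inverse is (I - i E) / 2. This conjugation turns symmetry about the
  antidiagonal, E Y E = Y^T, into ordinary symmetry. Square upper triangular Toeplitz matrices have
  the former, which is why the commutant of a single block is symmetric.\<close>

lemma cvec_norm_carrier: "v \<in> carrier_vec n \<Longrightarrow> cvec_norm v = L2_set (\<lambda>i. cmod (v $ i)) {..<n}"
  by (auto simp: cvec_norm_def)

lemma cvec_norm_nonneg [simp]: "0 \<le> cvec_norm v"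
  by (simp add: cvec_norm_def)

lemma cvec_norm_zero [simp]: "cvec_norm (0\<^sub>v n) = 0"
  by (simp add: cvec_norm_def L2_set_eq_0_iff)

lemma cvec_norm_eq_0D: "v \<in> carrier_vec n \<Longrightarrow> cvec_norm v = 0 \<Longrightarrow> v = 0\<^sub>v n"
  by (intro eq_vecI) (auto simp: cvec_norm_def L2_set_eq_0_iff)

lemma cvec_norm_triangle:
  assumes "v \<in> carrier_vec n" "w \<in> carrier_vec n"
  shows "cvec_norm (v + w) \<le> cvec_norm v + cvec_norm w"
proof -
  have "cvec_norm (v + w) = L2_set (\<lambda>i. cmod (v $ i + w $ i)) {..<n}"
    unfolding cvec_norm_def using assms by (intro L2_set_cong) auto
  also have "\<dots> \<le> L2_set (\<lambda>i. cmod (v $ i) + cmod (w $ i)) {..<n}"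
    by (intro L2_set_mono) (auto simp: norm_triangle_ineq)
  also have "\<dots> \<le> cvec_norm v + cvec_norm w"
    using assms by (simp add: L2_set_triangle_ineq cvec_norm_carrier)
  finally show ?thesis .
qed

lemma cvec_norm_smult: "cvec_norm (c \<cdot>\<^sub>v v) = cmod c * cvec_norm v"
proof -
  have "cvec_norm (c \<cdot>\<^sub>v v) = L2_set (\<lambda>i. cmod c * cmod (v $ i)) {..<dim_vec v}"
    unfolding cvec_norm_def by (intro L2_set_cong) (auto simp: norm_mult)
  then show ?thesis by (simp add: L2_set_right_distrib cvec_norm_def)
qed

lemma cvec_norm_uminus [simp]: "cvec_norm (- v) = cvec_norm v"
  by (simp add: cvec_norm_def L2_set_def)

lemma cvec_norm_diff:
  assumes "v \<in> carrier_vec n" "w \<in> carrier_vec n"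
  shows "cvec_norm (v - w) \<le> cvec_norm v + cvec_norm w"
proof -
  have "v - w = v + (- w)" using assms by auto
  then show ?thesis using cvec_norm_triangle[of v n "- w"] assms by simp
qed

lemma cmod_le_cvec_norm: "i < dim_vec v \<Longrightarrow> cmod (v $ i) \<le> cvec_norm v"
  unfolding cvec_norm_def by (rule member_le_L2_set) auto

lemma cvec_norm_le_sum: "cvec_norm v \<le> (\<Sum>i<dim_vec v. cmod (v $ i))"
  unfolding cvec_norm_def by (rule L2_set_le_sum) auto

lemma cvec_norm_mult_mat_vec_le:
  assumes "D \<in> carrier_mat n m" "v \<in> carrier_vec m" "\<And>i j. i < n \<Longrightarrow> j < m \<Longrightarrow> cmod (D $$ (i, j)) \<le> B"
  shows "cvec_norm (D *\<^sub>v v) \<le> real (n * m) * B * cvec_norm v"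
proof -
  have B: "cmod ((D *\<^sub>v v) $ i) \<le> real m * B * cvec_norm v" if "i < n" for i
  proof -
    have "cmod ((D *\<^sub>v v) $ i) = cmod (\<Sum>j<m. D $$ (i, j) * v $ j)"
      using assms that by (auto simp: scalar_prod_def atLeast0LessThan)
    also have "\<dots> \<le> (\<Sum>j<m. cmod (D $$ (i, j) * v $ j))" by (rule norm_sum)
    also have "\<dots> \<le> (\<Sum>j<m. B * cvec_norm v)"
      unfolding norm_mult using assms that
      by (intro sum_mono mult_mono cmod_le_cvec_norm) (auto intro: order_trans[OF norm_ge_zero])
    finally show ?thesis by simp
  qed
  have "cvec_norm (D *\<^sub>v v) \<le> (\<Sum>i<n. cmod ((D *\<^sub>v v) $ i))"
    using cvec_norm_le_sum[of "D *\<^sub>v v"] assms by auto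
  also have "\<dots> \<le> (\<Sum>i<n. real m * B * cvec_norm v)"
    using B by (intro sum_mono) auto
  finally show ?thesis by (simp add: mult.assoc)
qed

lemma cvec_norm_mult_mat_vec_bound:
  assumes "D \<in> carrier_mat n m"
  obtains K where "K > 0" "\<And>v. v \<in> carrier_vec m \<Longrightarrow> cvec_norm (D *\<^sub>v v) \<le> K * cvec_norm v"
proof -
  define B where "B = (\<Sum>i<n. \<Sum>j<m. cmod (D $$ (i, j)))"
  have "cmod (D $$ (i, j)) \<le> B" if "i < n" "j < m" for i j
  proof -
    have "cmod (D $$ (i, j)) \<le> (\<Sum>j<m. cmod (D $$ (i, j)))"
      using that by (intro member_le_sum) auto
    also have "\<dots> \<le> B" unfolding B_def
      using that by (intro member_le_sum[of i _ "\<lambda>i. \<Sum>j<m. cmod (D $$ (i, j))"]) (auto intro: sum_nonneg)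
    finally show ?thesis .
  qed
  note * = cvec_norm_mult_mat_vec_le[OF assms _ this]
  have "B \<ge> 0" unfolding B_def by (intro sum_nonneg) auto
  show ?thesis
  proof (rule that)
    \<comment> \<open>The added 1 keeps the constant positive when \<open>D\<close> is zero, since
      tolerances are divided by it later.\<close>
    show "real (n * m) * B + 1 > 0" using \<open>B \<ge> 0\<close> by (smt (verit) mult_nonneg_nonneg of_nat_0_le_iff)
    show "cvec_norm (D *\<^sub>v v) \<le> (real (n * m) * B + 1) * cvec_norm v" if "v \<in> carrier_vec m" for v
      using *[OF that] unfolding distrib_right mult_1 by (rule add_increasing2[OF cvec_norm_nonneg])
  qed
qed

section \<open>Complex derivatives and the chain rule\<close>

text \<open>\<open>cvec_holomorphic\<close> hides the Jacobian under a quantifier; naming it makes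
  the chain rule and the relation between the Jacobians of a map and its inverse
  expressible.\<close>

definition has_cvec_derivative ::
  "nat \<Rightarrow> (complex vec \<Rightarrow> complex vec) \<Rightarrow> complex mat \<Rightarrow> complex vec \<Rightarrow> complex vec set \<Rightarrow> bool" where
  "has_cvec_derivative n f D p U \<longleftrightarrow> D \<in> carrier_mat n n \<and>
     (\<forall>e>0. \<exists>d>0. \<forall>q\<in>U. cvec_norm (q - p) < d \<longrightarrow>
        cvec_norm (f q - f p - D *\<^sub>v (q - p)) \<le> e * cvec_norm (q - p))"

lemma cvec_holomorphic_iff: "cvec_holomorphic n f U \<longleftrightarrow> (\<forall>p\<in>U. \<exists>D. has_cvec_derivative n f D p U)"
  unfolding cvec_holomorphic_def has_cvec_derivative_def by blast

lemma has_cvec_derivativeD: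
  assumes "has_cvec_derivative n f D p U" "e > 0"
  obtains d where "d > 0" "\<And>q. q \<in> U \<Longrightarrow> cvec_norm (q - p) < d \<Longrightarrow>
    cvec_norm (f q - f p - D *\<^sub>v (q - p)) \<le> e * cvec_norm (q - p)"
  using assms unfolding has_cvec_derivative_def by meson

lemma has_cvec_derivative_carrier: "has_cvec_derivative n f D p U \<Longrightarrow> D \<in> carrier_mat n n"
  by (simp add: has_cvec_derivative_def)

text \<open>The derivative estimate with tolerance 1 bounds the increment by (K + 1) |q - p|, where
  \<open>K\<close> bounds \<open>D\<close>. It stands in for continuity in the chain rule and for
  preimages of open sets.\<close>

lemma has_cvec_derivative_lipschitz:
  assumes "has_cvec_derivative n f D p U" "p \<in> U" "U \<subseteq> carrier_vec n" "f ` U \<subseteq> carrier_vec n"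
  obtains K d where "K > 0" "d > 0"
    "\<And>q. q \<in> U \<Longrightarrow> cvec_norm (q - p) < d \<Longrightarrow> cvec_norm (f q - f p) \<le> K * cvec_norm (q - p)"
proof -
  have D: "D \<in> carrier_mat n n" using assms(1) by (rule has_cvec_derivative_carrier)
  obtain K where K: "K > 0" "\<And>v. v \<in> carrier_vec n \<Longrightarrow> cvec_norm (D *\<^sub>v v) \<le> K * cvec_norm v"
    using cvec_norm_mult_mat_vec_bound[OF D] by blast
  obtain d where d: "d > 0" "\<And>q. q \<in> U \<Longrightarrow> cvec_norm (q - p) < d \<Longrightarrow>
    cvec_norm (f q - f p - D *\<^sub>v (q - p)) \<le> 1 * cvec_norm (q - p)"
    using has_cvec_derivativeD[OF assms(1), of 1] by auto
  show ?thesis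
  proof (rule that[of "K + 1" d])
    fix q assume q: "q \<in> U" "cvec_norm (q - p) < d"
    have "q \<in> carrier_vec n" "p \<in> carrier_vec n" "f q \<in> carrier_vec n" "f p \<in> carrier_vec n"
      using q assms by blast+
    then have c: "q - p \<in> carrier_vec n" "f q - f p \<in> carrier_vec n"
      "D *\<^sub>v (q - p) \<in> carrier_vec n" using D by auto
    have "f q - f p = (f q - f p - D *\<^sub>v (q - p)) + D *\<^sub>v (q - p)"
      using c carrier_vecD[OF c(2)] carrier_vecD[OF c(3)] by (intro eq_vecI) auto
    then have "cvec_norm (f q - f p) \<le> cvec_norm (f q - f p - D *\<^sub>v (q - p)) + cvec_norm (D *\<^sub>v (q - p))"
      using cvec_norm_triangle[of "f q - f p - D *\<^sub>v (q - p)" n "D *\<^sub>v (q - p)"] c by auto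
    then show "cvec_norm (f q - f p) \<le> (K + 1) * cvec_norm (q - p)"
      using d(2)[OF q] K(2)[OF c(1)] by (simp add: distrib_right)
  qed (use K d in auto)
qed

lemma has_cvec_derivative_compose:
  assumes f: "has_cvec_derivative n f D p U" and g: "has_cvec_derivative n g E (f p) V"
    and sub: "f ` U \<subseteq> V" "p \<in> U" "U \<subseteq> carrier_vec n" "V \<subseteq> carrier_vec n" "g ` V \<subseteq> carrier_vec n"
  shows "has_cvec_derivative n (g \<circ> f) (E * D) p U"
  unfolding has_cvec_derivative_def
proof (intro conjI allI impI)
  have D: "D \<in> carrier_mat n n" using f by (rule has_cvec_derivative_carrier)
  have E: "E \<in> carrier_mat n n" using g by (rule has_cvec_derivative_carrier)
  show "E * D \<in> carrier_mat n n" using D E by auto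
  fix e :: real assume e: "e > 0"
  obtain K d1 where K: "K > 0" "d1 > 0"
    "\<And>q. q \<in> U \<Longrightarrow> cvec_norm (q - p) < d1 \<Longrightarrow> cvec_norm (f q - f p) \<le> K * cvec_norm (q - p)"
    using has_cvec_derivative_lipschitz[OF f sub(2,3) subset_trans[OF sub(1,4)]] by blast
  obtain L where L: "L > 0" "\<And>v. v \<in> carrier_vec n \<Longrightarrow> cvec_norm (E *\<^sub>v v) \<le> L * cvec_norm v"
    using cvec_norm_mult_mat_vec_bound[OF E] by blast
  \<comment> \<open>The error splits into \<open>E\<close> applied to the remainder of
    \<open>f\<close>, where \<open>E\<close> is bounded by \<open>L\<close>, and the remainder of
    \<open>g\<close> at \<open>f q\<close>, where |f q - f p| is at most K |q - p|. The two
    tolerances make each share at most e / 2.\<close>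
  obtain d2 where d2: "d2 > 0" "\<And>q. q \<in> U \<Longrightarrow> cvec_norm (q - p) < d2 \<Longrightarrow>
    cvec_norm (f q - f p - D *\<^sub>v (q - p)) \<le> e / (2 * L) * cvec_norm (q - p)"
    using has_cvec_derivativeD[OF f, of "e / (2 * L)"] e L by auto
  obtain d3 where d3: "d3 > 0" "\<And>q. q \<in> V \<Longrightarrow> cvec_norm (q - f p) < d3 \<Longrightarrow>
    cvec_norm (g q - g (f p) - E *\<^sub>v (q - f p)) \<le> e / (2 * K) * cvec_norm (q - f p)"
    using has_cvec_derivativeD[OF g, of "e / (2 * K)"] e K by auto
  show "\<exists>d>0. \<forall>q\<in>U. cvec_norm (q - p) < d \<longrightarrow>
        cvec_norm ((g \<circ> f) q - (g \<circ> f) p - (E * D) *\<^sub>v (q - p)) \<le> e * cvec_norm (q - p)"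
  proof (intro exI[of _ "min (min d1 d2) (d3 / K)"] conjI ballI impI)
    show "min (min d1 d2) (d3 / K) > 0" using K d2 d3 by auto
    fix q assume q: "q \<in> U" "cvec_norm (q - p) < min (min d1 d2) (d3 / K)"
    let ?r = "f q - f p - D *\<^sub>v (q - p)"
    have "q \<in> carrier_vec n" "p \<in> carrier_vec n" "f q \<in> V" "f p \<in> V" using q sub by blast+
    moreover from this have "f q \<in> carrier_vec n" "f p \<in> carrier_vec n"
      "g (f q) \<in> carrier_vec n" "g (f p) \<in> carrier_vec n" using sub by blast+
    ultimately have c: "q - p \<in> carrier_vec n" "f q - f p \<in> carrier_vec n" "g (f q) \<in> carrier_vec n" "g (f p) \<in> carrier_vec n"
      "D *\<^sub>v (q - p) \<in> carrier_vec n" "f q \<in> V" "?r \<in> carrier_vec n"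
      using D by auto
    have fq: "cvec_norm (f q - f p) \<le> K * cvec_norm (q - p)" using q K by auto
    have "cvec_norm (q - p) < d3 / K" using q by simp
    then have "K * cvec_norm (q - p) < d3" using K(1) by (simp add: pos_less_divide_eq mult.commute)
    then have "cvec_norm (g (f q) - g (f p) - E *\<^sub>v (f q - f p)) \<le> e / (2 * K) * cvec_norm (f q - f p)"
      using fq c by (intro d3) auto
    also have "\<dots> \<le> e / (2 * K) * (K * cvec_norm (q - p))"
      using fq e K by (intro mult_left_mono) auto
    finally have 1: "cvec_norm (g (f q) - g (f p) - E *\<^sub>v (f q - f p)) \<le> e / 2 * cvec_norm (q - p)"
      using K by simp
    have "cvec_norm (E *\<^sub>v ?r) \<le> L * cvec_norm ?r" using c by (intro L)
    also have "\<dots> \<le> L * (e / (2 * L) * cvec_norm (q - p))"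
      using q L by (intro mult_left_mono d2) auto
    finally have 2: "cvec_norm (E *\<^sub>v ?r) \<le> e / 2 * cvec_norm (q - p)" using L by simp
    have "E *\<^sub>v ?r = E *\<^sub>v (f q - f p) - E *\<^sub>v (D *\<^sub>v (q - p))"
      using c D E by (intro mult_minus_distrib_mat_vec) auto
    then have "g (f q) - g (f p) - (E * D) *\<^sub>v (q - p) = (g (f q) - g (f p) - E *\<^sub>v (f q - f p)) + E *\<^sub>v ?r"
      using c D E by (intro eq_vecI) (auto simp: assoc_mult_mat_vec[OF E D c(1)])
    moreover have "g (f q) - g (f p) - E *\<^sub>v (f q - f p) \<in> carrier_vec n" "E *\<^sub>v ?r \<in> carrier_vec n"
      using c E by auto
    ultimately show "cvec_norm ((g \<circ> f) q - (g \<circ> f) p - (E * D) *\<^sub>v (q - p)) \<le> e * cvec_norm (q - p)"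
      using 1 2 cvec_norm_triangle[of "g (f q) - g (f p) - E *\<^sub>v (f q - f p)" n "E *\<^sub>v ?r"] by simp
  qed
qed

text \<open>A difference quotient in direction \<open>v\<close> comes within \<open>e\<close> of
  \<open>D v\<close> for some small t > 0. One such t suffices for the uses below, where division by
  t leaves a bound by an arbitrary e.\<close>

lemma has_cvec_derivative_along:
  assumes f: "has_cvec_derivative n f D p U" and "p \<in> carrier_vec n" "v \<in> carrier_vec n"
    and t0: "t0 > 0" "\<And>t. 0 < t \<Longrightarrow> t < t0 \<Longrightarrow> p + complex_of_real t \<cdot>\<^sub>v v \<in> U" and "e > 0"
  obtains t where "0 < t" "p + complex_of_real t \<cdot>\<^sub>v v \<in> U"
    "cvec_norm (f (p + complex_of_real t \<cdot>\<^sub>v v) - f p - complex_of_real t \<cdot>\<^sub>v (D *\<^sub>v v)) \<le> e * t"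
proof -
  have D: "D \<in> carrier_mat n n" using f by (rule has_cvec_derivative_carrier)
  define K where "K = cvec_norm v + 1"
  have K: "K > 0" "cvec_norm v \<le> K" using cvec_norm_nonneg[of v] unfolding K_def by linarith+
  obtain d where d: "d > 0" "\<And>q. q \<in> U \<Longrightarrow> cvec_norm (q - p) < d \<Longrightarrow>
    cvec_norm (f q - f p - D *\<^sub>v (q - p)) \<le> e / K * cvec_norm (q - p)"
    using has_cvec_derivativeD[OF f, of "e / K"] \<open>e > 0\<close> K by auto
  define t where "t = min t0 (d / K) / 2"
  have t: "0 < t" "t < t0" "t < d / K" using t0 d K by (auto simp: t_def min_def field_simps)
  let ?q = "p + complex_of_real t \<cdot>\<^sub>v v"
  have q: "?q - p = complex_of_real t \<cdot>\<^sub>v v" using assms by (intro eq_vecI) auto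
  have "cvec_norm (?q - p) = t * cvec_norm v" using t by (simp add: q cvec_norm_smult)
  also have "\<dots> \<le> t * K" using t K by simp
  finally have n: "cvec_norm (?q - p) \<le> t * K" .
  also have "\<dots> < d" using t(3) K(1) by (simp add: pos_less_divide_eq)
  finally have "cvec_norm (f ?q - f p - D *\<^sub>v (?q - p)) \<le> e / K * cvec_norm (?q - p)"
    using t t0 by (intro d)
  also have "\<dots> \<le> e / K * (t * K)" using n \<open>e > 0\<close> K by (intro mult_left_mono) auto
  finally have "cvec_norm (f ?q - f p - D *\<^sub>v (?q - p)) \<le> e * t" using K by simp
  moreover have "D *\<^sub>v (?q - p) = complex_of_real t \<cdot>\<^sub>v (D *\<^sub>v v)"
    unfolding q using D assms by (intro mult_mat_vec)
  ultimately show ?thesis using t t0 by (intro that[of t]) auto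
qed

lemma cvec_openD:
  assumes "cvec_open n U" "p \<in> U"
  obtains e where "e > 0" "\<And>q. q \<in> carrier_vec n \<Longrightarrow> cvec_norm (q - p) < e \<Longrightarrow> q \<in> U"
  using assms unfolding cvec_open_def by meson

lemma cvec_open_carrier: "cvec_open n U \<Longrightarrow> U \<subseteq> carrier_vec n"
  by (simp add: cvec_open_def)

lemma cvec_open_along:
  assumes "cvec_open n U" "p \<in> U" "v \<in> carrier_vec n"
  obtains t0 :: real where "t0 > 0" "\<And>t. 0 < t \<Longrightarrow> t < t0 \<Longrightarrow> p + complex_of_real t \<cdot>\<^sub>v v \<in> U"
proof -
  obtain e where e: "e > 0" "\<And>q. q \<in> carrier_vec n \<Longrightarrow> cvec_norm (q - p) < e \<Longrightarrow> q \<in> U"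
    using cvec_openD[OF assms(1,2)] by blast
  have p: "p \<in> carrier_vec n" using assms cvec_open_carrier by blast
  have K: "cvec_norm v + 1 > 0" using cvec_norm_nonneg[of v] by linarith
  show ?thesis
  proof (rule that[of "e / (cvec_norm v + 1)"])
    show "e / (cvec_norm v + 1) > 0" using e K by simp
    fix t :: real assume t: "0 < t" "t < e / (cvec_norm v + 1)"
    have "p + complex_of_real t \<cdot>\<^sub>v v - p = complex_of_real t \<cdot>\<^sub>v v"
      using p assms by (intro eq_vecI) auto
    then have "cvec_norm (p + complex_of_real t \<cdot>\<^sub>v v - p) = t * cvec_norm v"
      using t by (simp add: cvec_norm_smult)
    also have "\<dots> \<le> t * (cvec_norm v + 1)" using t by simp
    also have "\<dots> < e" using t(2) K by (simp add: pos_less_divide_eq)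
    finally show "p + complex_of_real t \<cdot>\<^sub>v v \<in> U" using p assms by (intro e) auto
  qed
qed

text \<open>Along a unit vector v the estimate for the identity reads t |v - D v| <= e t, so each
  column of \<open>D\<close> is arbitrarily close to the unit vector. Openness of \<open>U\<close>
  puts the points p + t v into \<open>U\<close>.\<close>

lemma has_cvec_derivative_id_unique:
  assumes f: "has_cvec_derivative n f D p U" and U: "cvec_open n U" "p \<in> U" and id: "\<And>q. q \<in> U \<Longrightarrow> f q = q"
  shows "D = 1\<^sub>m n"
proof (rule eq_matI)
  have D: "D \<in> carrier_mat n n" using f by (rule has_cvec_derivative_carrier)
  then show "dim_row D = dim_row (1\<^sub>m n)" "dim_col D = dim_col (1\<^sub>m n)" by auto
  have p: "p \<in> carrier_vec n" using U cvec_open_carrier by blast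
  fix i j assume "i < dim_row (1\<^sub>m n :: complex mat)" "j < dim_col (1\<^sub>m n :: complex mat)"
  then have ij: "i < n" "j < n" by auto
  let ?v = "unit_vec n j :: complex vec"
  have v: "?v \<in> carrier_vec n" by simp
  obtain t0 where t0: "(t0::real) > 0" "\<And>t. 0 < t \<Longrightarrow> t < t0 \<Longrightarrow> p + complex_of_real t \<cdot>\<^sub>v ?v \<in> U"
    using cvec_open_along[OF U v] by blast
  have le: "cvec_norm (?v - D *\<^sub>v ?v) \<le> e" if "e > 0" for e
  proof -
    obtain t where t: "0 < t" "p + complex_of_real t \<cdot>\<^sub>v ?v \<in> U"
      "cvec_norm (f (p + complex_of_real t \<cdot>\<^sub>v ?v) - f p - complex_of_real t \<cdot>\<^sub>v (D *\<^sub>v ?v)) \<le> e * t"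
      using has_cvec_derivative_along[OF f p v t0 \<open>e > 0\<close>] by blast
    have "f (p + complex_of_real t \<cdot>\<^sub>v ?v) - f p - complex_of_real t \<cdot>\<^sub>v (D *\<^sub>v ?v)
       = complex_of_real t \<cdot>\<^sub>v (?v - D *\<^sub>v ?v)"
      unfolding id[OF t(2)] id[OF U(2)] using p D by (intro eq_vecI) (auto simp: algebra_simps)
    then have "t * cvec_norm (?v - D *\<^sub>v ?v) \<le> e * t" using t by (simp add: cvec_norm_smult)
    then show ?thesis using t by (simp add: mult.commute)
  qed
  have "cvec_norm (?v - D *\<^sub>v ?v) \<le> 0" by (rule field_le_epsilon) (simp only: le add_0)
  then have 0: "cvec_norm (?v - D *\<^sub>v ?v) = 0" by (intro order_antisym cvec_norm_nonneg)
  have "?v - D *\<^sub>v ?v = 0\<^sub>v n" using D by (intro cvec_norm_eq_0D[OF _ 0]) auto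
  then have "(?v - D *\<^sub>v ?v) $ i = 0" using ij by simp
  moreover have "(?v - D *\<^sub>v ?v) $ i = ?v $ i - D $$ (i, j)"
    using ij D by (simp add: scalar_prod_right_unit)
  ultimately show "D $$ (i, j) = 1\<^sub>m n $$ (i, j)" using ij by (simp add: unit_vec_def)
qed

lemma has_cvec_derivative_subset:
  "has_cvec_derivative n f D p U \<Longrightarrow> U' \<subseteq> U \<Longrightarrow> has_cvec_derivative n f D p U'"
  unfolding has_cvec_derivative_def by blast

section \<open>Open sets and biholomorphic maps\<close>

lemma cvec_open_preimage:
  assumes f: "cvec_holomorphic n f U" and sub: "f ` U \<subseteq> carrier_vec n" and U: "cvec_open n U" and V: "cvec_open n V"
  shows "cvec_open n {q \<in> U. f q \<in> V}"
  unfolding cvec_open_def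
proof (intro conjI ballI)
  show "{q \<in> U. f q \<in> V} \<subseteq> carrier_vec n" using cvec_open_carrier[OF U] by auto
  fix p assume "p \<in> {q \<in> U. f q \<in> V}"
  then have p: "p \<in> U" "f p \<in> V" by auto
  obtain D where D: "has_cvec_derivative n f D p U" using f p by (auto simp: cvec_holomorphic_iff)
  obtain K d where K: "K > 0" "d > 0"
    "\<And>q. q \<in> U \<Longrightarrow> cvec_norm (q - p) < d \<Longrightarrow> cvec_norm (f q - f p) \<le> K * cvec_norm (q - p)"
    using has_cvec_derivative_lipschitz[OF D p(1) cvec_open_carrier[OF U] sub] by blast
  obtain a where a: "a > 0" "\<And>q. q \<in> carrier_vec n \<Longrightarrow> cvec_norm (q - p) < a \<Longrightarrow> q \<in> U"
    using cvec_openD[OF U p(1)] by blast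
  obtain b where b: "b > 0" "\<And>q. q \<in> carrier_vec n \<Longrightarrow> cvec_norm (q - f p) < b \<Longrightarrow> q \<in> V"
    using cvec_openD[OF V p(2)] by blast
  show "\<exists>e>0. \<forall>q\<in>carrier_vec n. cvec_norm (q - p) < e \<longrightarrow> q \<in> {q \<in> U. f q \<in> V}"
  proof (intro exI[of _ "min (min a d) (b / K)"] conjI ballI impI)
    show "min (min a d) (b / K) > 0" using K(1,2) a(1) b(1) by simp
    fix q :: "complex vec" assume q: "q \<in> carrier_vec n" "cvec_norm (q - p) < min (min a d) (b / K)"
    then have qU: "q \<in> U" by (intro a) auto
    then have "f q \<in> carrier_vec n" using sub by auto
    moreover have "cvec_norm (f q - f p) \<le> K * cvec_norm (q - p)" using q qU by (intro K) auto
    moreover have "K * cvec_norm (q - p) < b"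
      using q K(1) by (simp add: pos_less_divide_eq mult.commute)
    ultimately show "q \<in> {q \<in> U. f q \<in> V}" using qU b(2)[of "f q"] by simp
  qed
qed

lemma cvec_holomorphic_cong:
  assumes "\<And>q. q \<in> U \<Longrightarrow> f q = g q"
  shows "cvec_holomorphic n f U \<longleftrightarrow> cvec_holomorphic n g U"
  unfolding cvec_holomorphic_def using assms by simp

lemma cvec_holomorphic_compose:
  assumes "cvec_holomorphic n f U" "cvec_holomorphic n g V" "f ` U \<subseteq> V"
    "U \<subseteq> carrier_vec n" "V \<subseteq> carrier_vec n" "g ` V \<subseteq> carrier_vec n"
  shows "cvec_holomorphic n (g \<circ> f) U"
  unfolding cvec_holomorphic_iff
proof
  fix p assume p: "p \<in> U"
  obtain D where D: "has_cvec_derivative n f D p U" using assms p by (auto simp: cvec_holomorphic_iff)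
  have "f p \<in> V" using p assms by blast
  then obtain E where E: "has_cvec_derivative n g E (f p) V" using assms by (auto simp: cvec_holomorphic_iff)
  show "\<exists>D. has_cvec_derivative n (g \<circ> f) D p U"
    using has_cvec_derivative_compose[OF D E assms(3) p assms(4-6)] by blast
qed

text \<open>Replaces \<open>inv_into\<close>, which has no formula to differentiate, by any explicit
  two-sided inverse \<open>g\<close>; the two agree on \<open>V\<close>.\<close>

lemma cvec_biholomorphicI:
  assumes "cvec_open n U" "cvec_open n V" "f ` U \<subseteq> V" "g ` V \<subseteq> U"
    "\<And>x. x \<in> U \<Longrightarrow> g (f x) = x" "\<And>y. y \<in> V \<Longrightarrow> f (g y) = y"
    "cvec_holomorphic n f U" "cvec_holomorphic n g V"
  shows "cvec_biholomorphic n f U V"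
proof -
  have bij: "bij_betw f U V" using assms by (intro bij_betw_byWitness[of _ g]) auto
  have "inv_into U f y = g y" if "y \<in> V" for y
  proof (rule inv_into_f_eq)
    show "inj_on f U" using bij by (rule bij_betw_imp_inj_on)
    show "g y \<in> U" "f (g y) = y" using assms that by auto
  qed
  then have "cvec_holomorphic n (inv_into U f) V"
    using cvec_holomorphic_cong[of V "inv_into U f" g n] assms by simp
  then show ?thesis unfolding cvec_biholomorphic_def using assms bij by simp
qed

lemma cvec_biholomorphicD:
  assumes "cvec_biholomorphic n f U V"
  shows "cvec_open n U" "cvec_open n V" "bij_betw f U V" "f ` U = V"
    "cvec_holomorphic n f U" "cvec_holomorphic n (inv_into U f) V" "inv_into U f ` V = U"
    "\<And>x. x \<in> U \<Longrightarrow> inv_into U f (f x) = x" "\<And>y. y \<in> V \<Longrightarrow> f (inv_into U f y) = y"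
proof -
  show "cvec_open n U" "cvec_open n V" and b: "bij_betw f U V" and
    "cvec_holomorphic n f U" "cvec_holomorphic n (inv_into U f) V"
    using assms by (auto simp: cvec_biholomorphic_def)
  show "f ` U = V" using b by (simp add: bij_betw_def)
  then show "\<And>y. y \<in> V \<Longrightarrow> f (inv_into U f y) = y" by (auto intro: f_inv_into_f)
  show "\<And>x. x \<in> U \<Longrightarrow> inv_into U f (f x) = x" using b by (simp add: bij_betw_def)
  show "inv_into U f ` V = U" using bij_betw_inv_into[OF b] by (simp add: bij_betw_def)
qed

lemma cvec_biholomorphic_compose:
  assumes f: "cvec_biholomorphic n f U V" and g: "cvec_biholomorphic n g V W"
  shows "cvec_biholomorphic n (g \<circ> f) U W"
proof (rule cvec_biholomorphicI[where g = "inv_into U f \<circ> inv_into V g"])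
  note F = cvec_biholomorphicD[OF f] and G = cvec_biholomorphicD[OF g]
  note C = cvec_open_carrier[OF F(1)] cvec_open_carrier[OF F(2)] cvec_open_carrier[OF G(2)]
  show "cvec_open n U" "cvec_open n W" by fact+
  show "(g \<circ> f) ` U \<subseteq> W" using F(4) G(4) by auto
  show "(inv_into U f \<circ> inv_into V g) ` W \<subseteq> U" using F(7) G(7) by (metis image_comp subset_refl)
  show "(inv_into U f \<circ> inv_into V g) ((g \<circ> f) x) = x" if "x \<in> U" for x
    using F(4,8) G(8) that by auto
  show "(g \<circ> f) ((inv_into U f \<circ> inv_into V g) y) = y" if "y \<in> W" for y
  proof -
    have "inv_into V g y \<in> V" using G(7) that by blast
    then show ?thesis using F(9) G(9) that by simp
  qed
  show "cvec_holomorphic n (g \<circ> f) U"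
    by (rule cvec_holomorphic_compose[OF F(5) G(5)]) (use F(4) G(4) C in auto)
  show "cvec_holomorphic n (inv_into U f \<circ> inv_into V g) W"
    by (rule cvec_holomorphic_compose[OF G(6) F(6)]) (use F(7) G(7) C in auto)
qed

text \<open>The chain rule for the inverse after \<open>f\<close>, with uniqueness of the derivative
  of the identity, gives E D = I; for square matrices the other order follows.\<close>

lemma cvec_biholomorphic_derivatives:
  assumes f: "cvec_biholomorphic n f U V" and p: "p \<in> U"
  obtains D E where "has_cvec_derivative n f D p U" "has_cvec_derivative n (inv_into U f) E (f p) V"
    "E * D = 1\<^sub>m n" "D * E = 1\<^sub>m n"
proof -
  note F = cvec_biholomorphicD[OF f]
  note C = cvec_open_carrier[OF F(1)] cvec_open_carrier[OF F(2)]
  obtain D where D: "has_cvec_derivative n f D p U" using F(5) p by (auto simp: cvec_holomorphic_iff)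
  have "f p \<in> V" using p F(4) by auto
  then obtain E where E: "has_cvec_derivative n (inv_into U f) E (f p) V"
    using F(6) by (auto simp: cvec_holomorphic_iff)
  have "has_cvec_derivative n (inv_into U f \<circ> f) (E * D) p U"
    by (rule has_cvec_derivative_compose[OF D E]) (use F(4,7) C p in auto)
  then have ED: "E * D = 1\<^sub>m n" by (rule has_cvec_derivative_id_unique) (use F p in auto)
  have "D * E = 1\<^sub>m n"
    by (rule mat_mult_left_right_inverse[OF _ _ ED]) (use D E in \<open>auto simp: has_cvec_derivative_def\<close>)
  with D E ED show ?thesis by (rule that)
qed

section \<open>Invariance of the dimension\<close>

text \<open>If d' < d, the leading d x d corner \<open>M\<close> of \<open>D\<close> has a zero row
  d', hence a nonzero kernel vector. Padded with zeros it is killed by \<open>D\<close>: the first d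
  entries of the image vanish because of \<open>M\<close>, the others by the slice condition. This
  contradicts injectivity.\<close>

lemma dim_le_of_injective_on_slice:
  fixes D :: "complex mat"
  assumes D: "D \<in> carrier_mat n n" and "d \<le> n"
    and inj: "\<And>v. v \<in> carrier_vec n \<Longrightarrow> D *\<^sub>v v = 0\<^sub>v n \<Longrightarrow> v = 0\<^sub>v n"
    and slice: "\<And>v i. v \<in> carrier_vec n \<Longrightarrow> \<forall>i\<in>{d..<n}. v $ i = 0 \<Longrightarrow> i \<in> {d'..<n} \<Longrightarrow> (D *\<^sub>v v) $ i = 0"
  shows "d \<le> d'"
proof (rule ccontr)
  assume "\<not> d \<le> d'"
  then have d': "d' < d" by simp
  define M where "M = mat d d (\<lambda>(i, j). D $$ (i, j))"
  have M: "M \<in> carrier_mat d d" by (simp add: M_def)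
  define pad where "pad = (\<lambda>v :: complex vec. vec n (\<lambda>i. if i < d then v $ i else 0))"
  have pad: "pad v \<in> carrier_vec n" "\<forall>i\<in>{d..<n}. pad v $ i = 0" for v
    using \<open>d \<le> n\<close> by (auto simp: pad_def)
  have Mv: "(D *\<^sub>v pad v) $ i = (M *\<^sub>v v) $ i" if "v \<in> carrier_vec d" "i < d" for v i
  proof -
    have "(D *\<^sub>v pad v) $ i = (\<Sum>j\<in>{0..<n}. D $$ (i, j) * pad v $ j)"
      using that D \<open>d \<le> n\<close> pad by (simp add: scalar_prod_def pad_def)
    also have "\<dots> = (\<Sum>j\<in>{0..<d}. D $$ (i, j) * pad v $ j)"
      using \<open>d \<le> n\<close> by (intro sum.mono_neutral_right) (auto simp: pad_def)
    also have "\<dots> = (M *\<^sub>v v) $ i"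
      using that \<open>d \<le> n\<close> by (auto simp: scalar_prod_def M_def pad_def intro!: sum.cong)
    finally show ?thesis .
  qed
  have last: "(M *\<^sub>v v) $ d' = 0" if "v \<in> carrier_vec d" for v
    using slice[of "pad v" d'] pad Mv[OF that d'] d' \<open>d \<le> n\<close> by simp
  have "M $$ (d', j) = 0" if "j < d" for j
    using last[of "unit_vec d j"] M d' that by (simp add: scalar_prod_right_unit)
  then have "M\<^sup>T *\<^sub>v unit_vec d d' = 0\<^sub>v d" using M d' by (intro eq_vecI) (auto simp: scalar_prod_right_unit)
  moreover have "unit_vec d d' \<noteq> (0\<^sub>v d :: complex vec)" using d' by (metis index_unit_vec(2) index_zero_vec(1) one_neq_zero)
  ultimately have "det (M\<^sup>T) = 0" using M
    by (subst det_0_iff_vec_prod_zero[of _ d]) (auto intro!: exI[of _ "unit_vec d d'"])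
  then have "det M = 0" using M by (simp add: det_transpose)
  then obtain v where v: "v \<in> carrier_vec d" "v \<noteq> 0\<^sub>v d" "M *\<^sub>v v = 0\<^sub>v d"
    using det_0_iff_vec_prod_zero[OF M] by auto
  have "D *\<^sub>v pad v = 0\<^sub>v n"
  proof (rule eq_vecI)
    fix i assume "i < dim_vec (0\<^sub>v n :: complex vec)"
    then show "(D *\<^sub>v pad v) $ i = 0\<^sub>v n $ i"
      using Mv[OF v(1), of i] v slice[of "pad v" i] pad d' by (cases "i < d") auto
  qed (use D in auto)
  then have 0: "pad v = 0\<^sub>v n" using inj pad by blast
  have "v $ i = 0" if "i < d" for i
    using arg_cong[OF 0, of "\<lambda>v. v $ i"] that \<open>d \<le> n\<close> by (simp add: pad_def)
  then have "v = 0\<^sub>v d" using v by (intro eq_vecI) auto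
  with v show False by simp
qed

text \<open>The transition map between the charts carries points of C^d x {0} to points of C^d' x
  {0}. Its derivative at \<open>f p\<close> does the same and is injective, so d <= d'; exchanging
  the charts gives the converse.\<close>

lemma complex_submanifold_dim_le:
  assumes M: "complex_submanifold n d M" and M': "complex_submanifold n d' M" and p: "p \<in> M"
  shows "d \<le> d'"
proof -
  obtain U V f where pU: "p \<in> U" and f: "cvec_biholomorphic n f U V"
    and fM: "f ` (M \<inter> U) = {v \<in> V. \<forall>i\<in>{d..<n}. v $ i = 0}"
    using M p unfolding complex_submanifold_def by meson
  obtain U' V' f' where pU': "p \<in> U'" and f': "cvec_biholomorphic n f' U' V'"
    and fM': "f' ` (M \<inter> U') = {v \<in> V'. \<forall>i\<in>{d'..<n}. v $ i = 0}"
    using M' p unfolding complex_submanifold_def by meson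
  note F = cvec_biholomorphicD[OF f] and F' = cvec_biholomorphicD[OF f']
  note C = cvec_open_carrier[OF F(1)] cvec_open_carrier[OF F(2)] cvec_open_carrier[OF F'(1)] cvec_open_carrier[OF F'(2)]
  obtain D E where D: "has_cvec_derivative n f D p U" and E: "has_cvec_derivative n (inv_into U f) E (f p) V"
    and DE: "D * E = 1\<^sub>m n"
    using cvec_biholomorphic_derivatives[OF f pU] by metis
  obtain D' E' where D': "has_cvec_derivative n f' D' p U'" and E': "has_cvec_derivative n (inv_into U' f') E' (f' p) V'"
    and DE': "E' * D' = 1\<^sub>m n"
    using cvec_biholomorphic_derivatives[OF f' pU'] by metis
  note mats = D[THEN has_cvec_derivative_carrier] E[THEN has_cvec_derivative_carrier]
    D'[THEN has_cvec_derivative_carrier] E'[THEN has_cvec_derivative_carrier]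
  let ?g = "inv_into U f"
  \<comment> \<open>The part of \<open>V\<close> on which the transition map, \<open>f'\<close>
    after the inverse of \<open>f\<close>, is defined.\<close>
  define X where "X = {x \<in> V. ?g x \<in> U'}"
  have X: "cvec_open n X" unfolding X_def
    by (rule cvec_open_preimage[OF F(6) _ F(2) F'(1)]) (use F(7) C in auto)
  have gp: "?g (f p) = p" using F pU by auto
  have fpX: "f p \<in> X" using F gp pU pU' by (auto simp: X_def)
  have fp: "f p \<in> carrier_vec n" using fpX cvec_open_carrier[OF X] by auto
  have fp': "f' p \<in> carrier_vec n" using F'(4) C pU' by auto
  have comp: "has_cvec_derivative n (f' \<circ> ?g) (D' * E) (f p) X"
    by (rule has_cvec_derivative_compose[where V = U'])
       (use has_cvec_derivative_subset[OF E, of X] D' gp fpX cvec_open_carrier[OF X] C F'(4) in \<open>auto simp: X_def\<close>)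
  have DE_carrier: "D' * E \<in> carrier_mat n n" using mats by auto
  have slice: "((D' * E) *\<^sub>v v) $ i = 0"
    if v: "v \<in> carrier_vec n" "\<forall>i\<in>{d..<n}. v $ i = 0" and i: "i \<in> {d'..<n}" for v i
  proof -
    obtain t0 where t0: "(t0::real) > 0" "\<And>t. 0 < t \<Longrightarrow> t < t0 \<Longrightarrow> f p + complex_of_real t \<cdot>\<^sub>v v \<in> X"
      using cvec_open_along[OF X fpX v(1)] by blast
    let ?w = "(D' * E) *\<^sub>v v"
    have w: "?w \<in> carrier_vec n" using DE_carrier v by auto
    have le: "cmod (?w $ i) \<le> e" if e: "e > 0" for e
    proof -
      obtain t where t: "0 < t" "f p + complex_of_real t \<cdot>\<^sub>v v \<in> X" and
        le: "cvec_norm ((f' \<circ> ?g) (f p + complex_of_real t \<cdot>\<^sub>v v) - (f' \<circ> ?g) (f p) - complex_of_real t \<cdot>\<^sub>v ?w) \<le> e * t"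
        using has_cvec_derivative_along[OF comp fp v(1) t0 e] by blast
      let ?x = "f p + complex_of_real t \<cdot>\<^sub>v v"
      have xV: "?x \<in> V" "?g ?x \<in> U'" using t by (auto simp: X_def)
      have "f p \<in> f ` (M \<inter> U)" using p pU by auto
      then have "\<forall>i\<in>{d..<n}. f p $ i = 0" unfolding fM by auto
      then have "?x \<in> f ` (M \<inter> U)" unfolding fM using xV v fp by auto
      then have "?g ?x \<in> M" using F(8) by auto
      then have gx: "f' (?g ?x) \<in> f' ` (M \<inter> U')" using xV by auto
      have "f' p \<in> f' ` (M \<inter> U')" using p pU' by auto
      then have z: "f' (?g ?x) $ i = 0" "f' p $ i = 0" using gx i unfolding fM' by auto
      have c: "f' (?g ?x) \<in> carrier_vec n" using gx unfolding fM' using C by auto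
      let ?r = "f' (?g ?x) - f' p - complex_of_real t \<cdot>\<^sub>v ?w"
      \<comment> \<open>Both values of \<open>f'\<close> lie in the second slice, so in coordinate
        \<open>i\<close> only the linear term of the remainder survives.\<close>
      have "t * cmod (?w $ i) = cmod (?r $ i)"
        using z c fp' w i t carrier_vecD[OF w] carrier_vecD[OF fp'] by (simp add: norm_mult)
      also have "\<dots> \<le> cvec_norm ?r" using w i carrier_vecD[OF w] by (intro cmod_le_cvec_norm) simp
      also have "\<dots> \<le> e * t" using le by (simp add: gp)
      finally show ?thesis using t by (simp add: mult.commute)
    qed
    have "cmod (?w $ i) \<le> 0" by (rule field_le_epsilon) (simp only: add_0 le)
    then show ?thesis by simp
  qed
  show ?thesis
  proof (rule dim_le_of_injective_on_slice[OF DE_carrier _ _ slice])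
    show "d \<le> n" using M by (simp add: complex_submanifold_def)
    fix v assume v: "v \<in> carrier_vec n" "(D' * E) *\<^sub>v v = 0\<^sub>v n"
    have Ev: "E *\<^sub>v v \<in> carrier_vec n" using mats v by auto
    \<comment> \<open>Since E' D' = I, a kernel vector of D' E is already killed by
      \<open>E\<close>; then D E = I makes it zero.\<close>
    have "E *\<^sub>v v = (E' * D') *\<^sub>v (E *\<^sub>v v)" using DE' Ev by simp
    also have "\<dots> = E' *\<^sub>v ((D' * E) *\<^sub>v v)"
      using assoc_mult_mat_vec[OF mats(4,3) Ev] assoc_mult_mat_vec[OF mats(3,2) v(1)] by simp
    also have "\<dots> = 0\<^sub>v n" using v mats by (intro eq_vecI) auto
    finally have "E *\<^sub>v v = 0\<^sub>v n" .
    then have "(D * E) *\<^sub>v v = 0\<^sub>v n"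
      using assoc_mult_mat_vec[OF mats(1,2) v(1)] mats by (intro eq_vecI) auto
    then show "v = 0\<^sub>v n" using DE v by simp
  qed
qed

text \<open>The empty set is a submanifold of every dimension up to \<open>n\<close>, so
  nonemptiness is what makes the definite description well defined.\<close>

lemma complex_dim_eq:
  assumes "complex_submanifold n d M" "M \<noteq> {}"
  shows "complex_dim n M = d"
  unfolding complex_dim_def
  using assms complex_submanifold_dim_le by (intro the_equality) (auto intro: antisym)

section \<open>Linear and affine changes of coordinates\<close>

text \<open>The type \<open>complex vec\<close> contains vectors of all sizes, so linearity is
  required on a carrier only and both dimensions are explicit.\<close>

definition clinear_vec :: "nat \<Rightarrow> nat \<Rightarrow> (complex vec \<Rightarrow> complex vec) \<Rightarrow> bool" where
  "clinear_vec n m F \<longleftrightarrow> (\<forall>v\<in>carrier_vec n. F v \<in> carrier_vec m) \<and>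
     (\<forall>v\<in>carrier_vec n. \<forall>w\<in>carrier_vec n. F (v + w) = F v + F w) \<and>
     (\<forall>c. \<forall>v\<in>carrier_vec n. F (c \<cdot>\<^sub>v v) = c \<cdot>\<^sub>v F v)"

lemma clinear_vecD:
  assumes "clinear_vec n m F"
  shows "v \<in> carrier_vec n \<Longrightarrow> F v \<in> carrier_vec m"
    "v \<in> carrier_vec n \<Longrightarrow> w \<in> carrier_vec n \<Longrightarrow> F (v + w) = F v + F w"
    "v \<in> carrier_vec n \<Longrightarrow> F (c \<cdot>\<^sub>v v) = c \<cdot>\<^sub>v F v"
  using assms by (auto simp: clinear_vec_def)

lemma clinear_vec_zero: "clinear_vec n m F \<Longrightarrow> F (0\<^sub>v n) = 0\<^sub>v m"
proof -
  assume F: "clinear_vec n m F"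
  have "0\<^sub>v n = 0 \<cdot>\<^sub>v (0\<^sub>v n :: complex vec)" by (intro eq_vecI) auto
  then have "F (0\<^sub>v n) = 0 \<cdot>\<^sub>v F (0\<^sub>v n)" using clinear_vecD(3)[OF F, of "0\<^sub>v n" 0] by simp
  also have "\<dots> = 0\<^sub>v m" using clinear_vecD(1)[OF F, of "0\<^sub>v n"] by (intro eq_vecI) auto
  finally show ?thesis .
qed

lemma clinear_vec_mat:
  assumes F: "clinear_vec n m F"
  obtains D where "D \<in> carrier_mat m n" "\<And>v. v \<in> carrier_vec n \<Longrightarrow> F v = D *\<^sub>v v"
proof -
  define D where "D = mat m n (\<lambda>(i, j). F (unit_vec n j) $ i)"
  have D: "D \<in> carrier_mat m n" by (simp add: D_def)
  have unit: "F (unit_vec n j) = D *\<^sub>v unit_vec n j" if "j < n" for j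
    using that clinear_vecD(1)[OF F, of "unit_vec n j"]
    by (intro eq_vecI) (auto simp: D_def scalar_prod_right_unit)
  \<comment> \<open>Induction on a bound \<open>k\<close> for the support of \<open>v\<close>: the
    last possibly nonzero entry is split off as a multiple of a unit vector.\<close>
  have "F v = D *\<^sub>v v" if "k \<le> n" "v \<in> carrier_vec n" "\<And>i. k \<le> i \<Longrightarrow> i < n \<Longrightarrow> v $ i = 0" for k v
    using that
  proof (induction k arbitrary: v)
    case 0
    then have "v = 0\<^sub>v n" by (intro eq_vecI) auto
    moreover have "D *\<^sub>v 0\<^sub>v n = 0\<^sub>v m" using D by (intro eq_vecI) auto
    ultimately show ?case using clinear_vec_zero[OF F] by simp
  next
    case (Suc k)
    define w where "w = vec n (\<lambda>i. if i = k then 0 else v $ i)"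
    have w: "w \<in> carrier_vec n" by (simp add: w_def)
    have v: "v = w + v $ k \<cdot>\<^sub>v unit_vec n k"
      using Suc.prems by (intro eq_vecI) (auto simp: w_def unit_vec_def)
    have "F w = D *\<^sub>v w"
    proof (rule Suc.IH[OF _ w])
      fix i assume "k \<le> i" "i < n"
      then show "w $ i = 0" using Suc.prems(3)[of i] by (auto simp: w_def)
    qed (use Suc.prems in simp)
    then have "F (w + v $ k \<cdot>\<^sub>v unit_vec n k) = D *\<^sub>v w + v $ k \<cdot>\<^sub>v (D *\<^sub>v unit_vec n k)"
      using clinear_vecD[OF F] w unit[of k] Suc.prems(1) by simp
    also have "\<dots> = D *\<^sub>v (w + v $ k \<cdot>\<^sub>v unit_vec n k)"
      using D w by (simp add: mult_add_distrib_mat_vec[OF D] mult_mat_vec[OF D])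
    finally show ?case using v by simp
  qed
  from this[of n] D show ?thesis by (intro that) auto
qed

lemma affine_has_cvec_derivative:
  assumes F: "clinear_vec n n F" and b: "b \<in> carrier_vec n" and "p \<in> carrier_vec n" "U \<subseteq> carrier_vec n"
  obtains D where "has_cvec_derivative n (\<lambda>v. F v + b) D p U"
proof -
  obtain D where D: "D \<in> carrier_mat n n" "\<And>v. v \<in> carrier_vec n \<Longrightarrow> F v = D *\<^sub>v v"
    using clinear_vec_mat[OF F] by blast
  have "(F q + b) - (F p + b) - D *\<^sub>v (q - p) = 0\<^sub>v n" if "q \<in> U" for q
  proof -
    have q: "q \<in> carrier_vec n" using that assms by auto
    show ?thesis
      using D q assms mult_minus_distrib_mat_vec[OF D(1) q assms(3)] by (intro eq_vecI) auto
  qed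
  then have "has_cvec_derivative n (\<lambda>v. F v + b) D p U"
    unfolding has_cvec_derivative_def using D(1) by (auto intro: exI[of _ 1])
  then show ?thesis by (rule that)
qed

lemma affine_cvec_holomorphic:
  assumes "clinear_vec n n F" "b \<in> carrier_vec n" "U \<subseteq> carrier_vec n"
  shows "cvec_holomorphic n (\<lambda>v. F v + b) U"
  unfolding cvec_holomorphic_iff
proof
  fix p assume "p \<in> U"
  then have "p \<in> carrier_vec n" using assms by auto
  then show "\<exists>D. has_cvec_derivative n (\<lambda>v. F v + b) D p U"
    using affine_has_cvec_derivative[OF assms(1,2) _ assms(3)] by metis
qed

lemma cvec_open_UNIV: "cvec_open n (carrier_vec n)"
  unfolding cvec_open_def by (auto intro: exI[of _ 1])

text \<open>The target is written as a preimage under the inverse map, which is itself affine with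
  translation part \<open>- G b\<close>; so its openness is an instance of
  \<open>cvec_open_preimage\<close>.\<close>

lemma affine_cvec_biholomorphic:
  assumes F: "clinear_vec n n F" and G: "clinear_vec n n G"
    and FG: "\<And>v. v \<in> carrier_vec n \<Longrightarrow> G (F v) = v" "\<And>v. v \<in> carrier_vec n \<Longrightarrow> F (G v) = v"
    and b: "b \<in> carrier_vec n" and U: "cvec_open n U"
  shows "cvec_biholomorphic n (\<lambda>v. F v + b) U {w \<in> carrier_vec n. G (w - b) \<in> U}"
proof -
  have C: "U \<subseteq> carrier_vec n" using U by (rule cvec_open_carrier)
  note Fc = clinear_vecD[OF F] and Gc = clinear_vecD[OF G]
  have "G (w - b) = G w + - G b" if "w \<in> carrier_vec n" for w
  proof -
    have "w - b = w + (- 1) \<cdot>\<^sub>v b" using that b by (intro eq_vecI) auto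
    then have "G (w - b) = G w + (- 1) \<cdot>\<^sub>v G b" using Gc that b by simp
    then show ?thesis using Gc that b by (intro eq_vecI) auto
  qed
  moreover have "- G b \<in> carrier_vec n" using Gc b by simp
  ultimately have hol: "cvec_holomorphic n (\<lambda>w. G (w - b)) V" if "V \<subseteq> carrier_vec n" for V
    using cvec_holomorphic_cong[of V "\<lambda>w. G (w - b)" "\<lambda>w. G w + - G b" n]
      affine_cvec_holomorphic[OF G, of "- G b" V] that by auto
  show ?thesis
  proof (rule cvec_biholomorphicI[OF U, where g = "\<lambda>w. G (w - b)"])
    show "cvec_open n {w \<in> carrier_vec n. G (w - b) \<in> U}"
      by (rule cvec_open_preimage[OF hol _ cvec_open_UNIV U]) (use Gc b in auto)
    have *: "F v + b - b = F v" if "v \<in> U" for v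
    proof -
      have "F v \<in> carrier_vec n" using that C Fc(1) by auto
      then show ?thesis using b by (intro eq_vecI) auto
    qed
    show "(\<lambda>v. F v + b) ` U \<subseteq> {w \<in> carrier_vec n. G (w - b) \<in> U}"
      using FG * C Fc b by auto
    show "G (F v + b - b) = v" if "v \<in> U" for v using FG * C that by auto
    show "F (G (y - b)) + b = y" if "y \<in> {w \<in> carrier_vec n. G (w - b) \<in> U}" for y
    proof -
      have "y \<in> carrier_vec n" using that by simp
      then show ?thesis using FG(2)[of "y - b"] b by (simp add: minus_add_uminus_vec)
    qed
  qed (use hol affine_cvec_holomorphic[OF F b C] in auto)
qed

section \<open>Matrix inversion and the Cayley transform\<close>

definition square_of_vec :: "nat \<Rightarrow> complex vec \<Rightarrow> complex mat" where
  "square_of_vec k v = mat k k (\<lambda>(i, j). v $ (i * k + j))"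

lemma square_of_vec_carrier [simp]: "square_of_vec k v \<in> carrier_mat k k"
  "dim_row (square_of_vec k v) = k" "dim_col (square_of_vec k v) = k"
  by (auto simp: square_of_vec_def)

lemma vec_of_square_carrier [simp]: "vec_of_square k M \<in> carrier_vec (k * k)"
  "dim_vec (vec_of_square k M) = k * k"
  by (auto simp: vec_of_square_def)

lemma square_index_less: "i < k \<Longrightarrow> j < k \<Longrightarrow> i * k + j < k * (k :: nat)"
proof -
  assume "i < k" "j < k"
  then have "i * k + j < Suc i * k" by simp
  also have "\<dots> \<le> k * k" using \<open>i < k\<close> by (intro mult_le_mono1) auto
  finally show ?thesis .
qed

lemma div_less_of_less_square: "l < k * k \<Longrightarrow> l div k < (k :: nat)" "l < k * k \<Longrightarrow> l mod k < k"
  by (cases k; simp add: less_mult_imp_div_less)+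

lemma vec_of_square_of_vec [simp]: "v \<in> carrier_vec (k * k) \<Longrightarrow> vec_of_square k (square_of_vec k v) = v"
  by (intro eq_vecI) (auto simp: vec_of_square_def square_of_vec_def div_less_of_less_square)

lemma square_of_vec_of_square [simp]: "M \<in> carrier_mat k k \<Longrightarrow> square_of_vec k (vec_of_square k M) = M"
  by (intro eq_matI) (auto simp: vec_of_square_def square_of_vec_def square_index_less)

lemma vec_of_square_add: "A \<in> carrier_mat k k \<Longrightarrow> B \<in> carrier_mat k k \<Longrightarrow>
    vec_of_square k (A + B) = vec_of_square k A + vec_of_square k B"
  by (intro eq_vecI) (auto simp: vec_of_square_def div_less_of_less_square)

lemma vec_of_square_minus: "A \<in> carrier_mat k k \<Longrightarrow> B \<in> carrier_mat k k \<Longrightarrow>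
    vec_of_square k (A - B) = vec_of_square k A - vec_of_square k B"
  by (intro eq_vecI) (auto simp: vec_of_square_def div_less_of_less_square)

lemma vec_of_square_smult: "A \<in> carrier_mat k k \<Longrightarrow>
    vec_of_square k (c \<cdot>\<^sub>m A) = c \<cdot>\<^sub>v vec_of_square k A"
  by (intro eq_vecI) (auto simp: vec_of_square_def div_less_of_less_square)

lemma square_of_vec_add: "v \<in> carrier_vec (k * k) \<Longrightarrow> w \<in> carrier_vec (k * k) \<Longrightarrow>
    square_of_vec k (v + w) = square_of_vec k v + square_of_vec k w"
  by (intro eq_matI) (auto simp: square_of_vec_def square_index_less)

lemma square_of_vec_smult: "v \<in> carrier_vec (k * k) \<Longrightarrow>
    square_of_vec k (c \<cdot>\<^sub>v v) = c \<cdot>\<^sub>m square_of_vec k v"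
  by (intro eq_matI) (auto simp: square_of_vec_def square_index_less)

text \<open>This single shape covers the derivative -R H R of inversion and the right
  multiplications by 2 Q0 and by Q0^T / 2 in the Cayley chart.\<close>

lemma clinear_vec_mult_left_right:
  assumes A: "A \<in> carrier_mat k k" and B: "B \<in> carrier_mat k k"
  shows "clinear_vec (k * k) (k * k) (\<lambda>v. vec_of_square k (c \<cdot>\<^sub>m (A * square_of_vec k v * B)))"
  unfolding clinear_vec_def
proof (intro conjI ballI allI)
  fix v w :: "complex vec" and a assume v: "v \<in> carrier_vec (k * k)" and w: "w \<in> carrier_vec (k * k)"
  show "vec_of_square k (c \<cdot>\<^sub>m (A * square_of_vec k (v + w) * B)) =
    vec_of_square k (c \<cdot>\<^sub>m (A * square_of_vec k v * B)) + vec_of_square k (c \<cdot>\<^sub>m (A * square_of_vec k w * B))"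
  proof -
    have c: "A * square_of_vec k u \<in> carrier_mat k k" "A * square_of_vec k u * B \<in> carrier_mat k k" for u
      using A B by auto
    have "A * square_of_vec k (v + w) * B = A * square_of_vec k v * B + A * square_of_vec k w * B"
      unfolding square_of_vec_add[OF v w]
      by (simp add: mult_add_distrib_mat[OF A, of _ k] add_mult_distrib_mat[OF c(1) c(1) B])
    then show ?thesis
      using add_smult_distrib_left_mat[OF c(2) c(2)] c by (simp add: vec_of_square_add)
  qed
next
  fix v :: "complex vec" and a assume v: "v \<in> carrier_vec (k * k)"
  show "vec_of_square k (c \<cdot>\<^sub>m (A * square_of_vec k (a \<cdot>\<^sub>v v) * B)) =
    a \<cdot>\<^sub>v vec_of_square k (c \<cdot>\<^sub>m (A * square_of_vec k v * B))"
  proof -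
    have c: "A * square_of_vec k v \<in> carrier_mat k k" "A * square_of_vec k v * B \<in> carrier_mat k k"
      using A B by auto
    have "A * square_of_vec k (a \<cdot>\<^sub>v v) * B = a \<cdot>\<^sub>m (A * square_of_vec k v * B)"
      unfolding square_of_vec_smult[OF v]
      by (simp add: mult_smult_distrib[OF A, of _ k] mult_smult_assoc_mat[OF c(1) B])
    moreover have "c \<cdot>\<^sub>m (a \<cdot>\<^sub>m M) = a \<cdot>\<^sub>m (c \<cdot>\<^sub>m M)" for M :: "complex mat"
      by (intro eq_matI) auto
    ultimately show ?thesis using c by (simp add: vec_of_square_smult)
  qed
qed simp

lemma cmod_le_cvec_norm_square:
  assumes "M \<in> carrier_mat k k" "i < k" "j < k"
  shows "cmod (M $$ (i, j)) \<le> cvec_norm (vec_of_square k M)"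
  using cmod_le_cvec_norm[of "i * k + j" "vec_of_square k M"] square_index_less[OF assms(2,3)] assms
  by (simp add: vec_of_square_def)

text \<open>An entry of the product is at most k |A| |B|, and summing the k^2 entries gives k^3. The
  added 1 makes the factor at least 1 also for k = 0.\<close>

lemma cvec_norm_square_mult:
  assumes A: "A \<in> carrier_mat k k" and B: "B \<in> carrier_mat k k"
  shows "cvec_norm (vec_of_square k (A * B)) \<le>
    (real k ^ 3 + 1) * cvec_norm (vec_of_square k A) * cvec_norm (vec_of_square k B)"
proof -
  let ?a = "cvec_norm (vec_of_square k A)" and ?b = "cvec_norm (vec_of_square k B)"
  have entry: "cmod ((A * B) $$ (i, j)) \<le> real k * (?a * ?b)" if "i < k" "j < k" for i j
  proof -
    have "cmod ((A * B) $$ (i, j)) = cmod (\<Sum>l\<in>{0..<k}. A $$ (i, l) * B $$ (l, j))"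
      using A B that by (simp add: scalar_prod_def)
    also have "\<dots> \<le> (\<Sum>l\<in>{0..<k}. cmod (A $$ (i, l) * B $$ (l, j)))" by (rule norm_sum)
    also have "\<dots> \<le> (\<Sum>l\<in>{0..<k}. ?a * ?b)" unfolding norm_mult
      using A B that by (intro sum_mono mult_mono cmod_le_cvec_norm_square) auto
    finally show ?thesis by simp
  qed
  have "cvec_norm (vec_of_square k (A * B)) \<le> (\<Sum>l<k * k. cmod (vec_of_square k (A * B) $ l))"
    using cvec_norm_le_sum[of "vec_of_square k (A * B)"] by simp
  also have "\<dots> \<le> (\<Sum>l<k * k. real k * (?a * ?b))"
    by (intro sum_mono) (auto simp: vec_of_square_def[of k "A * B"] intro!: entry div_less_of_less_square)
  also have "\<dots> = real k ^ 3 * (?a * ?b)" by (simp add: power3_eq_cube)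
  also have "\<dots> \<le> (real k ^ 3 + 1) * (?a * ?b)" by (intro mult_right_mono) auto
  finally show ?thesis by (simp only: mult.assoc)
qed

section \<open>Holomorphy of matrix inversion\<close>

lemma mat_inverse_det_nonzero:
  fixes W :: "complex mat"
  assumes W: "W \<in> carrier_mat k k" and det: "det W \<noteq> 0"
  shows "the (mat_inverse W) \<in> carrier_mat k k" "W * the (mat_inverse W) = 1\<^sub>m k"
    "the (mat_inverse W) * W = 1\<^sub>m k"
proof -
  have "W \<in> Units (ring_mat TYPE(complex) k 0)" using W det by (rule det_non_zero_imp_unit)
  then have "mat_inverse W \<noteq> None" using mat_inverse(1)[OF W, where b = 0] by blast
  then obtain R where "mat_inverse W = Some R" by auto
  with mat_inverse(2)[OF W this] show "the (mat_inverse W) \<in> carrier_mat k k"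
    "W * the (mat_inverse W) = 1\<^sub>m k" "the (mat_inverse W) * W = 1\<^sub>m k" by auto
qed

lemma det_nonzero_of_mult_eq_one:
  fixes W :: "complex mat"
  assumes "W \<in> carrier_mat k k" "R \<in> carrier_mat k k" "W * R = 1\<^sub>m k"
  shows "det W \<noteq> 0" "det R \<noteq> 0"
  using det_mult[OF assms(1,2)] assms(3) by auto

lemma mat_inverse_eqI:
  fixes W :: "complex mat"
  assumes W: "W \<in> carrier_mat k k" and R: "R \<in> carrier_mat k k" and WR: "W * R = 1\<^sub>m k"
  shows "the (mat_inverse W) = R"
proof -
  note I = mat_inverse_det_nonzero[OF W det_nonzero_of_mult_eq_one(1)[OF W R WR]]
  have "the (mat_inverse W) = the (mat_inverse W) * (W * R)" using I WR by simp
  also have "\<dots> = R" using I W R by (simp flip: assoc_mult_mat[of _ k k])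
  finally show ?thesis .
qed

text \<open>With S the inverse of W + H and A = H R, the equation R = S + S A yields the exact
  identity S - R + R H R = S A A, which is quadratic in H. So -R H R is the first-order term of
  inversion at \<open>W\<close>, with an explicit remainder.\<close>

lemma mat_inverse_perturb:
  fixes W H R :: "complex mat" and k :: nat
  defines "\<nu> \<equiv> \<lambda>M. cvec_norm (vec_of_square k M)" and "K \<equiv> real k ^ 3 + 1"
  assumes W: "W \<in> carrier_mat k k" and R: "R \<in> carrier_mat k k" and H: "H \<in> carrier_mat k k"
    and RW: "R * W = 1\<^sub>m k" and small: "K ^ 2 * \<nu> H * \<nu> R \<le> 1 / 2"
  shows "det (W + H) \<noteq> 0"
    and "\<nu> (the (mat_inverse (W + H)) - R + R * H * R) \<le> 2 * K ^ 4 * \<nu> R ^ 3 * \<nu> H ^ 2"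
proof -
  have K: "K \<ge> 1" "K > 0" "real (k * k) \<le> K"
  proof -
    show "K \<ge> 1" "K > 0" by (auto simp: K_def add_nonneg_pos)
    have "k * k \<le> k ^ 3" by (cases k) (auto simp: power3_eq_cube)
    then show "real (k * k) \<le> K" unfolding K_def
      by (metis add_increasing2 of_nat_le_iff of_nat_power zero_le_one)
  qed
  have nn: "\<nu> M \<ge> 0" for M by (simp add: \<nu>_def)
  have mult: "\<nu> (A * B) \<le> K * \<nu> A * \<nu> B" if "A \<in> carrier_mat k k" "B \<in> carrier_mat k k" for A B
    unfolding \<nu>_def K_def using cvec_norm_square_mult[OF that] .
  have WR: "W * R = 1\<^sub>m k" by (rule mat_mult_left_right_inverse[OF R W RW])
  \<comment> \<open>A kernel vector v of W + H satisfies v = - R H v, and the smallness hypothesis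
    bounds the right side by |v| / 2, so v = 0.\<close>
  show det: "det (W + H) \<noteq> 0"
  proof
    assume "det (W + H) = 0"
    then obtain v where v: "v \<in> carrier_vec k" "v \<noteq> 0\<^sub>v k" "(W + H) *\<^sub>v v = 0\<^sub>v k"
      using det_0_iff_vec_prod_zero[of "W + H" k] W H by auto
    have RH: "R * H \<in> carrier_mat k k" using R H by simp
    have "0\<^sub>v k = R *\<^sub>v ((W + H) *\<^sub>v v)" using v R by (intro eq_vecI) auto
    also have "(W + H) *\<^sub>v v = W *\<^sub>v v + H *\<^sub>v v" by (rule add_mult_distrib_mat_vec[OF W H v(1)])
    also have "R *\<^sub>v \<dots> = R *\<^sub>v (W *\<^sub>v v) + R *\<^sub>v (H *\<^sub>v v)"
      using W H v(1) by (intro mult_add_distrib_mat_vec[OF R]) auto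
    also have "\<dots> = (R * W) *\<^sub>v v + (R * H) *\<^sub>v v"
      by (simp only: assoc_mult_mat_vec[OF R W v(1)] assoc_mult_mat_vec[OF R H v(1)])
    finally have eq: "v + (R * H) *\<^sub>v v = 0\<^sub>v k" using v RW by simp
    have "v = - ((R * H) *\<^sub>v v)"
    proof (rule eq_vecI)
      fix i assume "i < dim_vec (- ((R * H) *\<^sub>v v))"
      then have i: "i < k" using R by simp
      then have "(v + (R * H) *\<^sub>v v) $ i = 0" using eq by simp
      then show "v $ i = (- ((R * H) *\<^sub>v v)) $ i" using i R by (simp add: eq_neg_iff_add_eq_0)
    qed (use v R in auto)
    then have "cvec_norm v = cvec_norm ((R * H) *\<^sub>v v)" by (metis cvec_norm_uminus)
    also have "\<dots> \<le> real (k * k) * \<nu> (R * H) * cvec_norm v"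
      using cvec_norm_mult_mat_vec_le[OF RH v(1)] cmod_le_cvec_norm_square[OF RH] unfolding \<nu>_def by blast
    also have "\<dots> \<le> K * (K * \<nu> R * \<nu> H) * cvec_norm v"
      using K mult[OF R H] nn by (intro mult_right_mono mult_mono) auto
    also have "\<dots> = (K ^ 2 * \<nu> H * \<nu> R) * cvec_norm v" by (simp add: power2_eq_square mult_ac)
    also have "\<dots> \<le> 1 / 2 * cvec_norm v" using small by (intro mult_right_mono) auto
    finally have "cvec_norm v = 0" using cvec_norm_nonneg[of v] by linarith
    then show False using v cvec_norm_eq_0D by blast
  qed
  define S where "S = the (mat_inverse (W + H))"
  have S: "S \<in> carrier_mat k k" "S * (W + H) = 1\<^sub>m k"
    using mat_inverse_det_nonzero[OF _ det] W H by (auto simp: S_def)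
  let ?A = "H * R"
  have A: "?A \<in> carrier_mat k k" using H R by simp
  have "R = (S * (W + H)) * R" using S R by simp
  also have "\<dots> = S * ((W + H) * R)" using S(1) R W H by (intro assoc_mult_mat) auto
  also have "\<dots> = S * (1\<^sub>m k + ?A)" using WR by (simp add: add_mult_distrib_mat[OF W H R])
  also have "\<dots> = S + S * ?A" using S by (simp add: mult_add_distrib_mat[OF S(1) one_carrier_mat A])
  finally have R_eq: "R = S + S * ?A" .
  have "R * ?A = (S + S * ?A) * ?A" by (rule arg_cong[OF R_eq])
  also have "\<dots> = S * ?A + S * ?A * ?A" using S A by (intro add_mult_distrib_mat[of _ k k]) auto
  finally have RA: "R * ?A = S * ?A + S * ?A * ?A" .
  have SA: "S * ?A \<in> carrier_mat k k" "S * ?A * ?A \<in> carrier_mat k k" using S A by auto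
  have eq: "S - R + R * H * R = S * ?A * ?A"
  proof (rule eq_matI)
    fix i j assume "i < dim_row (S * ?A * ?A)" "j < dim_col (S * ?A * ?A)"
    then have ij: "i < k" "j < k" using S R by auto
    have "R * H * R = R * ?A" using R H by simp
    then have "(S - R + R * H * R) $$ (i, j) = S $$ (i, j) - R $$ (i, j) + (R * ?A) $$ (i, j)"
      using ij R S A by simp
    also have "R $$ (i, j) = S $$ (i, j) + (S * ?A) $$ (i, j)"
      using ij S SA arg_cong[OF R_eq, of "\<lambda>M. M $$ (i, j)"] by (simp del: index_mult_mat)
    also have "(R * ?A) $$ (i, j) = (S * ?A) $$ (i, j) + (S * ?A * ?A) $$ (i, j)"
      using ij SA by (simp add: RA del: index_mult_mat)
    finally show "(S - R + R * H * R) $$ (i, j) = (S * ?A * ?A) $$ (i, j)" by simp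
  qed (use S R in auto)
  have nA: "\<nu> ?A \<le> K * \<nu> H * \<nu> R" using mult H R by simp
  \<comment> \<open>Absorption: |S| <= |R| + |S A|, and smallness gives |S A| <= |S| / 2.\<close>
  have nS: "\<nu> S \<le> 2 * \<nu> R"
  proof -
    have "S = R - S * ?A"
    proof (rule eq_matI)
      fix i j assume "i < dim_row (R - S * ?A)" "j < dim_col (R - S * ?A)"
      then show "S $$ (i, j) = (R - S * ?A) $$ (i, j)"
        using S SA R arg_cong[OF R_eq, of "\<lambda>M. M $$ (i, j)"] by (simp del: index_mult_mat(1))
    qed (use S R in auto)
    then have "\<nu> S = cvec_norm (vec_of_square k R - vec_of_square k (S * ?A))"
      unfolding \<nu>_def using vec_of_square_minus[OF R SA(1)] by simp
    also have "\<dots> \<le> \<nu> R + \<nu> (S * ?A)" unfolding \<nu>_def by (rule cvec_norm_diff[where n = "k * k"]) simp_all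
    finally have 1: "\<nu> S \<le> \<nu> R + \<nu> (S * ?A)" .
    have "\<nu> (S * ?A) \<le> K * \<nu> S * \<nu> ?A" using mult S A by simp
    also have "\<dots> \<le> K * \<nu> S * (K * \<nu> H * \<nu> R)" using nA nn K by (intro mult_left_mono) auto
    also have "\<dots> = (K ^ 2 * \<nu> H * \<nu> R) * \<nu> S" by (simp add: power2_eq_square mult_ac)
    also have "\<dots> \<le> 1 / 2 * \<nu> S" using small nn by (intro mult_right_mono) auto
    finally show ?thesis using 1 by linarith
  qed
  have "\<nu> (S * ?A * ?A) \<le> K * \<nu> (S * ?A) * \<nu> ?A" using mult SA A by simp
  also have "\<dots> \<le> K * (K * \<nu> S * \<nu> ?A) * \<nu> ?A"
    using mult[OF S(1) A] nn K by (intro mult_right_mono mult_left_mono) auto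
  \<comment> \<open>The 2 comes from |S| <= 2 |R|. Of the four factors \<open>K\<close>, two come
    from the two products and two from the bound on H R, used twice.\<close>
  also have "\<dots> \<le> K * (K * (2 * \<nu> R) * (K * \<nu> H * \<nu> R)) * (K * \<nu> H * \<nu> R)"
    using nS nA nn K by (intro mult_mono) (auto intro!: mult_nonneg_nonneg)
  also have "\<dots> = 2 * K ^ 4 * \<nu> R ^ 3 * \<nu> H ^ 2" by (simp add: power2_eq_square power3_eq_cube power4_eq_xxxx mult_ac)
  finally show "\<nu> (the (mat_inverse (W + H)) - R + R * H * R) \<le> 2 * K ^ 4 * \<nu> R ^ 3 * \<nu> H ^ 2"
    using eq by (simp add: S_def)
qed

definition gl_vec :: "nat \<Rightarrow> complex vec set" where
  "gl_vec k = {q \<in> carrier_vec (k * k). det (square_of_vec k q) \<noteq> 0}"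

definition inv_vec :: "nat \<Rightarrow> complex vec \<Rightarrow> complex vec" where
  "inv_vec k q = vec_of_square k (the (mat_inverse (square_of_vec k q)))"

lemma inv_vec_gl_vec: "q \<in> gl_vec k \<Longrightarrow> inv_vec k q \<in> gl_vec k" "q \<in> gl_vec k \<Longrightarrow> inv_vec k (inv_vec k q) = q"
proof -
  assume q: "q \<in> gl_vec k"
  let ?W = "square_of_vec k q"
  have W: "?W \<in> carrier_mat k k" "det ?W \<noteq> 0" "q \<in> carrier_vec (k * k)" using q by (auto simp: gl_vec_def)
  note I = mat_inverse_det_nonzero[OF W(1,2)]
  show "inv_vec k q \<in> gl_vec k"
    using I det_nonzero_of_mult_eq_one(2)[OF W(1) I(1,2)] by (simp add: gl_vec_def inv_vec_def)
  show "inv_vec k (inv_vec k q) = q"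
    using mat_inverse_eqI[OF I(1) W(1) I(3)] I W by (simp add: inv_vec_def)
qed

lemma gl_vec_perturb:
  assumes p: "p \<in> gl_vec k"
  obtains d C where "d > 0" "C > 0"
    "\<And>q. q \<in> carrier_vec (k * k) \<Longrightarrow> cvec_norm (q - p) < d \<Longrightarrow> q \<in> gl_vec k \<and>
       cvec_norm (inv_vec k q - inv_vec k p -
         vec_of_square k ((- 1) \<cdot>\<^sub>m (square_of_vec k (inv_vec k p) * square_of_vec k (q - p) * square_of_vec k (inv_vec k p))))
       \<le> C * cvec_norm (q - p) ^ 2"
proof -
  let ?W = "square_of_vec k p"
  let ?R = "the (mat_inverse ?W)"
  let ?r = "cvec_norm (vec_of_square k ?R)"
  define K where "K = real k ^ 3 + 1"
  have K: "K > 0" by (auto simp: K_def add_nonneg_pos)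
  have W: "?W \<in> carrier_mat k k" "det ?W \<noteq> 0" "p \<in> carrier_vec (k * k)" using p by (auto simp: gl_vec_def)
  note I = mat_inverse_det_nonzero[OF W(1,2)]
  have r: "?r \<ge> 0" by simp
  define C where "C = 2 * K ^ 4 * ?r ^ 3 + 1"
  \<comment> \<open>Makes K^2 |q - p| |R| at most 1 / 2, the smallness that
    \<open>mat_inverse_perturb\<close> asks for; the 1 added to \<open>?r\<close> keeps the
    denominator positive even for k = 0, where \<open>?r\<close> = 0.\<close>
  define d where "d = 1 / (2 * K ^ 2 * (?r + 1))"
  have C: "C > 0" using K by (auto simp: C_def add_nonneg_pos)
  have d: "d > 0" using K r by (auto simp: d_def add_nonneg_pos)
  show ?thesis
  proof (rule that[OF d C])
    fix q :: "complex vec" assume q: "q \<in> carrier_vec (k * k)" and qd: "cvec_norm (q - p) < d"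
    let ?H = "square_of_vec k (q - p)"
    have vH: "vec_of_square k ?H = q - p" using q W by simp
    have H: "?H \<in> carrier_mat k k" by simp
    have qp: "square_of_vec k q = ?W + ?H"
    proof -
      have "q = p + (q - p)" using q W by (intro eq_vecI) auto
      then show ?thesis using square_of_vec_add[of p k "q - p"] q W by simp
    qed
    have "K ^ 2 * cvec_norm (q - p) * ?r \<le> K ^ 2 * d * (?r + 1)"
      using qd r K d by (intro mult_mono) auto
    also have "\<dots> = 1 / 2"
    proof -
      have "?r + 1 \<noteq> 0" "2 * ?r + 2 \<noteq> 0" using r by linarith+
      then show ?thesis using K by (simp add: d_def divide_simps)
    qed
    finally have small: "(real k ^ 3 + 1) ^ 2 * cvec_norm (vec_of_square k ?H) * ?r \<le> 1 / 2"
      by (simp only: vH K_def)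
    note P = mat_inverse_perturb[OF W(1) I(1) H I(3) small]
    let ?S = "the (mat_inverse (?W + ?H))"
    have S: "?S \<in> carrier_mat k k" using mat_inverse_det_nonzero(1)[OF _ P(1)] by simp
    have "inv_vec k q - inv_vec k p - vec_of_square k ((- 1) \<cdot>\<^sub>m (?R * ?H * ?R)) =
       vec_of_square k (?S - ?R + ?R * ?H * ?R)"
      unfolding inv_vec_def qp using S I(1)
      by (intro eq_vecI) (auto simp: vec_of_square_def div_less_of_less_square simp del: index_mult_mat(1))
    moreover have "cvec_norm (vec_of_square k (?S - ?R + ?R * ?H * ?R)) \<le> C * cvec_norm (q - p) ^ 2"
      using P(2) unfolding vH C_def K_def distrib_right mult_1 by (rule add_increasing2[OF zero_le_power2])
    moreover have "square_of_vec k (inv_vec k p) = ?R" using I by (simp add: inv_vec_def)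
    ultimately show "q \<in> gl_vec k \<and>
       cvec_norm (inv_vec k q - inv_vec k p -
         vec_of_square k ((- 1) \<cdot>\<^sub>m (square_of_vec k (inv_vec k p) * ?H * square_of_vec k (inv_vec k p))))
       \<le> C * cvec_norm (q - p) ^ 2"
      using P(1) q qp by (simp add: gl_vec_def)
  qed
qed

lemma cvec_open_gl_vec: "cvec_open (k * k) (gl_vec k)"
  unfolding cvec_open_def
proof (intro conjI ballI)
  fix p assume "p \<in> gl_vec k"
  from gl_vec_perturb[OF this] show "\<exists>e>0. \<forall>q\<in>carrier_vec (k * k). cvec_norm (q - p) < e \<longrightarrow> q \<in> gl_vec k"
    by metis
qed (auto simp: gl_vec_def)

lemma inv_vec_holomorphic: "cvec_holomorphic (k * k) (inv_vec k) (gl_vec k)"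
  unfolding cvec_holomorphic_iff
proof
  fix p assume p: "p \<in> gl_vec k"
  let ?R = "square_of_vec k (inv_vec k p)"
  obtain D where D: "D \<in> carrier_mat (k * k) (k * k)"
    "\<And>v. v \<in> carrier_vec (k * k) \<Longrightarrow> vec_of_square k ((- 1) \<cdot>\<^sub>m (?R * square_of_vec k v * ?R)) = D *\<^sub>v v"
    using clinear_vec_mat[OF clinear_vec_mult_left_right[of ?R k ?R "- 1"]] by auto
  obtain d C where d: "d > 0" and C: "C > 0" and P:
    "\<And>q. q \<in> carrier_vec (k * k) \<Longrightarrow> cvec_norm (q - p) < d \<Longrightarrow> q \<in> gl_vec k \<and>
       cvec_norm (inv_vec k q - inv_vec k p - vec_of_square k ((- 1) \<cdot>\<^sub>m (?R * square_of_vec k (q - p) * ?R)))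
       \<le> C * cvec_norm (q - p) ^ 2"
    using gl_vec_perturb[OF p] by blast
  have "has_cvec_derivative (k * k) (inv_vec k) D p (gl_vec k)"
    unfolding has_cvec_derivative_def
  proof (intro conjI allI impI)
    fix e :: real assume e: "e > 0"
    show "\<exists>d>0. \<forall>q\<in>gl_vec k. cvec_norm (q - p) < d \<longrightarrow>
        cvec_norm (inv_vec k q - inv_vec k p - D *\<^sub>v (q - p)) \<le> e * cvec_norm (q - p)"
    \<comment> \<open>Within e / C of p the quadratic remainder C |q - p|^2 is at most e |q -
      p|.\<close>
    proof (intro exI[of _ "min d (e / C)"] conjI ballI impI)
      show "min d (e / C) > 0" using d e C by simp
      fix q assume q: "q \<in> gl_vec k" "cvec_norm (q - p) < min d (e / C)"
      have c: "q \<in> carrier_vec (k * k)" "p \<in> carrier_vec (k * k)" using p q by (auto simp: gl_vec_def)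
      have "cvec_norm (inv_vec k q - inv_vec k p - D *\<^sub>v (q - p)) \<le> C * cvec_norm (q - p) ^ 2"
        using P[OF c(1)] q c D(2)[of "q - p"] by simp
      also have "\<dots> = (C * cvec_norm (q - p)) * cvec_norm (q - p)" by (simp add: power2_eq_square)
      also have "\<dots> \<le> e * cvec_norm (q - p)"
        using q C by (intro mult_right_mono) (auto simp: pos_less_divide_eq mult.commute less_imp_le)
      finally show "cvec_norm (inv_vec k q - inv_vec k p - D *\<^sub>v (q - p)) \<le> e * cvec_norm (q - p)" .
    qed
  qed (rule D(1))
  then show "\<exists>D. has_cvec_derivative (k * k) (inv_vec k) D p (gl_vec k)" ..
qed

lemma inv_vec_biholomorphic: "cvec_biholomorphic (k * k) (inv_vec k) (gl_vec k) (gl_vec k)"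
  by (rule cvec_biholomorphicI[where g = "inv_vec k"])
     (auto simp: cvec_open_gl_vec inv_vec_gl_vec inv_vec_holomorphic)

text \<open>Side conditions on dimensions instead of carriers let the simplifier discharge them, so
  that associativity works as a rewrite rule for long products.\<close>

lemma mat_mult_assoc_dim:
  fixes A B C :: "complex mat"
  shows "dim_col A = dim_row B \<Longrightarrow> dim_col B = dim_row C \<Longrightarrow> A * B * C = A * (B * C)"
  by (rule assoc_mult_mat) auto

lemma mat_distrib_dim:
  fixes A B C :: "complex mat"
  shows "dim_row A = dim_row B \<Longrightarrow> dim_col A = dim_col B \<Longrightarrow> dim_col A = dim_row C \<Longrightarrow> (A + B) * C = A * C + B * C"
    "dim_row B = dim_row C \<Longrightarrow> dim_col B = dim_col C \<Longrightarrow> dim_col A = dim_row B \<Longrightarrow> A * (B + C) = A * B + A * C"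
  by (rule add_mult_distrib_mat[of _ "dim_row A" "dim_col A"]; auto)
     (rule mult_add_distrib_mat[of _ "dim_row A" "dim_row B" _ "dim_col B"]; auto)

section \<open>The Cayley chart of the stabilizer\<close>

text \<open>The Lie algebra of the stabilizer: the equations Q^T Q = I and Q B = B Q, differentiated
  at the identity.\<close>

definition skew_commutant :: "complex mat \<Rightarrow> complex mat set" where
  "skew_commutant B = {X \<in> carrier_mat (dim_row B) (dim_row B). X\<^sup>T = - X \<and> X * B = B * X}"

text \<open>An orthogonal matrix has its transpose as inverse, so invariance under conjugation
  becomes commutation, a condition linear in \<open>Q\<close>.\<close>

lemma orth_stab_iff:
  assumes B: "B \<in> carrier_mat k k"
  shows "Q \<in> orth_stab B \<longleftrightarrow> Q \<in> carrier_mat k k \<and> Q\<^sup>T * Q = 1\<^sub>m k \<and> Q * B = B * Q"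
proof (cases "Q \<in> carrier_mat k k \<and> Q\<^sup>T * Q = 1\<^sub>m k")
  case True
  then have Q: "Q \<in> carrier_mat k k" and QQ: "Q\<^sup>T * Q = 1\<^sub>m k" by auto
  have T: "Q\<^sup>T \<in> carrier_mat k k" using Q by simp
  have QT: "Q * Q\<^sup>T = 1\<^sub>m k" by (rule mat_mult_left_right_inverse[OF T Q QQ])
  have inv: "the (mat_inverse Q) = Q\<^sup>T" by (rule mat_inverse_eqI[OF Q T QT])
  have cancel: "dim_row Z = k \<Longrightarrow> Q * (Q\<^sup>T * Z) = Z" "dim_row Z = k \<Longrightarrow> Q\<^sup>T * (Q * Z) = Z" for Z
    using Q QQ QT by (simp_all flip: mat_mult_assoc_dim)
  have "Q\<^sup>T * B * Q = B \<longleftrightarrow> Q * B = B * Q"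
  proof
    assume "Q\<^sup>T * B * Q = B"
    then have "Q * (Q\<^sup>T * B * Q) = Q * B" by simp
    then show "Q * B = B * Q" using Q B by (simp add: mat_mult_assoc_dim cancel)
  next
    assume "Q * B = B * Q"
    then have "Q\<^sup>T * (B * Q) = Q\<^sup>T * (Q * B)" by simp
    then show "Q\<^sup>T * B * Q = B" using Q B by (simp add: mat_mult_assoc_dim cancel)
  qed
  then show ?thesis using True B by (simp add: orth_stab_def complex_orthogonal_def orth_sim_def inv)
qed (use B in \<open>auto simp: orth_stab_def complex_orthogonal_def\<close>)

lemma mat_commute_inverse:
  fixes W R B :: "complex mat"
  assumes c: "W \<in> carrier_mat k k" "R \<in> carrier_mat k k" "B \<in> carrier_mat k k"
    and i: "W * R = 1\<^sub>m k" "R * W = 1\<^sub>m k" and WB: "W * B = B * W"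
  shows "R * B = B * R"
proof -
  have cancel: "dim_row Z = k \<Longrightarrow> R * (W * Z) = Z" for Z
    using c i by (simp flip: mat_mult_assoc_dim)
  have "R * (W * B) * R = R * (B * W) * R" using WB by simp
  then show ?thesis using c i by (simp add: mat_mult_assoc_dim cancel)
qed

lemma mat_commute_mult:
  fixes P Q B :: "complex mat"
  assumes c: "P \<in> carrier_mat k k" "Q \<in> carrier_mat k k" "B \<in> carrier_mat k k"
    and "P * B = B * P" "Q * B = B * Q"
  shows "(P * Q) * B = B * (P * Q)"
proof -
  have "(P * Q) * B = P * (Q * B)" using c by (simp add: mat_mult_assoc_dim)
  also have "\<dots> = (P * B) * Q" using c assms(5) by (simp add: mat_mult_assoc_dim)
  also have "\<dots> = B * (P * Q)" using c assms(4) by (simp add: mat_mult_assoc_dim)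
  finally show ?thesis .
qed

text \<open>Put W = Q + Q0 and G = W^-1 Q0, so that the transform is 2 G - I. Since Q = W - Q0,
  orthogonality of Q reads W^T W = W^T Q0 + Q0^T W; multiplied by G^T on the left and G on the right
  it becomes I = G + G^T, which is skewness of 2 G - I. Commutation with \<open>B\<close> passes
  through each operation in both directions because \<open>Q0\<close> commutes with
  \<open>B\<close>.\<close>

lemma cayley_transform_stab:
  assumes B: "B \<in> carrier_mat k k" and Q0: "Q0 \<in> orth_stab B" and Q: "Q \<in> carrier_mat k k"
    and R: "R \<in> carrier_mat k k" and WR: "(Q + Q0) * R = 1\<^sub>m k" and RW: "R * (Q + Q0) = 1\<^sub>m k"
  shows "Q \<in> orth_stab B \<longleftrightarrow> 2 \<cdot>\<^sub>m (R * Q0) - 1\<^sub>m k \<in> skew_commutant B"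
proof -
  have Q0c: "Q0 \<in> carrier_mat k k" and TQ: "Q0\<^sup>T * Q0 = 1\<^sub>m k" and Q0B: "Q0 * B = B * Q0"
    using Q0 by (auto simp: orth_stab_iff[OF B])
  define T where "T = Q0\<^sup>T"
  define W where "W = Q + Q0"
  define G where "G = R * Q0"
  have c: "T \<in> carrier_mat k k" "W \<in> carrier_mat k k" "G \<in> carrier_mat k k" using Q0c Q R by (auto simp: T_def W_def G_def)
  note c = c Q0c Q R B
  have i: "T * Q0 = 1\<^sub>m k" "Q0 * T = 1\<^sub>m k" "W * R = 1\<^sub>m k" "R * W = 1\<^sub>m k"
    using TQ mat_mult_left_right_inverse[OF c(1) Q0c] WR RW by (auto simp: T_def W_def)
  have it: "R\<^sup>T * W\<^sup>T = 1\<^sub>m k" "W\<^sup>T * R\<^sup>T = 1\<^sub>m k"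
    using i by (simp_all only: transpose_one flip: transpose_mult[OF c(2) R] transpose_mult[OF R c(2)])
  have cancel: "dim_row Z = k \<Longrightarrow> T * (Q0 * Z) = Z" "dim_row Z = k \<Longrightarrow> Q0 * (T * Z) = Z"
    "dim_row Z = k \<Longrightarrow> W * (R * Z) = Z" "dim_row Z = k \<Longrightarrow> R * (W * Z) = Z"
    "dim_row Z = k \<Longrightarrow> R\<^sup>T * (W\<^sup>T * Z) = Z" "dim_row Z = k \<Longrightarrow> W\<^sup>T * (R\<^sup>T * Z) = Z" for Z
    using c i it by (simp_all flip: mat_mult_assoc_dim)
  note simps = mat_mult_assoc_dim mat_distrib_dim cancel i it c[THEN carrier_matD(1)] c[THEN carrier_matD(2)]
  have Gt: "G\<^sup>T = T * R\<^sup>T" using transpose_mult[OF R Q0c] by (simp add: G_def T_def)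
  have 1: "Q\<^sup>T * Q = 1\<^sub>m k \<longleftrightarrow> W\<^sup>T * W = W\<^sup>T * Q0 + T * W"
  proof -
    have Wt: "W\<^sup>T = Q\<^sup>T + T" using transpose_add[OF Q Q0c] by (simp add: W_def T_def)
    have e1: "W\<^sup>T * W = (Q\<^sup>T * Q + T * Q) + (Q\<^sup>T * Q0 + 1\<^sub>m k)"
      unfolding Wt unfolding W_def by (simp add: simps)
    have e2: "W\<^sup>T * Q0 + T * W = (Q\<^sup>T * Q0 + 1\<^sub>m k) + (T * Q + 1\<^sub>m k)"
      unfolding Wt unfolding W_def by (simp add: simps)
    have gen: "X = 1\<^sub>m k \<longleftrightarrow> (X + Y) + (Z + 1\<^sub>m k) = (Z + 1\<^sub>m k) + (Y + 1\<^sub>m k)"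
      if "X \<in> carrier_mat k k" "Y \<in> carrier_mat k k" "Z \<in> carrier_mat k k" for X Y Z :: "complex mat"
      using that by (auto simp: mat_eq_iff)
    show ?thesis unfolding e1 e2 by (rule gen) (use c in auto)
  qed
  have 2: "W\<^sup>T * W = W\<^sup>T * Q0 + T * W \<longleftrightarrow> 1\<^sub>m k = G + G\<^sup>T"
  proof
    assume "W\<^sup>T * W = W\<^sup>T * Q0 + T * W"
    then have "T * R\<^sup>T * (W\<^sup>T * W) * (R * Q0) = T * R\<^sup>T * (W\<^sup>T * Q0 + T * W) * (R * Q0)" by simp
    then show "1\<^sub>m k = G + G\<^sup>T" unfolding Gt unfolding G_def by (simp add: simps)
  next
    assume "1\<^sub>m k = G + G\<^sup>T"
    \<comment> \<open>The outer factors are the inverses of G^T and G, which undoes the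
      multiplication of the other direction.\<close>
    then have "W\<^sup>T * Q0 * 1\<^sub>m k * (T * W) = W\<^sup>T * Q0 * (R * Q0 + T * R\<^sup>T) * (T * W)"
      unfolding Gt unfolding G_def by simp
    then show "W\<^sup>T * W = W\<^sup>T * Q0 + T * W" by (simp add: simps)
  qed
  let ?X = "2 \<cdot>\<^sub>m G - 1\<^sub>m k"
  \<comment> \<open>Here x and y stand for the entries of \<open>G\<close> at (i, j) and (j, i), and
    e for the entry of the identity at either place.\<close>
  have lin: "2 * y - e = - (2 * x - e) \<longleftrightarrow> e = x + y" for x y e :: complex
  proof
    assume "2 * y - e = - (2 * x - e)"
    then have "2 * y - e + (2 * x - e) = 0" by simp
    moreover have "2 * (x + y) = (2 * y - e + (2 * x - e)) + 2 * e" by (simp add: algebra_simps)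
    ultimately have "2 * (x + y) = 2 * e" by (simp only: add_0)
    then have "x + y = e" by (metis mult_cancel_left zero_neq_numeral)
    then show "e = x + y" by simp
  qed (simp add: algebra_simps)
  have 3: "1\<^sub>m k = G + G\<^sup>T \<longleftrightarrow> ?X\<^sup>T = - ?X"
  proof -
    have "?X\<^sup>T = - ?X \<longleftrightarrow> (\<forall>i<k. \<forall>j<k. 2 * G $$ (j, i) - 1\<^sub>m k $$ (j, i) = - (2 * G $$ (i, j) - 1\<^sub>m k $$ (i, j)))"
      using c(3) by (auto simp: mat_eq_iff)
    also have "\<dots> \<longleftrightarrow> (\<forall>i<k. \<forall>j<k. 1\<^sub>m k $$ (i, j) = G $$ (i, j) + G $$ (j, i))"
    proof (intro all_cong imp_cong refl)
      fix i j assume "i < k" "j < k"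
      then have "1\<^sub>m k $$ (j, i) = (1\<^sub>m k $$ (i, j) :: complex)" by auto
      then show "(2 * G $$ (j, i) - 1\<^sub>m k $$ (j, i) = - (2 * G $$ (i, j) - 1\<^sub>m k $$ (i, j))) \<longleftrightarrow>
        (1\<^sub>m k $$ (i, j) = G $$ (i, j) + G $$ (j, i))" by (simp only: lin)
    qed
    also have "\<dots> \<longleftrightarrow> 1\<^sub>m k = G + G\<^sup>T" using c(3) by (auto simp: mat_eq_iff)
    finally show ?thesis by simp
  qed
  have 4: "Q * B = B * Q \<longleftrightarrow> W * B = B * W"
  proof -
    have e: "W * B = Q * B + B * Q0" "B * W = B * Q + B * Q0" unfolding W_def using Q0B by (simp_all add: simps)
    have gen: "X = Y \<longleftrightarrow> X + Z = Y + Z" if "X \<in> carrier_mat k k" "Y \<in> carrier_mat k k" "Z \<in> carrier_mat k k" for X Y Z :: "complex mat"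
      using that by (auto simp: mat_eq_iff)
    show ?thesis unfolding e by (rule gen) (use c in auto)
  qed
  have TB: "T * B = B * T" by (rule mat_commute_inverse[OF Q0c c(1) B i(2,1) Q0B])
  have 5: "W * B = B * W \<longleftrightarrow> G * B = B * G"
  proof
    assume "W * B = B * W"
    then have "R * B = B * R" by (rule mat_commute_inverse[OF c(2) R B i(3,4)])
    then show "G * B = B * G" unfolding G_def by (rule mat_commute_mult[OF R Q0c B _ Q0B])
  next
    assume "G * B = B * G"
    then have "(G * T) * B = B * (G * T)" by (rule mat_commute_mult[OF c(3,1) B _ TB])
    moreover have "G * T = R" unfolding G_def by (simp add: simps)
    ultimately have "R * B = B * R" by simp
    then show "W * B = B * W" by (rule mat_commute_inverse[OF R c(2) B i(4,3)])
  qed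
  have 6: "G * B = B * G \<longleftrightarrow> ?X * B = B * ?X"
  proof -
    have e1: "?X * B = 2 \<cdot>\<^sub>m (G * B) - B" using c
      by (simp add: minus_mult_distrib_mat[of _ k k] mult_smult_assoc_mat[of _ k k])
    have e2: "B * ?X = 2 \<cdot>\<^sub>m (B * G) - B" using c
      by (simp add: mult_minus_distrib_mat[of _ k k _ k] mult_smult_distrib[of _ k k _ k])
    have gen: "X = Y \<longleftrightarrow> 2 \<cdot>\<^sub>m X - B = 2 \<cdot>\<^sub>m Y - B" if "X \<in> carrier_mat k k" "Y \<in> carrier_mat k k" for X Y :: "complex mat"
      using that B by (auto simp: mat_eq_iff)
    show ?thesis unfolding e1 e2 by (rule gen) (use c in auto)
  qed
  have "?X \<in> carrier_mat k k" by (intro minus_carrier_mat one_carrier_mat)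
  then show ?thesis
    using 1 2 3 4 5 6 Q B by (auto simp: orth_stab_iff[OF B] skew_commutant_def G_def)
qed

lemma clinear_vec_compose:
  "clinear_vec n m F \<Longrightarrow> clinear_vec m l G \<Longrightarrow> clinear_vec n l (\<lambda>v. G (F v))"
  by (simp add: clinear_vec_def)

lemma vec_of_square_image_iff:
  assumes "X \<in> carrier_mat k k" "S \<subseteq> carrier_mat k k"
  shows "vec_of_square k X \<in> vec_of_square k ` S \<longleftrightarrow> X \<in> S"
proof
  assume "vec_of_square k X \<in> vec_of_square k ` S"
  then obtain Y where Y: "Y \<in> S" "vec_of_square k X = vec_of_square k Y" by auto
  then have "square_of_vec k (vec_of_square k X) = square_of_vec k (vec_of_square k Y)" by simp
  then have "X = Y" using assms Y by (metis square_of_vec_of_square subsetD)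
  with Y show "X \<in> S" by simp
qed simp

text \<open>The chart at \<open>Q0\<close> is the Cayley transform followed by \<open>F\<close>. The
  former carries the stabilizer to \<open>skew_commutant B\<close>, and by \<open>slice\<close> the
  latter carries this linear space to a coordinate subspace.\<close>

lemma orth_stab_submanifold:
  assumes B: "B \<in> carrier_mat k k" and F: "clinear_vec (k * k) (k * k) F" and G: "clinear_vec (k * k) (k * k) G"
    and FG: "\<And>v. v \<in> carrier_vec (k * k) \<Longrightarrow> G (F v) = v" "\<And>v. v \<in> carrier_vec (k * k) \<Longrightarrow> F (G v) = v"
    and d: "d \<le> k * k"
    and slice: "\<And>x. x \<in> carrier_vec (k * k) \<Longrightarrow>
      x \<in> vec_of_square k ` skew_commutant B \<longleftrightarrow> (\<forall>i\<in>{d..<k * k}. F x $ i = 0)"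
  shows "complex_submanifold (k * k) d (vec_of_square k ` orth_stab B)"
  unfolding complex_submanifold_def
proof (intro conjI ballI)
  show "d \<le> k * k" by fact
  show "vec_of_square k ` orth_stab B \<subseteq> carrier_vec (k * k)" by auto
  fix p assume "p \<in> vec_of_square k ` orth_stab B"
  then obtain Q0 where Q0: "Q0 \<in> orth_stab B" and p: "p = vec_of_square k Q0" by auto
  have Q0c: "Q0 \<in> carrier_mat k k" and TQ: "Q0\<^sup>T * Q0 = 1\<^sub>m k" and Q0B: "Q0 * B = B * Q0"
    using Q0 by (auto simp: orth_stab_iff[OF B])
  have Tc: "Q0\<^sup>T \<in> carrier_mat k k" using Q0c by simp
  have QT: "Q0 * Q0\<^sup>T = 1\<^sub>m k" by (rule mat_mult_left_right_inverse[OF Tc Q0c TQ])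
  have pc: "p \<in> carrier_vec (k * k)" by (simp add: p)
  have sub: "orth_stab B \<subseteq> carrier_mat k k" by (auto simp: orth_stab_iff[OF B])
  let ?n = "k * k"
  let ?M = "vec_of_square k ` orth_stab B"
  define U where "U = {q \<in> carrier_vec ?n. q + p \<in> gl_vec k}"
  have id: "clinear_vec ?n ?n (\<lambda>v. v)" by (auto simp: clinear_vec_def)
  have U: "cvec_open ?n U" unfolding U_def
    by (rule cvec_open_preimage[OF affine_cvec_holomorphic[OF id pc] _ cvec_open_UNIV cvec_open_gl_vec]) (use pc in auto)
  have "{w \<in> carrier_vec ?n. w - p \<in> U} = gl_vec k"
  proof -
    have "w - p + p = w" if "w \<in> carrier_vec ?n" for w using that pc by auto
    then show ?thesis using pc by (auto simp: U_def gl_vec_def)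
  qed
  then have a1: "cvec_biholomorphic ?n (\<lambda>v. v + p) U (gl_vec k)"
    using affine_cvec_biholomorphic[OF id id _ _ pc U] by simp
  define H where "H = (\<lambda>v. vec_of_square k (2 \<cdot>\<^sub>m (1\<^sub>m k * square_of_vec k v * Q0)))"
  define H' where "H' = (\<lambda>v. vec_of_square k ((1 / 2) \<cdot>\<^sub>m (1\<^sub>m k * square_of_vec k v * Q0\<^sup>T)))"
  have H: "clinear_vec ?n ?n H" "clinear_vec ?n ?n H'"
    unfolding H_def H'_def using Q0c by (intro clinear_vec_mult_left_right one_carrier_mat transpose_carrier_mat[THEN iffD2]; assumption)+
  have HH: "H' (H v) = v" "H (H' v) = v" if "v \<in> carrier_vec ?n" for v
  proof -
    let ?V = "square_of_vec k v"
    have V: "?V \<in> carrier_mat k k" by simp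
    have VQ: "?V * Q0 \<in> carrier_mat k k" "?V * Q0\<^sup>T \<in> carrier_mat k k" using V Q0c Tc by auto
    have s: "a \<cdot>\<^sub>m (c \<cdot>\<^sub>m X) = (a * c) \<cdot>\<^sub>m X" for a c and X :: "complex mat" by (intro eq_matI) auto
    have o: "1 \<cdot>\<^sub>m X = X" for X :: "complex mat" by (intro eq_matI) auto
    have "2 \<cdot>\<^sub>m (?V * Q0) * Q0\<^sup>T = 2 \<cdot>\<^sub>m ?V"
      using Q0c QT mult_smult_assoc_mat[OF mult_carrier_mat[OF V Q0c] Tc, of 2] by (simp add: mat_mult_assoc_dim)
    then show "H' (H v) = v" using that VQ by (simp add: H_def H'_def s o)
    have "(1 / 2) \<cdot>\<^sub>m (?V * Q0\<^sup>T) * Q0 = (1 / 2) \<cdot>\<^sub>m ?V"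
      using Q0c TQ mult_smult_assoc_mat[OF mult_carrier_mat[OF V Tc] Q0c, of "1 / 2"] by (simp add: mat_mult_assoc_dim)
    then show "H (H' v) = v" using that VQ by (simp add: H_def H'_def s o)
  qed
  \<comment> \<open>The summand -I of the Cayley transform, moved through the linear map
    \<open>F\<close> so that the last stage of the chart is affine.\<close>
  define b where "b = F (vec_of_square k (- 1\<^sub>m k))"
  have bc: "b \<in> carrier_vec ?n" unfolding b_def by (intro clinear_vecD(1)[OF F]) simp
  note Fc = clinear_vecD[OF F] and Gc = clinear_vecD[OF G] and Hc = clinear_vecD[OF H(1)] clinear_vecD[OF H(2)]
  define V where "V = {w \<in> carrier_vec ?n. H' (G (w - b)) \<in> gl_vec k}"
  have a3: "cvec_biholomorphic ?n (\<lambda>v. F (H v) + b) (gl_vec k) V"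
    unfolding V_def
    by (rule affine_cvec_biholomorphic[OF clinear_vec_compose[OF H(1) F] clinear_vec_compose[OF G H(2)] _ _ bc cvec_open_gl_vec])
      (use HH FG Fc(1) Gc(1) Hc in auto)
  define f where "f = (\<lambda>v. F (H v) + b) \<circ> (inv_vec k \<circ> (\<lambda>v. v + p))"
  have f: "cvec_biholomorphic ?n f U V" unfolding f_def
    by (rule cvec_biholomorphic_compose[OF cvec_biholomorphic_compose[OF a1 inv_vec_biholomorphic] a3])
  have key: "q \<in> ?M \<longleftrightarrow> (\<forall>i\<in>{d..<?n}. f q $ i = 0)" if q: "q \<in> U" for q
  proof -
    have qc: "q \<in> carrier_vec ?n" and gl: "q + p \<in> gl_vec k" using q by (auto simp: U_def)
    let ?Q = "square_of_vec k q"
    have W: "square_of_vec k (q + p) = ?Q + Q0" using square_of_vec_add[OF qc pc] Q0c by (simp add: p)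
    have Wc: "?Q + Q0 \<in> carrier_mat k k" "det (?Q + Q0) \<noteq> 0" using gl W Q0c by (auto simp: gl_vec_def)
    let ?R = "the (mat_inverse (?Q + Q0))"
    note R = mat_inverse_det_nonzero[OF Wc]
    have RQ: "?R * Q0 \<in> carrier_mat k k" using R(1) Q0c by auto
    let ?X = "2 \<cdot>\<^sub>m (?R * Q0) - 1\<^sub>m k"
    have Xc: "?X \<in> carrier_mat k k" by (intro minus_carrier_mat one_carrier_mat)
    have "H (inv_vec k (q + p)) = vec_of_square k (2 \<cdot>\<^sub>m (?R * Q0))"
      using R RQ by (simp add: H_def inv_vec_def W)
    then have "f q = F (vec_of_square k (2 \<cdot>\<^sub>m (?R * Q0))) + F (vec_of_square k (- 1\<^sub>m k))"
      by (simp add: f_def b_def)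
    also have "\<dots> = F (vec_of_square k (2 \<cdot>\<^sub>m (?R * Q0)) + vec_of_square k (- 1\<^sub>m k))"
      by (simp add: Fc(2))
    also have "vec_of_square k (2 \<cdot>\<^sub>m (?R * Q0)) + vec_of_square k (- 1\<^sub>m k) = vec_of_square k ?X"
      using RQ vec_of_square_add[of "2 \<cdot>\<^sub>m (?R * Q0)" k "- 1\<^sub>m k"] minus_add_uminus_mat[of "2 \<cdot>\<^sub>m (?R * Q0)" k k "1\<^sub>m k"] by simp
    finally have fq: "f q = F (vec_of_square k ?X)" .
    have "q \<in> ?M \<longleftrightarrow> ?Q \<in> orth_stab B"
      using vec_of_square_image_iff[OF square_of_vec_carrier(1) sub, of q] qc by simp
    also have "\<dots> \<longleftrightarrow> ?X \<in> skew_commutant B"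
      by (rule cayley_transform_stab[OF B Q0 _ R]) simp
    also have "\<dots> \<longleftrightarrow> vec_of_square k ?X \<in> vec_of_square k ` skew_commutant B"
      using Xc B by (subst vec_of_square_image_iff) (auto simp: skew_commutant_def)
    also have "\<dots> \<longleftrightarrow> (\<forall>i\<in>{d..<?n}. f q $ i = 0)" using slice fq by simp
    finally show ?thesis .
  qed
  have "p \<in> U"
  proof -
    \<comment> \<open>Q0^T / 2 inverts 2 Q0, so the point \<open>p\<close> lies in the domain of its
      own chart.\<close>
    have "(Q0 + Q0) * ((1 / 2) \<cdot>\<^sub>m Q0\<^sup>T) = (1 / 2) \<cdot>\<^sub>m ((Q0 + Q0) * Q0\<^sup>T)"
      using Q0c by (intro mult_smult_distrib) auto
    also have "(Q0 + Q0) * Q0\<^sup>T = 1\<^sub>m k + 1\<^sub>m k" using Q0c QT by (simp add: mat_distrib_dim)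
    also have "(1 / 2) \<cdot>\<^sub>m (1\<^sub>m k + 1\<^sub>m k) = (1\<^sub>m k :: complex mat)" by (intro eq_matI) auto
    finally have "det (Q0 + Q0) \<noteq> 0" using Q0c by (intro det_nonzero_of_mult_eq_one(1)[of _ k]) auto
    then show ?thesis using pc Q0c by (simp add: U_def gl_vec_def square_of_vec_add) (simp add: p)
  qed
  moreover have "f ` (?M \<inter> U) = {v \<in> V. \<forall>i\<in>{d..<?n}. v $ i = 0}"
  proof (intro equalityI subsetI)
    fix v assume "v \<in> f ` (?M \<inter> U)"
    then obtain q where "q \<in> ?M" "q \<in> U" "v = f q" by blast
    then show "v \<in> {v \<in> V. \<forall>i\<in>{d..<?n}. v $ i = 0}" using key[of q] cvec_biholomorphicD(4)[OF f] by auto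
  next
    fix v assume v: "v \<in> {v \<in> V. \<forall>i\<in>{d..<?n}. v $ i = 0}"
    then obtain q where "q \<in> U" "v = f q" using cvec_biholomorphicD(4)[OF f] by auto
    then show "v \<in> f ` (?M \<inter> U)" using key[of q] v by auto
  qed
  ultimately show "\<exists>U V f. p \<in> U \<and> cvec_biholomorphic ?n f U V \<and>
        f ` (?M \<inter> U) = {v \<in> V. \<forall>i\<in>{d..<?n}. v $ i = 0}"
    using f by blast
qed

lemma dim_stab_eqI:
  assumes B: "B \<in> carrier_mat k k" and sub: "complex_submanifold (k * k) d (vec_of_square k ` orth_stab B)"
  shows "dim_stab B = d"
proof -
  have "1\<^sub>m k \<in> orth_stab B" using B by (simp add: orth_stab_iff[OF B])
  then have "vec_of_square k ` orth_stab B \<noteq> {}" by blast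
  with sub B show ?thesis by (simp add: dim_stab_def complex_dim_mat_def complex_dim_eq)
qed

section \<open>Dimensions of spaces of intertwining matrices\<close>

text \<open>Dimension is witnessed by an injective linear map from C^d. Linear images and direct
  sums then amount to composing maps, and the witness can be passed to
  \<open>straighten_linear_image\<close>.\<close>

definition linear_param :: "nat \<Rightarrow> nat \<Rightarrow> nat \<Rightarrow> (complex vec \<Rightarrow> complex mat) \<Rightarrow> bool" where
  "linear_param d a b \<phi> \<longleftrightarrow> (\<forall>v\<in>carrier_vec d. \<phi> v \<in> carrier_mat a b) \<and>
     (\<forall>v\<in>carrier_vec d. \<forall>w\<in>carrier_vec d. \<phi> (v + w) = \<phi> v + \<phi> w) \<and>
     (\<forall>c. \<forall>v\<in>carrier_vec d. \<phi> (c \<cdot>\<^sub>v v) = c \<cdot>\<^sub>m \<phi> v) \<and> inj_on \<phi> (carrier_vec d)"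

definition mat_space_dim :: "nat \<Rightarrow> nat \<Rightarrow> nat \<Rightarrow> complex mat set \<Rightarrow> bool" where
  "mat_space_dim a b d W \<longleftrightarrow> (\<exists>\<phi>. linear_param d a b \<phi> \<and> \<phi> ` carrier_vec d = W)"

lemma mat_space_dim_zero: "mat_space_dim a b 0 {0\<^sub>m a b}"
proof -
  have "carrier_vec 0 = {0\<^sub>v 0 :: complex vec}" by (auto intro!: eq_vecI)
  then show ?thesis unfolding mat_space_dim_def linear_param_def
    by (intro exI[of _ "\<lambda>v. 0\<^sub>m a b"]) auto
qed

text \<open>\<open>T\<close> assembles a matrix linearly and injectively from two independent parts,
  such as the blocks of a block matrix; the parameter vectors are concatenated.\<close>

lemma mat_space_dim_sum:
  assumes W1: "mat_space_dim a1 b1 d1 W1" and W2: "mat_space_dim a2 b2 d2 W2"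
    and T: "\<And>X Y. X \<in> carrier_mat a1 b1 \<Longrightarrow> Y \<in> carrier_mat a2 b2 \<Longrightarrow> T X Y \<in> carrier_mat a b"
      "\<And>X Y X' Y'. X \<in> carrier_mat a1 b1 \<Longrightarrow> X' \<in> carrier_mat a1 b1 \<Longrightarrow>
        Y \<in> carrier_mat a2 b2 \<Longrightarrow> Y' \<in> carrier_mat a2 b2 \<Longrightarrow> T (X + X') (Y + Y') = T X Y + T X' Y'"
      "\<And>c X Y. X \<in> carrier_mat a1 b1 \<Longrightarrow> Y \<in> carrier_mat a2 b2 \<Longrightarrow> T (c \<cdot>\<^sub>m X) (c \<cdot>\<^sub>m Y) = c \<cdot>\<^sub>m T X Y"
      "\<And>X Y X' Y'. X \<in> carrier_mat a1 b1 \<Longrightarrow> X' \<in> carrier_mat a1 b1 \<Longrightarrow>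
        Y \<in> carrier_mat a2 b2 \<Longrightarrow> Y' \<in> carrier_mat a2 b2 \<Longrightarrow> T X Y = T X' Y' \<Longrightarrow> X = X' \<and> Y = Y'"
  shows "mat_space_dim a b (d1 + d2) {T X Y | X Y. X \<in> W1 \<and> Y \<in> W2}"
proof -
  obtain f where f: "linear_param d1 a1 b1 f" "f ` carrier_vec d1 = W1" using W1 by (auto simp: mat_space_dim_def)
  obtain g where g: "linear_param d2 a2 b2 g" "g ` carrier_vec d2 = W2" using W2 by (auto simp: mat_space_dim_def)
  define \<phi> where "\<phi> = (\<lambda>v. T (f (vec_first v d1)) (g (vec_last v d2)))"
  have fc: "f u \<in> carrier_mat a1 b1" if "u \<in> carrier_vec d1" for u using f that by (auto simp: linear_param_def)
  have gc: "g u \<in> carrier_mat a2 b2" if "u \<in> carrier_vec d2" for u using g that by (auto simp: linear_param_def)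
  have "linear_param (d1 + d2) a b \<phi>"
    unfolding linear_param_def
  proof (intro conjI ballI allI)
    fix v w :: "complex vec" and c assume v: "v \<in> carrier_vec (d1 + d2)" and w: "w \<in> carrier_vec (d1 + d2)"
    have "vec_first (v + w) d1 = vec_first v d1 + vec_first w d1" "vec_last (v + w) d2 = vec_last v d2 + vec_last w d2"
      using v w by (auto simp: vec_first_def vec_last_def)
    then show "\<phi> (v + w) = \<phi> v + \<phi> w" unfolding \<phi>_def
      using f g T(2) fc gc by (simp add: linear_param_def)
  next
    fix v :: "complex vec" and c assume v: "v \<in> carrier_vec (d1 + d2)"
    have "vec_first (c \<cdot>\<^sub>v v) d1 = c \<cdot>\<^sub>v vec_first v d1" "vec_last (c \<cdot>\<^sub>v v) d2 = c \<cdot>\<^sub>v vec_last v d2"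
      using v by (auto simp: vec_first_def vec_last_def)
    then show "\<phi> (c \<cdot>\<^sub>v v) = c \<cdot>\<^sub>m \<phi> v" unfolding \<phi>_def
      using f g T(3) fc gc by (simp add: linear_param_def)
  next
    show "inj_on \<phi> (carrier_vec (d1 + d2))"
    proof (rule inj_onI)
      fix v w :: "complex vec" assume v: "v \<in> carrier_vec (d1 + d2)" and w: "w \<in> carrier_vec (d1 + d2)" and "\<phi> v = \<phi> w"
      then have "f (vec_first v d1) = f (vec_first w d1) \<and> g (vec_last v d2) = g (vec_last w d2)"
        unfolding \<phi>_def by (intro T(4)) (auto intro: fc gc)
      then have "vec_first v d1 = vec_first w d1" "vec_last v d2 = vec_last w d2"
        using f g by (auto simp: linear_param_def inj_on_def)
      then show "v = w" using vec_first_last_append[OF v] vec_first_last_append[OF w] by metis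
    qed
  qed (auto simp: \<phi>_def intro!: T(1) fc gc)
  moreover have "\<phi> ` carrier_vec (d1 + d2) = {T X Y | X Y. X \<in> W1 \<and> Y \<in> W2}"
  proof (intro equalityI subsetI)
    fix M assume "M \<in> \<phi> ` carrier_vec (d1 + d2)"
    then obtain v where "M = T (f (vec_first v d1)) (g (vec_last v d2))" by (auto simp: \<phi>_def)
    moreover have "f (vec_first v d1) \<in> W1" "g (vec_last v d2) \<in> W2" using f(2) g(2) by auto
    ultimately show "M \<in> {T X Y | X Y. X \<in> W1 \<and> Y \<in> W2}" by blast
  next
    fix M assume "M \<in> {T X Y | X Y. X \<in> W1 \<and> Y \<in> W2}"
    then obtain u v where uv: "u \<in> carrier_vec d1" "v \<in> carrier_vec d2" "M = T (f u) (g v)"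
      using f(2) g(2) by blast
    have "vec_first (u @\<^sub>v v) d1 = u" "vec_last (u @\<^sub>v v) d2 = v"
      using uv by (auto simp: vec_first_def vec_last_def)
    then have "M = \<phi> (u @\<^sub>v v)" using uv by (simp add: \<phi>_def)
    then show "M \<in> \<phi> ` carrier_vec (d1 + d2)" using uv by blast
  qed
  ultimately show ?thesis unfolding mat_space_dim_def by blast
qed

lemma mat_space_dim_image:
  assumes W: "mat_space_dim a' b' d W"
    and T: "\<And>X. X \<in> carrier_mat a' b' \<Longrightarrow> T X \<in> carrier_mat a b"
      "\<And>X Y. X \<in> carrier_mat a' b' \<Longrightarrow> Y \<in> carrier_mat a' b' \<Longrightarrow> T (X + Y) = T X + T Y"
      "\<And>c X. X \<in> carrier_mat a' b' \<Longrightarrow> T (c \<cdot>\<^sub>m X) = c \<cdot>\<^sub>m T X"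
      "\<And>X Y. X \<in> carrier_mat a' b' \<Longrightarrow> Y \<in> carrier_mat a' b' \<Longrightarrow> T X = T Y \<Longrightarrow> X = Y"
  shows "mat_space_dim a b d (T ` W)"
proof -
  obtain f where f: "linear_param d a' b' f" "f ` carrier_vec d = W" using W by (auto simp: mat_space_dim_def)
  have fc: "f v \<in> carrier_mat a' b'" if "v \<in> carrier_vec d" for v using f that by (auto simp: linear_param_def)
  have "inj_on T (f ` carrier_vec d)" by (rule inj_onI, rule T(4)) (use fc in auto)
  then have "inj_on (T \<circ> f) (carrier_vec d)" using f by (intro comp_inj_on) (auto simp: linear_param_def)
  then have "linear_param d a b (T \<circ> f)"
    using f T(1-3) fc unfolding linear_param_def by simp
  moreover have "(T \<circ> f) ` carrier_vec d = T ` W" using f(2) by auto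
  ultimately show ?thesis unfolding mat_space_dim_def by blast
qed

definition intertwiners :: "complex mat \<Rightarrow> complex mat \<Rightarrow> complex mat set" where
  "intertwiners A B = {X \<in> carrier_mat (dim_row A) (dim_row B). X * B = A * X}"

section \<open>Intertwiners of Jordan blocks\<close>

lemma mult_jordan_block_index:
  fixes Y :: "complex mat"
  assumes Y: "Y \<in> carrier_mat a b" and ij: "i < a" "j < b"
  shows "(Y * jordan_block b z) $$ (i, j) = z * Y $$ (i, j) + (if j = 0 then 0 else Y $$ (i, j - 1))"
proof -
  have "(Y * jordan_block b z) $$ (i, j) = (\<Sum>l\<in>{0..<b}. Y $$ (i, l) * (if l = j then z else if Suc l = j then 1 else 0))"
    using Y ij by (auto simp: scalar_prod_def intro!: sum.cong)
  also have "\<dots> = (\<Sum>l\<in>{0..<b}. (if l = j then z * Y $$ (i, j) else 0) + (if Suc l = j then Y $$ (i, l) else 0))"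
    by (intro sum.cong) auto
  also have "\<dots> = z * Y $$ (i, j) + (\<Sum>l\<in>{0..<b}. if Suc l = j then Y $$ (i, l) else 0)"
    using ij by (simp add: sum.distrib)
  also have "(\<Sum>l\<in>{0..<b}. if Suc l = j then Y $$ (i, l) else 0) = (if j = 0 then 0 else Y $$ (i, j - 1))"
    using ij by (cases j) auto
  finally show ?thesis .
qed

lemma jordan_block_mult_index:
  fixes Y :: "complex mat"
  assumes Y: "Y \<in> carrier_mat a b" and ij: "i < a" "j < b"
  shows "(jordan_block a z * Y) $$ (i, j) = z * Y $$ (i, j) + (if Suc i < a then Y $$ (Suc i, j) else 0)"
proof -
  have "(jordan_block a z * Y) $$ (i, j) = (\<Sum>l\<in>{0..<a}. (if i = l then z else if Suc i = l then 1 else 0) * Y $$ (l, j))"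
    using Y ij by (auto simp: scalar_prod_def intro!: sum.cong)
  also have "\<dots> = (\<Sum>l\<in>{0..<a}. (if i = l then z * Y $$ (i, j) else 0) + (if Suc i = l then Y $$ (Suc i, j) else 0))"
    by (intro sum.cong) auto
  also have "\<dots> = z * Y $$ (i, j) + (if Suc i < a then Y $$ (Suc i, j) else 0)"
    using ij by (simp add: sum.distrib)
  finally show ?thesis .
qed

text \<open>The nilpotent part shifts columns to the right when multiplied from the right and rows
  up when multiplied from the left; the scalar parts leave y - x.\<close>

lemma intertwiners_jordan_block_iff:
  "Y \<in> intertwiners (jordan_block a x) (jordan_block b y) \<longleftrightarrow> Y \<in> carrier_mat a b \<and>
    (\<forall>i<a. \<forall>j<b. (y - x) * Y $$ (i, j) =
       (if Suc i < a then Y $$ (Suc i, j) else 0) - (if j = 0 then 0 else Y $$ (i, j - 1)))"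
proof (cases "Y \<in> carrier_mat a b")
  case True
  then have "Y * jordan_block b y = jordan_block a x * Y \<longleftrightarrow>
    (\<forall>i<a. \<forall>j<b. (Y * jordan_block b y) $$ (i, j) = (jordan_block a x * Y) $$ (i, j))"
    by (auto simp: mat_eq_iff simp del: index_mult_mat(1))
  also have "\<dots> \<longleftrightarrow> (\<forall>i<a. \<forall>j<b. (y - x) * Y $$ (i, j) =
       (if Suc i < a then Y $$ (Suc i, j) else 0) - (if j = 0 then 0 else Y $$ (i, j - 1)))"
    by (simp add: mult_jordan_block_index[OF True] jordan_block_mult_index[OF True] algebra_simps
        eq_diff_eq diff_eq_eq cong: imp_cong)
  finally show ?thesis using True by (simp add: intertwiners_def)
qed (simp add: intertwiners_def)

text \<open>The entry depends on i - j only, and \<open>c\<close> lists the first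
  \<open>min a b\<close> entries of the last column. All later diagonals are zero, so a wide matrix
  has zero columns on the left and a tall one zero rows at the bottom.\<close>

definition toeplitz_param :: "nat \<Rightarrow> nat \<Rightarrow> complex vec \<Rightarrow> complex mat" where
  "toeplitz_param a b c = mat a b (\<lambda>(i, j). if b - 1 - j + i < min a b then c $ (b - 1 - j + i) else 0)"

lemma linear_param_toeplitz: "linear_param (min a b) a b (toeplitz_param a b)"
  unfolding linear_param_def
proof (intro conjI ballI allI)
  show "inj_on (toeplitz_param a b) (carrier_vec (min a b))"
  proof (rule inj_onI, rule eq_vecI)
    fix c d :: "complex vec" and t
    assume c: "c \<in> carrier_vec (min a b)" and d: "d \<in> carrier_vec (min a b)"
      and eq: "toeplitz_param a b c = toeplitz_param a b d" and "t < dim_vec d"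
    then have t: "t < min a b" by simp
    have "toeplitz_param a b c $$ (t, b - 1) = toeplitz_param a b d $$ (t, b - 1)" using eq by simp
    then show "c $ t = d $ t" using t by (auto simp: toeplitz_param_def)
  qed auto
qed (auto simp: toeplitz_param_def intro!: eq_matI)

text \<open>For equal eigenvalues the recursion says that entries are constant along diagonals, that
  the first column vanishes below its top entry, and that the last row vanishes except for its last
  entry.\<close>

lemma toeplitz_param_image:
  "toeplitz_param a b ` carrier_vec (min a b) = intertwiners (jordan_block a z) (jordan_block b z)"
proof (intro equalityI subsetI)
  fix Y assume "Y \<in> toeplitz_param a b ` carrier_vec (min a b)"
  then obtain c where Y: "Y = toeplitz_param a b c" by auto
  have r: "(if Suc i < a then Y $$ (Suc i, j) else 0) = (if j = 0 then 0 else Y $$ (i, j - 1))" if "i < a" "j < b" for i j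
  proof (cases "j = 0")
    case False
    then have "b - 1 - (j - 1) + i = b - 1 - j + Suc i" using that by linarith
    then show ?thesis using that False by (auto simp: Y toeplitz_param_def)
  qed (use that in \<open>auto simp: Y toeplitz_param_def\<close>)
  show "Y \<in> intertwiners (jordan_block a z) (jordan_block b z)"
    unfolding intertwiners_jordan_block_iff
  proof (intro conjI allI impI)
    show "Y \<in> carrier_mat a b" by (simp add: Y toeplitz_param_def)
  qed (simp only: r diff_self mult_zero_left)
next
  fix Y assume "Y \<in> intertwiners (jordan_block a z) (jordan_block b z)"
  then have Y: "Y \<in> carrier_mat a b" and
    r0: "\<forall>i<a. \<forall>j<b. (z - z) * Y $$ (i, j) =
       (if Suc i < a then Y $$ (Suc i, j) else 0) - (if j = 0 then 0 else Y $$ (i, j - 1))"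
    unfolding intertwiners_jordan_block_iff by blast+
  have r: "(if Suc i < a then Y $$ (Suc i, j) else 0) = (if j = 0 then 0 else Y $$ (i, j - 1))"
    if "i < a" "j < b" for i j
    using r0[rule_format, OF that] unfolding diff_self mult_zero_left by (subst eq_iff_diff_eq_0) (rule sym)
  \<comment> \<open>Following the diagonal up and to the left ends in the first column below its top
    entry.\<close>
  have lower: "Y $$ (i, j) = 0" if "i < a" "j < b" "j < i" for i j
    using that
  proof (induction j arbitrary: i)
    case 0
    then show ?case using r[of "i - 1" 0] by simp
  next
    case (Suc j)
    then show ?case using r[of "i - 1" "Suc j"] Suc.IH[of "i - 1"] by simp
  qed
  \<comment> \<open>Following the diagonal down and to the right for n steps ends in the last
    column, or leaves through the last row, where the entry is zero.\<close>
  have diag: "Y $$ (i, b - 1 - n) = (if n + i < min a b then Y $$ (n + i, b - 1) else 0)" if "i < a" "n < b" for i n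
    using that
  proof (induction n arbitrary: i)
    case 0
    then show ?case using lower[of i "b - 1"] by auto
  next
    case (Suc n)
    have j: "b - 1 - n \<noteq> 0" "b - 1 - n - 1 = b - 1 - Suc n" "b - 1 - n < b" using Suc.prems by auto
    have "Y $$ (i, b - 1 - Suc n) = (if Suc i < a then Y $$ (Suc i, b - 1 - n) else 0)"
      using r[of i "b - 1 - n"] j Suc.prems by simp
    then show ?case using Suc.IH[of "Suc i"] Suc.prems by auto
  qed
  have "Y = toeplitz_param a b (vec (min a b) (\<lambda>t. Y $$ (t, b - 1)))"
  proof (rule eq_matI)
    fix i j assume "i < dim_row (toeplitz_param a b (vec (min a b) (\<lambda>t. Y $$ (t, b - 1))))"
      "j < dim_col (toeplitz_param a b (vec (min a b) (\<lambda>t. Y $$ (t, b - 1))))"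
    then have ij: "i < a" "j < b" by (auto simp: toeplitz_param_def)
    then have "b - 1 - (b - 1 - j) = j" by simp
    then show "Y $$ (i, j) = toeplitz_param a b (vec (min a b) (\<lambda>t. Y $$ (t, b - 1))) $$ (i, j)"
      using diag[of i "b - 1 - j"] ij by (simp add: toeplitz_param_def)
  qed (use Y in \<open>auto simp: toeplitz_param_def\<close>)
  then show "Y \<in> toeplitz_param a b ` carrier_vec (min a b)" by (metis imageI vec_carrier)
qed

text \<open>The invertible factor y - x expresses each entry by its lower and its left neighbour.
  Both have a smaller value of j + (a - i), so zeros spread from the lower left corner.\<close>

lemma intertwiners_jordan_block_distinct:
  assumes "x \<noteq> y"
  shows "intertwiners (jordan_block a x) (jordan_block b y) = {0\<^sub>m a b}"
proof (intro equalityI subsetI)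
  fix Y assume "Y \<in> intertwiners (jordan_block a x) (jordan_block b y)"
  then have Y: "Y \<in> carrier_mat a b" and
    r: "\<And>i j. i < a \<Longrightarrow> j < b \<Longrightarrow> (y - x) * Y $$ (i, j) =
       (if Suc i < a then Y $$ (Suc i, j) else 0) - (if j = 0 then 0 else Y $$ (i, j - 1))"
    by (auto simp: intertwiners_jordan_block_iff)
  have "Y $$ (i, j) = 0" if "i < a" "j < b" for i j
    using that
  proof (induction "j + (a - i)" arbitrary: i j rule: less_induct)
    case less
    have "(if Suc i < a then Y $$ (Suc i, j) else 0) = 0" using less.hyps[of j "Suc i"] less.prems by auto
    moreover have "(if j = 0 then 0 else Y $$ (i, j - 1)) = 0" using less.hyps[of "j - 1" i] less.prems by auto
    ultimately show ?case using r[OF less.prems] assms by simp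
  qed
  then show "Y \<in> {0\<^sub>m a b}" using Y by (auto intro!: eq_matI)
qed (auto simp: intertwiners_jordan_block_iff)

lemma mat_space_dim_intertwiners_jordan_block:
  "mat_space_dim a b (if x = y then min a b else 0) (intertwiners (jordan_block a x) (jordan_block b y))"
proof (cases "x = y")
  case True
  then show ?thesis using linear_param_toeplitz toeplitz_param_image unfolding mat_space_dim_def by auto
next
  case False
  then show ?thesis by (simp add: intertwiners_jordan_block_distinct mat_space_dim_zero)
qed

lemma intertwiners_similar:
  assumes A: "A = P * J * P'" and B: "B = Q * K * Q'"
    and c: "P \<in> carrier_mat a a" "P' \<in> carrier_mat a a" "J \<in> carrier_mat a a"
      "Q \<in> carrier_mat b b" "Q' \<in> carrier_mat b b" "K \<in> carrier_mat b b"
    and i: "P * P' = 1\<^sub>m a" "P' * P = 1\<^sub>m a" "Q * Q' = 1\<^sub>m b" "Q' * Q = 1\<^sub>m b"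
  shows "intertwiners A B = (\<lambda>Y. P * Y * Q') ` intertwiners J K"
proof -
  have cancel: "dim_row Z = a \<Longrightarrow> P * (P' * Z) = Z" "dim_row Z = a \<Longrightarrow> P' * (P * Z) = Z"
    "dim_row Z = b \<Longrightarrow> Q * (Q' * Z) = Z" "dim_row Z = b \<Longrightarrow> Q' * (Q * Z) = Z" for Z
    using c i by (simp_all flip: mat_mult_assoc_dim)
  note simps = mat_mult_assoc_dim cancel i c[THEN carrier_matD(1)] c[THEN carrier_matD(2)]
  show ?thesis
  proof (intro equalityI subsetI)
    fix X assume "X \<in> intertwiners A B"
    then have X: "X \<in> carrier_mat a b" and eq: "X * B = A * X" using A B c by (auto simp: intertwiners_def)
    have "P' * (X * (Q * K * Q') * Q) = P' * (P * J * P' * X * Q)" using eq unfolding A B by simp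
    then have "(P' * X * Q) * K = J * (P' * X * Q)" using X c by (simp add: simps)
    then have "P' * X * Q \<in> intertwiners J K" using X c by (auto simp: intertwiners_def)
    moreover have "X = P * (P' * X * Q) * Q'" using X c by (simp add: simps)
    ultimately show "X \<in> (\<lambda>Y. P * Y * Q') ` intertwiners J K" by blast
  next
    fix X assume "X \<in> (\<lambda>Y. P * Y * Q') ` intertwiners J K"
    then obtain Y where X: "X = P * Y * Q'" and "Y \<in> intertwiners J K" by blast
    then have Y: "Y \<in> carrier_mat a b" and eq: "Y * K = J * Y"
      using c by (simp_all add: intertwiners_def)
    have "P * (Y * K) * Q' = P * (J * Y) * Q'" by (simp only: eq)
    then have "X * B = A * X" unfolding X A B using Y c by (simp add: simps)
    then show "X \<in> intertwiners A B" using Y c A B X by (auto simp: intertwiners_def)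
  qed
qed

section \<open>From Jordan blocks to symmetric blocks\<close>

lemma exchange_mat_carrier [simp]: "exchange_mat m \<in> carrier_mat m m"
  "dim_row (exchange_mat m) = m" "dim_col (exchange_mat m) = m"
  by (auto simp: exchange_mat_def)

lemma exchange_mat_mult_index:
  assumes "Y \<in> carrier_mat a b" "i < a" "j < b"
  shows "(exchange_mat a * Y) $$ (i, j) = Y $$ (a - 1 - i, j)"
proof -
  have "(exchange_mat a * Y) $$ (i, j) = (\<Sum>l\<in>{0..<a}. (if i + l + 1 = a then 1 else 0) * Y $$ (l, j))"
    using assms by (auto simp: scalar_prod_def exchange_mat_def intro!: sum.cong)
  also have "\<dots> = (\<Sum>l\<in>{0..<a}. if l = a - 1 - i then Y $$ (a - 1 - i, j) else 0)"
    using assms by (intro sum.cong) auto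
  finally show ?thesis using assms by simp
qed

lemma mult_exchange_mat_index:
  assumes "Y \<in> carrier_mat a b" "i < a" "j < b"
  shows "(Y * exchange_mat b) $$ (i, j) = Y $$ (i, b - 1 - j)"
proof -
  have "(Y * exchange_mat b) $$ (i, j) = (\<Sum>l\<in>{0..<b}. Y $$ (i, l) * (if l + j + 1 = b then 1 else 0))"
    using assms by (auto simp: scalar_prod_def exchange_mat_def intro!: sum.cong)
  also have "\<dots> = (\<Sum>l\<in>{0..<b}. if l = b - 1 - j then Y $$ (i, b - 1 - j) else 0)"
    using assms by (intro sum.cong) auto
  finally show ?thesis using assms by simp
qed

definition sym_trans :: "nat \<Rightarrow> complex mat" where
  "sym_trans m = 1\<^sub>m m + \<i> \<cdot>\<^sub>m exchange_mat m"

definition sym_trans_inv :: "nat \<Rightarrow> complex mat" where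
  "sym_trans_inv m = (1 / 2) \<cdot>\<^sub>m (1\<^sub>m m - \<i> \<cdot>\<^sub>m exchange_mat m)"

lemma sym_trans_carrier [simp]: "sym_trans m \<in> carrier_mat m m" "sym_trans_inv m \<in> carrier_mat m m"
  "dim_row (sym_trans m) = m" "dim_col (sym_trans m) = m"
  "dim_row (sym_trans_inv m) = m" "dim_col (sym_trans_inv m) = m"
proof -
  show 1: "sym_trans m \<in> carrier_mat m m" unfolding sym_trans_def by simp
  show 2: "sym_trans_inv m \<in> carrier_mat m m"
    unfolding sym_trans_inv_def by (intro smult_carrier_mat minus_carrier_mat exchange_mat_carrier(1))
  show "dim_row (sym_trans m) = m" "dim_col (sym_trans m) = m" using 1 by (rule carrier_matD)+
  show "dim_row (sym_trans_inv m) = m" "dim_col (sym_trans_inv m) = m" using 2 by (rule carrier_matD)+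
qed

text \<open>The exchange matrix reverses rows or columns, hence the reflected indices. This formula
  reduces the inverse, the shape of \<open>sym_block\<close> and symmetry to comparisons of four
  entries of \<open>Y\<close>.\<close>

lemma sym_trans_conj_index:
  assumes Y: "Y \<in> carrier_mat a b" and ij: "i < a" "j < b"
  shows "(sym_trans a * Y * sym_trans_inv b) $$ (i, j) =
    (Y $$ (i, j) + Y $$ (a - 1 - i, b - 1 - j) + \<i> * (Y $$ (a - 1 - i, j) - Y $$ (i, b - 1 - j))) / 2"
proof -
  have left: "(sym_trans a * Y) $$ (i, j) = Y $$ (i, j) + \<i> * Y $$ (a - 1 - i, j)" if "i < a" "j < b" for i j
  proof -
    have "sym_trans a * Y = Y + \<i> \<cdot>\<^sub>m (exchange_mat a * Y)"
      unfolding sym_trans_def using Y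
      by (simp add: add_mult_distrib_mat[of _ a a _ _ b] mult_smult_assoc_mat[of _ a a])
    then show ?thesis using that Y by (simp add: exchange_mat_mult_index del: index_mult_mat(1))
  qed
  have Z: "sym_trans a * Y \<in> carrier_mat a b" using Y by (rule mult_carrier_mat[OF sym_trans_carrier(1)])
  have "(sym_trans a * Y) * sym_trans_inv b =
      (1 / 2) \<cdot>\<^sub>m (sym_trans a * Y - \<i> \<cdot>\<^sub>m (sym_trans a * Y * exchange_mat b))"
    unfolding sym_trans_inv_def using Z
    by (simp add: mult_minus_distrib_mat[OF Z, of _ b] mult_smult_distrib[OF Z, of _ b] right_mult_one_mat[OF Z] minus_carrier_mat)
  then have "((sym_trans a * Y) * sym_trans_inv b) $$ (i, j) =
    ((sym_trans a * Y) $$ (i, j) - \<i> * (sym_trans a * Y) $$ (i, b - 1 - j)) / 2"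
    using ij Z mult_exchange_mat_index[OF Z ij] by (simp del: index_mult_mat(1))
  also have "\<dots> = (Y $$ (i, j) + Y $$ (a - 1 - i, b - 1 - j) + \<i> * (Y $$ (a - 1 - i, j) - Y $$ (i, b - 1 - j))) / 2"
    using ij by (simp add: left algebra_simps)
  finally show ?thesis .
qed

lemma sym_trans_inverse: "sym_trans m * sym_trans_inv m = 1\<^sub>m m" "sym_trans_inv m * sym_trans m = 1\<^sub>m m"
proof -
  \<comment> \<open>Inserting the identity as middle factor makes the entry formula for conjugation
    applicable.\<close>
  have "sym_trans m * sym_trans_inv m = sym_trans m * 1\<^sub>m m * sym_trans_inv m"
    by (simp only: right_mult_one_mat[OF sym_trans_carrier(1)])
  also have "\<dots> = 1\<^sub>m m"
  proof (rule eq_matI)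
    fix i j assume "i < dim_row (1\<^sub>m m :: complex mat)" "j < dim_col (1\<^sub>m m :: complex mat)"
    then have ij: "i < m" "j < m" by auto
    have "m - 1 - i = m - 1 - j \<longleftrightarrow> i = j" "m - 1 - i = j \<longleftrightarrow> i = m - 1 - j" using ij by auto
    then show "(sym_trans m * 1\<^sub>m m * sym_trans_inv m) $$ (i, j) = 1\<^sub>m m $$ (i, j)"
      by (subst sym_trans_conj_index[OF one_carrier_mat ij]) (use ij in simp)
  qed simp_all
  finally show 1: "sym_trans m * sym_trans_inv m = 1\<^sub>m m" .
  show "sym_trans_inv m * sym_trans m = 1\<^sub>m m"
    by (rule mat_mult_left_right_inverse[OF _ _ 1]) auto
qed

text \<open>Symmetry about the antidiagonal, that is E Y E = Y^T for the exchange matrix E.\<close>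

definition persymmetric :: "nat \<Rightarrow> complex mat \<Rightarrow> bool" where
  "persymmetric m Y \<longleftrightarrow> (\<forall>i<m. \<forall>j<m. Y $$ (m - 1 - i, m - 1 - j) = Y $$ (j, i))"

lemma persymmetric_jordan_block: "persymmetric m (jordan_block m z)"
  unfolding persymmetric_def
proof (intro allI impI)
  fix i j assume ij: "i < m" "j < m"
  have "m - 1 - i = m - 1 - j \<longleftrightarrow> j = i" "Suc (m - 1 - i) = m - 1 - j \<longleftrightarrow> Suc j = i" using ij by linarith+
  then show "jordan_block m z $$ (m - 1 - i, m - 1 - j) = jordan_block m z $$ (j, i)"
    using ij by simp
qed

lemma sym_block_carrier [simp]: "sym_block m z \<in> carrier_mat m m"
  "dim_row (sym_block m z) = m" "dim_col (sym_block m z) = m"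
proof -
  have "jordan_block m z * exchange_mat m \<in> carrier_mat m m"
    by (rule mult_carrier_mat[OF jordan_block_carrier exchange_mat_carrier(1)])
  then show c: "sym_block m z \<in> carrier_mat m m"
    unfolding sym_block_def by (intro add_carrier_mat smult_carrier_mat minus_carrier_mat)
  show "dim_row (sym_block m z) = m" "dim_col (sym_block m z) = m" using c by (rule carrier_matD)+
qed

text \<open>Expanding (I + i E) J (I - i E) / 2 gives (J + E J E) / 2 + i (E J - J E) / 2, and E J E
  = J^T because a Jordan block is persymmetric.\<close>

lemma sym_block_eq: "sym_block m z = sym_trans m * jordan_block m z * sym_trans_inv m"
proof (rule eq_matI)
  let ?J = "jordan_block m z"
  have J: "?J \<in> carrier_mat m m" by simp
  fix i j assume "i < dim_row (sym_trans m * jordan_block m z * sym_trans_inv m)"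
    "j < dim_col (sym_trans m * jordan_block m z * sym_trans_inv m)"
  then have ij: "i < m" "j < m" by (auto simp: sym_trans_def sym_trans_inv_def)
  have gen: "(1 / 2) * (a + d) + (\<i> / 2) * (c - e) = (a + d + \<i> * (c - e)) / 2" for a c d e :: complex
    by (simp add: field_simps)
  have "sym_block m z $$ (i, j) = (1 / 2) * (?J $$ (i, j) + ?J $$ (j, i)) +
      (\<i> / 2) * ((exchange_mat m * ?J) $$ (i, j) - (?J * exchange_mat m) $$ (i, j))"
    using ij by (simp add: sym_block_def carrier_matD[OF jordan_block_carrier] del: jordan_block_index index_mult_mat(1))
  also have "\<dots> = (1 / 2) * (?J $$ (i, j) + ?J $$ (j, i)) + (\<i> / 2) * (?J $$ (m - 1 - i, j) - ?J $$ (i, m - 1 - j))"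
    using exchange_mat_mult_index[OF J ij] mult_exchange_mat_index[OF J ij] by (simp only:)
  also have "?J $$ (j, i) = ?J $$ (m - 1 - i, m - 1 - j)"
    using persymmetric_jordan_block[of m z] ij unfolding persymmetric_def by metis
  finally show "sym_block m z $$ (i, j) = (sym_trans m * ?J * sym_trans_inv m) $$ (i, j)"
    unfolding sym_trans_conj_index[OF J ij] by (simp only: gen)
qed simp_all

text \<open>The conjugate is (Y + E Y E) / 2 + i (E Y - Y E) / 2. If E Y E = Y^T, the first part is
  (Y + Y^T) / 2, and (E Y)^T = Y^T E = E Y shows that E Y is symmetric; likewise Y E.\<close>

lemma persymmetric_conj_symmetric:
  assumes Y: "Y \<in> carrier_mat m m" and p: "persymmetric m Y"
  shows "(sym_trans m * Y * sym_trans_inv m)\<^sup>T = sym_trans m * Y * sym_trans_inv m"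
proof (rule eq_matI)
  let ?X = "sym_trans m * Y * sym_trans_inv m"
  have X: "?X \<in> carrier_mat m m" using Y by (intro mult_carrier_mat) auto
  fix i j assume "i < dim_row ?X" "j < dim_col ?X"
  then have ij: "i < m" "j < m" using X by auto
  let ?c = "\<lambda>i. m - 1 - i"
  have c: "?c i < m" "?c j < m" "?c (?c i) = i" "?c (?c j) = j" using ij by auto
  have p: "Y $$ (?c x, ?c y) = Y $$ (y, x)" if "x < m" "y < m" for x y
    using p that unfolding persymmetric_def by blast
  have "?X $$ (j, i) = ?X $$ (i, j)"
    unfolding sym_trans_conj_index[OF Y ij] sym_trans_conj_index[OF Y ij(2,1)]
    using p[OF ij] p[OF ij(2,1)] p[OF c(1) ij(2)] p[OF ij(1) c(2)] c by simp
  then show "?X\<^sup>T $$ (i, j) = ?X $$ (i, j)" using ij X by (simp del: index_mult_mat(1))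
qed simp_all

lemma sym_block_symmetric: "(sym_block m z)\<^sup>T = sym_block m z"
  unfolding sym_block_eq by (rule persymmetric_conj_symmetric) (auto simp: persymmetric_jordan_block)

lemma intertwiners_sym_block:
  "intertwiners (sym_block a x) (sym_block b y) =
    (\<lambda>Y. sym_trans a * Y * sym_trans_inv b) ` intertwiners (jordan_block a x) (jordan_block b y)"
  by (rule intertwiners_similar[OF sym_block_eq sym_block_eq sym_trans_carrier(1,2) jordan_block_carrier
      sym_trans_carrier(1,2) jordan_block_carrier sym_trans_inverse sym_trans_inverse])

lemma mat_space_dim_intertwiners_sym_block:
  "mat_space_dim a b (if x = y then min a b else 0) (intertwiners (sym_block a x) (sym_block b y))"
  unfolding intertwiners_sym_block
proof (rule mat_space_dim_image[OF mat_space_dim_intertwiners_jordan_block])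
  let ?P = "sym_trans a" and ?Q = "sym_trans_inv b"
  have PX: "?P * X \<in> carrier_mat a b" "?P * X * ?Q \<in> carrier_mat a b" if "X \<in> carrier_mat a b" for X
  proof -
    show "?P * X \<in> carrier_mat a b" using that by (rule mult_carrier_mat[OF sym_trans_carrier(1)])
    then show "?P * X * ?Q \<in> carrier_mat a b" by (rule mult_carrier_mat) simp
  qed
  show "?P * X * ?Q \<in> carrier_mat a b" if "X \<in> carrier_mat a b" for X by (rule PX(2)[OF that])
  show "?P * (X + Y) * ?Q = ?P * X * ?Q + ?P * Y * ?Q" if "X \<in> carrier_mat a b" "Y \<in> carrier_mat a b" for X Y
    by (simp add: mult_add_distrib_mat[OF sym_trans_carrier(1) that]
        add_mult_distrib_mat[OF PX(1)[OF that(1)] PX(1)[OF that(2)] sym_trans_carrier(2)])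
  show "?P * (c \<cdot>\<^sub>m X) * ?Q = c \<cdot>\<^sub>m (?P * X * ?Q)" if "X \<in> carrier_mat a b" for c X
    by (simp add: mult_smult_distrib[OF sym_trans_carrier(1) that]
        mult_smult_assoc_mat[OF PX(1)[OF that] sym_trans_carrier(2)])
  have recover: "sym_trans_inv a * (?P * X * ?Q) * sym_trans b = X" if X: "X \<in> carrier_mat a b" for X
  proof -
    have "sym_trans_inv a * (?P * X * ?Q) * sym_trans b = (sym_trans_inv a * ?P) * X * (?Q * sym_trans b)"
      using X
      by (simp add: mat_mult_assoc_dim)
    then show ?thesis using X by (simp add: sym_trans_inverse)
  qed
  show "X = Y" if "X \<in> carrier_mat a b" "Y \<in> carrier_mat a b" "?P * X * ?Q = ?P * Y * ?Q" for X Y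
    using recover[OF that(1), unfolded that(3) recover[OF that(2)]] by (rule sym)
qed

text \<open>A commuting matrix is a square Toeplitz matrix, and reflecting both indices and then
  swapping them preserves i - j.\<close>

lemma persymmetric_commutant_jordan_block:
  assumes "Y \<in> intertwiners (jordan_block m z) (jordan_block m z)"
  shows "persymmetric m Y"
proof -
  obtain c where Y: "Y = toeplitz_param m m c" using assms toeplitz_param_image[of m m z] by auto
  show ?thesis unfolding persymmetric_def
  proof (intro allI impI)
    fix i j assume ij: "i < m" "j < m"
    then have "m - 1 - (m - 1 - j) + (m - 1 - i) = m - 1 - i + j" by simp
    then show "Y $$ (m - 1 - i, m - 1 - j) = Y $$ (j, i)" using ij by (simp add: Y toeplitz_param_def)
  qed
qed

text \<open>Everything commuting with a single block is symmetric, so only zero is skew.\<close>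

lemma skew_commutant_sym_block: "skew_commutant (sym_block m z) = {0\<^sub>m m m}"
proof (intro equalityI subsetI)
  fix X assume "X \<in> skew_commutant (sym_block m z)"
  then have X: "X \<in> carrier_mat m m" "X\<^sup>T = - X" and "X * sym_block m z = sym_block m z * X"
    by (auto simp: skew_commutant_def)
  then have "X \<in> intertwiners (sym_block m z) (sym_block m z)"
    by (simp add: intertwiners_def)
  then obtain Y where XY: "X = sym_trans m * Y * sym_trans_inv m" and
    Y: "Y \<in> intertwiners (jordan_block m z) (jordan_block m z)"
    unfolding intertwiners_sym_block by blast
  have "Y \<in> carrier_mat m m" using Y by (simp add: intertwiners_def)
  then have "X\<^sup>T = X" unfolding XY
    by (rule persymmetric_conj_symmetric) (rule persymmetric_commutant_jordan_block[OF Y])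
  with X have eq: "- X = X" by simp
  have "X $$ (i, j) = 0" if "i < m" "j < m" for i j
  proof -
    have "- (X $$ (i, j)) = (- X) $$ (i, j)" using that X(1) by simp
    then show ?thesis unfolding eq by simp
  qed
  then show "X \<in> {0\<^sub>m m m}" using X(1) by (auto intro!: eq_matI)
qed (auto simp: skew_commutant_def)

section \<open>Block matrices: splitting off one summand\<close>

lemma four_block_mat_eq_iff:
  fixes A A' :: "'a mat"
  assumes "A \<in> carrier_mat a c" "B \<in> carrier_mat a d" "C \<in> carrier_mat b c" "D \<in> carrier_mat b d"
    "A' \<in> carrier_mat a c" "B' \<in> carrier_mat a d" "C' \<in> carrier_mat b c" "D' \<in> carrier_mat b d"
  shows "four_block_mat A B C D = four_block_mat A' B' C' D' \<longleftrightarrow> A = A' \<and> B = B' \<and> C = C' \<and> D = D'"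
proof
  assume eq: "four_block_mat A B C D = four_block_mat A' B' C' D'"
  have e: "four_block_mat A B C D $$ (i, j) = four_block_mat A' B' C' D' $$ (i, j)" for i j using eq by simp
  have "A = A'"
  proof (rule eq_matI)
    fix i j assume "i < dim_row A'" "j < dim_col A'"
    then show "A $$ (i, j) = A' $$ (i, j)" using e[of i j] assms by simp
  qed (use assms in auto)
  moreover have "B = B'"
  proof (rule eq_matI)
    fix i j assume "i < dim_row B'" "j < dim_col B'"
    then show "B $$ (i, j) = B' $$ (i, j)" using e[of i "c + j"] assms by simp
  qed (use assms in auto)
  moreover have "C = C'"
  proof (rule eq_matI)
    fix i j assume "i < dim_row C'" "j < dim_col C'"
    then show "C $$ (i, j) = C' $$ (i, j)" using e[of "a + i" j] assms by simp
  qed (use assms in auto)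
  moreover have "D = D'"
  proof (rule eq_matI)
    fix i j assume "i < dim_row D'" "j < dim_col D'"
    then show "D $$ (i, j) = D' $$ (i, j)" using e[of "a + i" "c + j"] assms by simp
  qed (use assms in auto)
  ultimately show "A = A' \<and> B = B' \<and> C = C' \<and> D = D'" by simp
qed simp

lemma obtain_four_block:
  assumes "X \<in> carrier_mat (a + b) (c + d)"
  obtains P Q R S where "X = four_block_mat P Q R S" "P \<in> carrier_mat a c" "Q \<in> carrier_mat a d"
    "R \<in> carrier_mat b c" "S \<in> carrier_mat b d"
proof -
  obtain P Q R S where "split_block X a c = (P, Q, R, S)" by (cases "split_block X a c")
  from split_block[OF this, of b d] assms show ?thesis by (intro that) auto
qed

text \<open>Mirrors one step of the recursion of \<open>diag_block_mat\<close>, by which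
  \<open>sym_canonical\<close> is built.\<close>

definition block_diag :: "complex mat \<Rightarrow> complex mat \<Rightarrow> complex mat" where
  "block_diag A B = four_block_mat A (0\<^sub>m (dim_row A) (dim_col B)) (0\<^sub>m (dim_row B) (dim_col A)) B"

lemma mult_block_diag:
  assumes "P \<in> carrier_mat r a" "Q \<in> carrier_mat r b" "R \<in> carrier_mat s a" "S \<in> carrier_mat s b"
    "A \<in> carrier_mat a a" "B \<in> carrier_mat b b"
  shows "four_block_mat P Q R S * block_diag A B = four_block_mat (P * A) (Q * B) (R * A) (S * B)"
proof -
  have "block_diag A B = four_block_mat A (0\<^sub>m a b) (0\<^sub>m b a) B" using assms by (simp add: block_diag_def)
  moreover have "four_block_mat P Q R S * four_block_mat A (0\<^sub>m a b) (0\<^sub>m b a) B =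
    four_block_mat (P * A + Q * 0\<^sub>m b a) (P * 0\<^sub>m a b + Q * B) (R * A + S * 0\<^sub>m b a) (R * 0\<^sub>m a b + S * B)"
    by (rule mult_four_block_mat) (use assms in auto)
  moreover have "P * A \<in> carrier_mat r a" "Q * B \<in> carrier_mat r b" "R * A \<in> carrier_mat s a" "S * B \<in> carrier_mat s b"
    using assms by auto
  ultimately show ?thesis using assms by simp
qed

lemma block_diag_mult:
  assumes "P \<in> carrier_mat a r" "Q \<in> carrier_mat a s" "R \<in> carrier_mat b r" "S \<in> carrier_mat b s"
    "A \<in> carrier_mat a a" "B \<in> carrier_mat b b"
  shows "block_diag A B * four_block_mat P Q R S = four_block_mat (A * P) (A * Q) (B * R) (B * S)"
proof -
  have "block_diag A B = four_block_mat A (0\<^sub>m a b) (0\<^sub>m b a) B" using assms by (simp add: block_diag_def)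
  moreover have "four_block_mat A (0\<^sub>m a b) (0\<^sub>m b a) B * four_block_mat P Q R S =
    four_block_mat (A * P + 0\<^sub>m a b * R) (A * Q + 0\<^sub>m a b * S) (0\<^sub>m b a * P + B * R) (0\<^sub>m b a * Q + B * S)"
    by (rule mult_four_block_mat) (use assms in auto)
  moreover have "A * P \<in> carrier_mat a r" "A * Q \<in> carrier_mat a s" "B * R \<in> carrier_mat b r" "B * S \<in> carrier_mat b s"
    using assms by auto
  ultimately show ?thesis using assms by simp
qed

lemma mat_space_dim_intertwiners_block_diag:
  assumes A: "A \<in> carrier_mat a a" and B: "B \<in> carrier_mat b b" and C: "C \<in> carrier_mat c c"
    and d: "mat_space_dim a b d1 (intertwiners A B)" "mat_space_dim a c d2 (intertwiners A C)"
  shows "mat_space_dim a (b + c) (d1 + d2) (intertwiners A (block_diag B C))"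
proof -
  \<comment> \<open>The row (X Y), given lower blocks of height zero so that the product rules for
    four blocks apply to it.\<close>
  let ?T = "\<lambda>X Y. four_block_mat X Y (0\<^sub>m 0 b) (0\<^sub>m 0 c) :: complex mat"
  have "mat_space_dim a (b + c) (d1 + d2) {?T X Y | X Y. X \<in> intertwiners A B \<and> Y \<in> intertwiners A C}"
  proof (rule mat_space_dim_sum[OF d])
    fix X Y X' Y' :: "complex mat" and k
    assume X: "X \<in> carrier_mat a b" and Y: "Y \<in> carrier_mat a c"
    show "?T X Y \<in> carrier_mat a (b + c)" using four_block_carrier_mat[OF X, of "0\<^sub>m 0 c" 0 c] by simp
    show "?T (k \<cdot>\<^sub>m X) (k \<cdot>\<^sub>m Y) = k \<cdot>\<^sub>m ?T X Y" using X Y by (intro eq_matI) auto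
    assume X': "X' \<in> carrier_mat a b" and Y': "Y' \<in> carrier_mat a c"
    show "?T (X + X') (Y + Y') = ?T X Y + ?T X' Y'" using X Y X' Y' by (intro eq_matI) auto
    show "X = X' \<and> Y = Y'" if "?T X Y = ?T X' Y'"
      using that four_block_mat_eq_iff[OF X Y _ _ X' Y', of "0\<^sub>m 0 b" 0 "0\<^sub>m 0 c"] by simp
  qed
  moreover have "{?T X Y | X Y. X \<in> intertwiners A B \<and> Y \<in> intertwiners A C} = intertwiners A (block_diag B C)"
  proof -
    have dims: "dim_row (block_diag B C) = b + c" using B C by (simp add: block_diag_def)
    \<comment> \<open>For the same reason \<open>A\<close> is viewed as a block diagonal matrix with
      an empty second block.\<close>
    have Am: "block_diag A (0\<^sub>m 0 0) = A" using A by (intro eq_matI) (auto simp: block_diag_def)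
    have iff: "?T X Y * block_diag B C = A * ?T X Y \<longleftrightarrow> X * B = A * X \<and> Y * C = A * Y"
      if X: "X \<in> carrier_mat a b" and Y: "Y \<in> carrier_mat a c" for X Y
    proof -
      have l: "?T X Y * block_diag B C = ?T (X * B) (Y * C)"
        using mult_block_diag[OF X Y, of "0\<^sub>m 0 b" 0 "0\<^sub>m 0 c" B C] B C by simp
      have r: "A * ?T X Y = ?T (A * X) (A * Y)"
        using block_diag_mult[OF X Y, of "0\<^sub>m 0 b" 0 "0\<^sub>m 0 c" A "0\<^sub>m 0 0"] A by (simp add: Am)
      show ?thesis unfolding l r
        by (subst four_block_mat_eq_iff[of _ a b _ c _ 0]) (use A B C X Y in auto)
    qed
    show ?thesis
    proof (intro equalityI subsetI)
      fix Z assume "Z \<in> intertwiners A (block_diag B C)"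
      then have Z: "Z \<in> carrier_mat (a + 0) (b + c)" "Z * block_diag B C = A * Z"
        using A dims by (auto simp: intertwiners_def)
      obtain P Q R S where PQ: "Z = four_block_mat P Q R S" "P \<in> carrier_mat a b" "Q \<in> carrier_mat a c"
        "R \<in> carrier_mat 0 b" "S \<in> carrier_mat 0 c" using obtain_four_block[OF Z(1)] by blast
      have "R = 0\<^sub>m 0 b" "S = 0\<^sub>m 0 c" using PQ by (auto intro!: eq_matI)
      then have "Z = ?T P Q" using PQ by simp
      moreover from this have "P \<in> intertwiners A B" "Q \<in> intertwiners A C"
        using iff[OF PQ(2,3)] Z(2) PQ A B C by (auto simp: intertwiners_def)
      ultimately show "Z \<in> {?T X Y | X Y. X \<in> intertwiners A B \<and> Y \<in> intertwiners A C}" by blast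
    next
      fix Z assume "Z \<in> {?T X Y | X Y. X \<in> intertwiners A B \<and> Y \<in> intertwiners A C}"
      then obtain X Y where Z: "Z = ?T X Y" "X \<in> intertwiners A B" "Y \<in> intertwiners A C" by blast
      then have XY: "X \<in> carrier_mat a b" "Y \<in> carrier_mat a c" "X * B = A * X" "Y * C = A * Y"
        using A B C by (auto simp: intertwiners_def)
      then have "?T X Y * block_diag B C = A * ?T X Y" using iff by blast
      moreover have "?T X Y \<in> carrier_mat a (b + c)" using four_block_carrier_mat[OF XY(1), of "0\<^sub>m 0 c" 0 c] by simp
      ultimately show "Z \<in> intertwiners A (block_diag B C)" using Z A dims by (simp add: intertwiners_def)
    qed
  qed
  ultimately show ?thesis by simp
qed

text \<open>A skew matrix has the blocks P, X, -X^T, Y with P and Y skew. Commutation holds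
  blockwise: it puts P into \<open>skew_commutant A\<close>, which is zero, X into the intertwiners
  and Y into \<open>skew_commutant B\<close>. X and Y are then free.\<close>

lemma mat_space_dim_skew_commutant_block_diag:
  assumes A: "A \<in> carrier_mat a a" "A\<^sup>T = A" and B: "B \<in> carrier_mat b b" "B\<^sup>T = B"
    and sA: "skew_commutant A = {0\<^sub>m a a}"
    and d: "mat_space_dim a b d1 (intertwiners A B)" "mat_space_dim b b d2 (skew_commutant B)"
  shows "mat_space_dim (a + b) (a + b) (d1 + d2) (skew_commutant (block_diag A B))"
proof -
  let ?T = "\<lambda>X Y. four_block_mat (0\<^sub>m a a) X (- X\<^sup>T) Y :: complex mat"
  have "mat_space_dim (a + b) (a + b) (d1 + d2) {?T X Y | X Y. X \<in> intertwiners A B \<and> Y \<in> skew_commutant B}"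
  proof (rule mat_space_dim_sum[OF d])
    fix X Y X' Y' :: "complex mat" and k
    assume X: "X \<in> carrier_mat a b" and Y: "Y \<in> carrier_mat b b"
    show "?T X Y \<in> carrier_mat (a + b) (a + b)" using Y by simp
    show "?T (k \<cdot>\<^sub>m X) (k \<cdot>\<^sub>m Y) = k \<cdot>\<^sub>m ?T X Y" using X Y by (intro eq_matI) auto
    assume X': "X' \<in> carrier_mat a b" and Y': "Y' \<in> carrier_mat b b"
    show "?T (X + X') (Y + Y') = ?T X Y + ?T X' Y'" using X Y X' Y' by (intro eq_matI) auto
    show "X = X' \<and> Y = Y'" if "?T X Y = ?T X' Y'"
      using that X Y X' Y' four_block_mat_eq_iff[of "0\<^sub>m a a" a a X b "- X\<^sup>T" b Y "0\<^sub>m a a" X' "- X'\<^sup>T" Y'] by simp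
  qed
  moreover have "{?T X Y | X Y. X \<in> intertwiners A B \<and> Y \<in> skew_commutant B} = skew_commutant (block_diag A B)"
  proof -
    have dims: "dim_row (block_diag A B) = a + b" using A B by (simp add: block_diag_def)
    have comm: "four_block_mat P Q R S * block_diag A B = block_diag A B * four_block_mat P Q R S \<longleftrightarrow>
        P * A = A * P \<and> Q * B = A * Q \<and> R * A = B * R \<and> S * B = B * S"
      if c: "P \<in> carrier_mat a a" "Q \<in> carrier_mat a b" "R \<in> carrier_mat b a" "S \<in> carrier_mat b b" for P Q R S
      unfolding mult_block_diag[OF c A(1) B(1)] block_diag_mult[OF c A(1) B(1)]
      by (rule four_block_mat_eq_iff) (use A(1) B(1) c in auto)
    have skew: "(four_block_mat P Q R S)\<^sup>T = - four_block_mat P Q R S \<longleftrightarrow>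
        P\<^sup>T = - P \<and> R\<^sup>T = - Q \<and> Q\<^sup>T = - R \<and> S\<^sup>T = - S"
      if c: "P \<in> carrier_mat a a" "Q \<in> carrier_mat a b" "R \<in> carrier_mat b a" "S \<in> carrier_mat b b" for P Q R S :: "complex mat"
    proof -
      have m: "- four_block_mat P Q R S = four_block_mat (- P) (- Q) (- R) (- S)"
        using c by (intro eq_matI) auto
      show ?thesis unfolding m transpose_four_block_mat[OF c]
        by (rule four_block_mat_eq_iff) (use c in auto)
    qed
    \<comment> \<open>The condition on the lower left block is the transpose of that on the upper
      right one; this is where the symmetry of \<open>A\<close> and \<open>B\<close> enters.\<close>
    have third: "R * A = B * R" if "R = - X\<^sup>T" "X * B = A * X" "X \<in> carrier_mat a b" for R X
    proof -
      have "(X * B)\<^sup>T = (A * X)\<^sup>T" using that by simp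
      then have "B * X\<^sup>T = X\<^sup>T * A"
        using transpose_mult[OF that(3) B(1)] transpose_mult[OF A(1) that(3)] A B by simp
      then show ?thesis using that A B by simp
    qed
    show ?thesis
    proof (intro equalityI subsetI)
      fix Z assume "Z \<in> skew_commutant (block_diag A B)"
      then have Z: "Z \<in> carrier_mat (a + b) (a + b)" "Z * block_diag A B = block_diag A B * Z" "Z\<^sup>T = - Z"
        using dims by (auto simp: skew_commutant_def)
      obtain P Q R S where PQ: "Z = four_block_mat P Q R S" and c: "P \<in> carrier_mat a a" "Q \<in> carrier_mat a b"
        "R \<in> carrier_mat b a" "S \<in> carrier_mat b b" using obtain_four_block[OF Z(1)] by blast
      have s: "P\<^sup>T = - P" "Q\<^sup>T = - R" "S\<^sup>T = - S" using skew[OF c] Z(3) PQ by auto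
      have m: "P * A = A * P" "Q * B = A * Q" "S * B = B * S" using comm[OF c] Z(2) PQ by auto
      have "P \<in> skew_commutant A" using s m c A by (auto simp: skew_commutant_def)
      then have P: "P = 0\<^sub>m a a" using sA by simp
      have "Z = ?T Q S" using PQ P s(2) by simp
      moreover have "Q \<in> intertwiners A B" "S \<in> skew_commutant B"
        using s m c A B by (auto simp: intertwiners_def skew_commutant_def)
      ultimately show "Z \<in> {?T X Y | X Y. X \<in> intertwiners A B \<and> Y \<in> skew_commutant B}" by blast
    next
      fix Z assume "Z \<in> {?T X Y | X Y. X \<in> intertwiners A B \<and> Y \<in> skew_commutant B}"
      then obtain X Y where Z: "Z = ?T X Y" "X \<in> intertwiners A B" "Y \<in> skew_commutant B" by blast
      then have XY: "X \<in> carrier_mat a b" "Y \<in> carrier_mat b b" "X * B = A * X" "Y * B = B * Y" "Y\<^sup>T = - Y"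
        using A B by (auto simp: intertwiners_def skew_commutant_def)
      have c: "0\<^sub>m a a \<in> carrier_mat a a" "- X\<^sup>T \<in> carrier_mat b a" using XY by auto
      note cs = c(1) XY(1) c(2) XY(2)
      have "Z * block_diag A B = block_diag A B * Z"
        unfolding Z(1) comm[OF cs] using third[OF refl XY(3,1)] XY A by simp
      moreover have "Z\<^sup>T = - Z" unfolding Z(1) skew[OF cs] using XY by (auto simp: transpose_uminus)
      moreover have "Z \<in> carrier_mat (a + b) (a + b)" using Z(1) XY by simp
      ultimately show "Z \<in> skew_commutant (block_diag A B)" using dims by (simp add: skew_commutant_def)
    qed
  qed
  ultimately show ?thesis by simp
qed

section \<open>The skew commutant of the canonical form\<close>

lemma sym_canonical_Nil: "sym_canonical [] = 0\<^sub>m 0 0"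
  by (simp add: sym_canonical_def)

lemma sym_canonical_Cons: "sym_canonical ((m, z) # xs) = block_diag (sym_block m z) (sym_canonical xs)"
  by (simp add: sym_canonical_def block_diag_def Let_def)

lemma sym_canonical_carrier: "sym_canonical xs \<in> carrier_mat (sum_list (map fst xs)) (sum_list (map fst xs))"
proof (induction xs)
  case Nil
  show ?case by (simp only: sym_canonical_Nil list.map sum_list.Nil zero_carrier_mat)
next
  case (Cons x xs)
  obtain m z where x: "x = (m, z)" by (cases x)
  show ?case unfolding x sym_canonical_Cons block_diag_def
    by (rule carrier_matI) (use carrier_matD[OF Cons.IH] in simp_all)
qed

lemma sym_canonical_symmetric: "(sym_canonical xs)\<^sup>T = sym_canonical xs"
proof (induction xs)
  case (Cons x xs)
  obtain m z where x: "x = (m, z)" by (cases x)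
  note c = carrier_matD[OF sym_canonical_carrier[of xs]] sym_block_carrier[of m z]
  show ?case unfolding x sym_canonical_Cons block_diag_def
    using c Cons.IH sym_block_symmetric[of m z]
    by (subst transpose_four_block_mat[OF sym_block_carrier(1)[of m z] _ _ sym_canonical_carrier[of xs]]) auto
qed (simp add: sym_canonical_Nil)

text \<open>Dimension of the space of intertwiners of the two symmetric blocks with these sizes and
  eigenvalues.\<close>

definition hom_dim :: "nat \<times> complex \<Rightarrow> nat \<times> complex \<Rightarrow> nat" where
  "hom_dim x y = (if snd x = snd y then min (fst x) (fst y) else 0)"

text \<open>The recursion follows the splitting off of the first block. Unfolded, it is a sum over
  pairs of positions in the list, so equal blocks at different positions count as well.\<close>

fun stab_dim :: "(nat \<times> complex) list \<Rightarrow> nat" where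
  "stab_dim [] = 0"
| "stab_dim (x # xs) = (\<Sum>y\<leftarrow>xs. hom_dim x y) + stab_dim xs"

lemma mat_space_dim_intertwiners_sym_canonical:
  "mat_space_dim m (sum_list (map fst xs)) (\<Sum>y\<leftarrow>xs. hom_dim (m, z) y) (intertwiners (sym_block m z) (sym_canonical xs))"
proof (induction xs)
  case Nil
  have "intertwiners (sym_block m z) (sym_canonical []) = {0\<^sub>m m 0}"
    by (auto simp: intertwiners_def sym_canonical_Nil intro!: eq_matI)
  then show ?case using mat_space_dim_zero[of m 0] by simp
next
  case (Cons x xs)
  obtain b y where x: "x = (b, y)" by (cases x)
  have "mat_space_dim m b (hom_dim (m, z) x) (intertwiners (sym_block m z) (sym_block b y))"
    using mat_space_dim_intertwiners_sym_block[of m b z y] by (simp only: x hom_dim_def fst_conv snd_conv)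
  from mat_space_dim_intertwiners_block_diag[OF sym_block_carrier(1) sym_block_carrier(1) sym_canonical_carrier this Cons.IH]
  show ?case by (simp add: x sym_canonical_Cons)
qed

lemma mat_space_dim_skew_commutant_sym_canonical:
  "mat_space_dim (sum_list (map fst xs)) (sum_list (map fst xs)) (stab_dim xs) (skew_commutant (sym_canonical xs))"
proof (induction xs)
  case Nil
  have "skew_commutant (sym_canonical []) = {0\<^sub>m 0 0}"
    by (auto simp: skew_commutant_def sym_canonical_Nil intro!: eq_matI)
  then show ?case using mat_space_dim_zero[of 0 0] by simp
next
  case (Cons x xs)
  obtain m z where x: "x = (m, z)" by (cases x)
  from mat_space_dim_skew_commutant_block_diag[OF sym_block_carrier(1) sym_block_symmetric sym_canonical_carrier
      sym_canonical_symmetric skew_commutant_sym_block mat_space_dim_intertwiners_sym_canonical Cons.IH]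
  show ?case by (simp add: x sym_canonical_Cons)
qed

section \<open>The dimension of the stabilizer\<close>

text \<open>Gaussian elimination, one column at a time: once \<open>F\<close> straightens the first
  d columns of \<phi>, an elementary map brings the next one to a unit vector without disturbing
  them. Inverses are built alongside, since the chart needs both directions.\<close>

lemma straighten_linear_image:
  assumes "clinear_vec d n \<phi>" "inj_on \<phi> (carrier_vec d)"
  shows "d \<le> n \<and> (\<exists>F G. clinear_vec n n F \<and> clinear_vec n n G \<and>
    (\<forall>v\<in>carrier_vec n. G (F v) = v \<and> F (G v) = v) \<and>
    (\<forall>v\<in>carrier_vec d. F (\<phi> v) = vec n (\<lambda>i. if i < d then v $ i else 0)))"
  using assms
proof (induction d arbitrary: \<phi>)
  case 0
  have "\<phi> v = vec n (\<lambda>i. if i < 0 then v $ i else 0)" if "v \<in> carrier_vec 0" for v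
  proof -
    have "v = 0\<^sub>v 0" using that by (intro eq_vecI) auto
    then show ?thesis using clinear_vec_zero[OF 0(1)] by (simp add: zero_vec_def)
  qed
  then show ?case by (intro conjI exI[of _ "\<lambda>v. v"]) (auto simp: clinear_vec_def)
next
  case (Suc d)
  note phi = clinear_vecD[OF Suc.prems(1)]
  \<comment> \<open>The inclusion of C^d in C^(d+1); the induction hypothesis is applied to the
    restriction of \<phi> along it.\<close>
  define ext where "ext = (\<lambda>u :: complex vec. vec (Suc d) (\<lambda>i. if i < d then u $ i else 0))"
  have ext: "clinear_vec d (Suc d) ext" by (auto simp: clinear_vec_def ext_def)
  have extc: "ext u \<in> carrier_vec (Suc d)" for u by (simp add: ext_def)
  have inj_ext: "u = v" if "u \<in> carrier_vec d" "v \<in> carrier_vec d" "ext u = ext v" for u v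
  proof (rule eq_vecI)
    fix i assume "i < dim_vec v"
    then have i: "i < d" using that by simp
    have "ext u $ i = ext v $ i" by (simp only: that(3))
    then show "u $ i = v $ i" using i by (simp add: ext_def)
  qed (use that in auto)
  have inj_phi: "u = v" if "u \<in> carrier_vec (Suc d)" "v \<in> carrier_vec (Suc d)" "\<phi> u = \<phi> v" for u v
    using Suc.prems(2) that by (auto simp: inj_on_def)
  have "inj_on (\<lambda>u. \<phi> (ext u)) (carrier_vec d)"
  proof (rule inj_onI)
    fix u v :: "complex vec" assume uv: "u \<in> carrier_vec d" "v \<in> carrier_vec d" "\<phi> (ext u) = \<phi> (ext v)"
    show "u = v" by (rule inj_ext[OF uv(1,2) inj_phi[OF extc extc uv(3)]])
  qed
  from Suc.IH[OF clinear_vec_compose[OF ext Suc.prems(1)] this] obtain F G where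
    F: "clinear_vec n n F" and G: "clinear_vec n n G" and
    GF: "\<And>v. v \<in> carrier_vec n \<Longrightarrow> G (F v) = v" "\<And>v. v \<in> carrier_vec n \<Longrightarrow> F (G v) = v" and
    Fphi: "\<And>u. u \<in> carrier_vec d \<Longrightarrow> F (\<phi> (ext u)) = vec n (\<lambda>i. if i < d then u $ i else 0)"
    by blast
  note Fl = clinear_vecD[OF F] and Gl = clinear_vecD[OF G]
  let ?e = "unit_vec (Suc d) d :: complex vec"
  have e: "?e \<in> carrier_vec (Suc d)" by simp
  define w where "w = F (\<phi> ?e)"
  have w: "w \<in> carrier_vec n" unfolding w_def by (intro Fl(1) phi(1) e)
  \<comment> \<open>A pivot exists: otherwise the new column \<open>w\<close> would lie in the span
    of the straightened ones, against the injectivity of \<phi>.\<close>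
  have "\<exists>i\<in>{d..<n}. w $ i \<noteq> 0"
  proof (rule ccontr)
    assume "\<not> ?thesis"
    then have z: "w $ i = 0" if "d \<le> i" "i < n" for i using that by auto
    define u where "u = vec d (\<lambda>i. w $ i)"
    have u: "u \<in> carrier_vec d" by (simp add: u_def)
    have "F (\<phi> (ext u)) = w" unfolding Fphi[OF u] using w z by (intro eq_vecI) (auto simp: u_def)
    then have "G (F (\<phi> (ext u))) = G (F (\<phi> ?e))" by (simp add: w_def)
    then have "\<phi> (ext u) = \<phi> ?e" using GF(1)[OF phi(1)[OF extc]] GF(1)[OF phi(1)[OF e]] by simp
    then have "ext u = ?e" by (rule inj_phi[OF extc e])
    then have "ext u $ d = ?e $ d" by simp
    then show False by (simp add: ext_def)
  qed
  then obtain p where p: "d \<le> p" "p < n" "w $ p \<noteq> 0" by auto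
  \<comment> \<open>The transposition of the pivot position \<open>p\<close> with position
    \<open>d\<close>.\<close>
  define \<sigma> where "\<sigma> = (\<lambda>r. if r = p then d else if r = d then p else r)"
  have \<sigma>: "\<sigma> (\<sigma> r) = r" "r < n \<Longrightarrow> \<sigma> r < n" for r using p by (auto simp: \<sigma>_def)
  have \<sigma>d: "\<sigma> d = p" by (simp add: \<sigma>_def)
  \<comment> \<open>Moves the pivot to position \<open>d\<close>, scales it to 1 and clears the
    other entries of \<open>w\<close>. Vectors supported below \<open>d\<close> are fixed, as their
    entry at \<open>p\<close> is zero. \<open>E'\<close> is the inverse.\<close>
  define E where "E = (\<lambda>v :: complex vec. vec n (\<lambda>r. if r = d then v $ p / w $ p else v $ \<sigma> r - w $ \<sigma> r / w $ p * v $ p))"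
  define E' where "E' = (\<lambda>x :: complex vec. vec n (\<lambda>r. if \<sigma> r = d then w $ p * x $ d else x $ \<sigma> r + w $ r * x $ d))"
  have dn: "d < n" using p by simp
  have E: "clinear_vec n n E"
    unfolding clinear_vec_def E_def using p dn \<sigma>(2) by (auto simp: algebra_simps add_divide_distrib intro!: eq_vecI)
  have E': "clinear_vec n n E'"
    unfolding clinear_vec_def E'_def using p dn \<sigma>(2) by (auto simp: algebra_simps intro!: eq_vecI)
  have pd: "\<sigma> r = d \<longleftrightarrow> r = p" for r using \<sigma>(1)[of r] \<sigma>d by (metis \<sigma>_def)
  have E'E: "E' (E v) = v" if "v \<in> carrier_vec n" for v
    using that p dn \<sigma> by (intro eq_vecI) (auto simp: E_def E'_def pd)
  have EE': "E (E' v) = v" if "v \<in> carrier_vec n" for v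
  proof (rule eq_vecI)
    fix r assume "r < dim_vec v"
    then have r: "r < n" using that by simp
    show "E (E' v) $ r = v $ r"
    proof (cases "r = d")
      case True
      then show ?thesis using r p by (simp add: E_def E'_def pd)
    next
      case False
      then have "\<sigma> r \<noteq> p" using \<sigma>(1)[of r] pd by metis
      then show ?thesis using r p False \<sigma> by (simp add: E_def E'_def pd)
    qed
  qed (use that in \<open>auto simp: E_def\<close>)
  have main: "E (F (\<phi> v)) = vec n (\<lambda>i. if i < Suc d then v $ i else 0)" if v: "v \<in> carrier_vec (Suc d)" for v
  proof -
    define u where "u = vec d (\<lambda>i. v $ i)"
    have u: "u \<in> carrier_vec d" by (simp add: u_def)
    have "v = ext u + v $ d \<cdot>\<^sub>v ?e"
      using v by (intro eq_vecI) (auto simp: ext_def u_def less_Suc_eq unit_vec_def)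
    then have "F (\<phi> v) = F (\<phi> (ext u + v $ d \<cdot>\<^sub>v ?e))" by simp
    also have "\<dots> = F (\<phi> (ext u)) + v $ d \<cdot>\<^sub>v w"
      unfolding w_def using phi Fl extc e by simp
    finally have Fv: "F (\<phi> v) = vec n (\<lambda>i. if i < d then u $ i else 0) + v $ d \<cdot>\<^sub>v w" by (simp add: Fphi[OF u])
    show ?thesis
    proof (rule eq_vecI)
      fix r assume "r < dim_vec (vec n (\<lambda>i. if i < Suc d then v $ i else 0))"
      then have r: "r < n" by simp
      have \<sigma>r: "\<sigma> r < d \<longleftrightarrow> r < d" "r < d \<Longrightarrow> \<sigma> r = r" if "r \<noteq> d" using that p by (auto simp: \<sigma>_def)
      show "E (F (\<phi> v)) $ r = vec n (\<lambda>i. if i < Suc d then v $ i else 0) $ r"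
        using r p w \<sigma>(2)[OF r] \<sigma>r dn by (auto simp: Fv E_def u_def)
    qed (simp add: E_def)
  qed
  show ?case
  proof (intro conjI exI ballI)
    show "Suc d \<le> n" using dn by simp
    show "clinear_vec n n (\<lambda>v. E (F v))" by (rule clinear_vec_compose[OF F E])
    show "clinear_vec n n (\<lambda>v. G (E' v))" by (rule clinear_vec_compose[OF E' G])
    fix v :: "complex vec" assume v: "v \<in> carrier_vec n"
    show "G (E' (E (F v))) = v" using E'E[OF Fl(1)[OF v]] GF(1)[OF v] by simp
    show "E (F (G (E' v))) = v" using GF(2)[OF clinear_vecD(1)[OF E' v]] EE'[OF v] by simp
  qed (rule main)
qed

lemma dim_stab_eq:
  assumes B: "B \<in> carrier_mat k k" and d: "mat_space_dim k k d (skew_commutant B)"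
  shows "dim_stab B = d"
proof -
  let ?n = "k * k"
  obtain \<phi> where \<phi>: "linear_param d k k \<phi>" and im: "\<phi> ` carrier_vec d = skew_commutant B"
    using d by (auto simp: mat_space_dim_def)
  have c: "\<phi> v \<in> carrier_mat k k" if "v \<in> carrier_vec d" for v using \<phi> that by (auto simp: linear_param_def)
  have lin: "clinear_vec d ?n (\<lambda>v. vec_of_square k (\<phi> v))"
    using \<phi> c by (simp add: clinear_vec_def linear_param_def vec_of_square_add vec_of_square_smult)
  have "inj_on (\<lambda>v. vec_of_square k (\<phi> v)) (carrier_vec d)"
  proof (rule inj_onI)
    fix u v :: "complex vec" assume uv: "u \<in> carrier_vec d" "v \<in> carrier_vec d" "vec_of_square k (\<phi> u) = vec_of_square k (\<phi> v)"
    have "square_of_vec k (vec_of_square k (\<phi> u)) = square_of_vec k (vec_of_square k (\<phi> v))" by (simp only: uv(3))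
    then have "\<phi> u = \<phi> v" by (simp only: square_of_vec_of_square[OF c[OF uv(1)]] square_of_vec_of_square[OF c[OF uv(2)]])
    then show "u = v" using \<phi> uv by (auto simp: linear_param_def inj_on_def)
  qed
  from straighten_linear_image[OF lin this] obtain F G where dn: "d \<le> ?n" and
    F: "clinear_vec ?n ?n F" and G: "clinear_vec ?n ?n G" and
    GF: "\<And>v. v \<in> carrier_vec ?n \<Longrightarrow> G (F v) = v" "\<And>v. v \<in> carrier_vec ?n \<Longrightarrow> F (G v) = v" and
    Fphi: "\<And>v. v \<in> carrier_vec d \<Longrightarrow> F (vec_of_square k (\<phi> v)) = vec ?n (\<lambda>i. if i < d then v $ i else 0)"
    by blast
  have "x \<in> vec_of_square k ` skew_commutant B \<longleftrightarrow> (\<forall>i\<in>{d..<?n}. F x $ i = 0)" if x: "x \<in> carrier_vec ?n" for x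
  proof
    assume "x \<in> vec_of_square k ` skew_commutant B"
    then obtain v where v: "v \<in> carrier_vec d" "x = vec_of_square k (\<phi> v)"
      unfolding im[symmetric] image_image by auto
    show "\<forall>i\<in>{d..<?n}. F x $ i = 0" unfolding v(2) Fphi[OF v(1)] by simp
  next
    assume z: "\<forall>i\<in>{d..<?n}. F x $ i = 0"
    \<comment> \<open>The parameters of \<open>x\<close> are its first d straightened coordinates;
      the remaining ones vanish by assumption.\<close>
    define v where "v = vec d (\<lambda>i. F x $ i)"
    have v: "v \<in> carrier_vec d" by (simp add: v_def)
    have "F (vec_of_square k (\<phi> v)) = F x"
      unfolding Fphi[OF v] using z dn clinear_vecD(1)[OF F x] by (intro eq_vecI) (auto simp: v_def)
    then have "G (F (vec_of_square k (\<phi> v))) = G (F x)" by simp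
    then have "vec_of_square k (\<phi> v) = x" using GF(1)[OF x] GF(1)[OF vec_of_square_carrier(1)] by simp
    then show "x \<in> vec_of_square k ` skew_commutant B"
      using imageI[OF imageI[OF v, of \<phi>], of "vec_of_square k"] im by simp
  qed
  then show ?thesis by (intro dim_stab_eqI[OF B] orth_stab_submanifold[OF B F G GF dn])
qed

lemma dim_stab_sym_canonical: "dim_stab (sym_canonical xs) = stab_dim xs"
  by (rule dim_stab_eq[OF sym_canonical_carrier mat_space_dim_skew_commutant_sym_canonical])

section \<open>Counting pairs of blocks\<close>

lemma sum_list_hom_dim_filter: "(\<Sum>y\<leftarrow>filter (\<lambda>y. snd y = snd x) xs. hom_dim x y) = (\<Sum>y\<leftarrow>xs. hom_dim x y)"
  by (induction xs) (auto simp: hom_dim_def)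

text \<open>Pairs with distinct eigenvalues contribute zero, so the sum over pairs splits by
  eigenvalue. An element of \<open>S\<close> that is no eigenvalue contributes an empty
  list.\<close>

lemma stab_dim_eq_sum_filter:
  assumes "finite S" "snd ` set xs \<subseteq> S"
  shows "stab_dim xs = (\<Sum>\<rho>\<in>S. stab_dim (filter (\<lambda>x. snd x = \<rho>) xs))"
  using assms(2)
proof (induction xs)
  case (Cons x xs)
  have "(\<Sum>\<rho>\<in>S. stab_dim (filter (\<lambda>x. snd x = \<rho>) (x # xs))) =
    (\<Sum>\<rho>\<in>S. (if snd x = \<rho> then (\<Sum>y\<leftarrow>filter (\<lambda>y. snd y = snd x) xs. hom_dim x y) else 0) + stab_dim (filter (\<lambda>x. snd x = \<rho>) xs))"
    by (intro sum.cong) auto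
  also have "\<dots> = (\<Sum>y\<leftarrow>xs. hom_dim x y) + (\<Sum>\<rho>\<in>S. stab_dim (filter (\<lambda>x. snd x = \<rho>) xs))"
    using Cons.prems assms(1) by (simp add: sum.distrib sum_list_hom_dim_filter)
  finally show ?case using Cons by simp
qed simp

lemma spectrum_jordan_nf:
  fixes A :: "complex mat"
  assumes A: "A \<in> carrier_mat n n" and J: "jordan_nf A n_as"
  shows "spectrum A = snd ` set n_as"
proof -
  \<comment> \<open>A block of size zero would list an eigenvalue that is no root of the
    characteristic polynomial; a Jordan normal form excludes such blocks.\<close>
  have 0: "0 \<notin> fst ` set n_as" using J by (simp add: jordan_nf_def)
  have root: "poly (\<Prod>(m, a)\<leftarrow>xs. [:- a, 1:] ^ m) z = 0 \<longleftrightarrow> z \<in> snd ` set xs"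
    if "0 \<notin> fst ` set xs" for xs :: "(nat \<times> complex) list" and z
    using that by (induction xs) auto
  show ?thesis
    using eigenvalue_root_char_poly[OF A] jordan_nf_char_poly[OF J] root[OF 0]
    by (auto simp: spectrum_def)
qed

lemma stab_dim_append:
  "stab_dim (xs @ ys) = stab_dim xs + stab_dim ys + (\<Sum>x\<leftarrow>xs. \<Sum>y\<leftarrow>ys. hom_dim x y)"
  by (induction xs) auto

text \<open>There are m (m - 1) / 2 pairs, each contributing a. Over the reals the factor m - 1 is
  not truncated at m = 0.\<close>

lemma stab_dim_replicate: "real (stab_dim (replicate m (a, z))) = real a * real m * (1 / 2 * (real m - 1))"
proof (induction m)
  case (Suc m)
  then show ?case by (simp add: sum_list_replicate hom_dim_def map_replicate field_simps)
qed simp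

lemma sum_list_hom_dim_replicate: "(\<Sum>x\<leftarrow>replicate k (b, l). \<Sum>y\<leftarrow>replicate m (a, l). hom_dim x y) = k * (m * min b a)"
  by (simp add: sum_list_replicate map_replicate hom_dim_def)

text \<open>Groups are appended at the end, that is in order of decreasing size, so the r-th group
  meets exactly the blocks of the groups s < r, all of them larger.\<close>

lemma stab_dim_concat_replicate:
  fixes \<alpha> m :: "nat \<Rightarrow> nat"
  assumes "strict_antimono_on {1..N} \<alpha>"
  shows "real (stab_dim (concat (map (\<lambda>r. replicate (m r) (\<alpha> r, l)) [1..<N + 1]))) =
    (\<Sum>r = 1..N. real (\<alpha> r) * real (m r) * (1 / 2 * (real (m r) - 1) + (\<Sum>s\<in>{1..<r}. real (m s))))"
  using assms
proof (induction N)
  case (Suc N)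
  let ?L = "\<lambda>N. concat (map (\<lambda>r. replicate (m r) (\<alpha> r, l)) [1..<N + 1])"
  let ?a = "\<alpha> (Suc N)" and ?m = "m (Suc N)"
  have "strict_antimono_on {1..N} \<alpha>"
    using Suc.prems by (rule monotone_on_subset) auto
  note IH = Suc.IH[OF this]
  \<comment> \<open>The new blocks are the smallest, so the minimum of the sizes is
    \<open>?a\<close> for every earlier block, whatever its own size.\<close>
  have cross: "(\<Sum>x\<leftarrow>concat (map (\<lambda>r. replicate (m r) (\<alpha> r, l)) rs). \<Sum>y\<leftarrow>replicate ?m (?a, l). hom_dim x y)
     = (\<Sum>r\<leftarrow>rs. m r) * (?m * ?a)" if "\<And>r. r \<in> set rs \<Longrightarrow> ?a \<le> \<alpha> r" for rs
    using that
  proof (induction rs)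
    case (Cons r rs)
    have "min (\<alpha> r) ?a = ?a" using Cons.prems[of r] by simp
    then show ?case using Cons.IH Cons.prems sum_list_hom_dim_replicate[where k = "m r" and b = "\<alpha> r" and l = l and m = ?m and a = ?a]
      by (simp del: map_replicate add: distrib_right)
  qed simp
  have less: "?a \<le> \<alpha> r" if "r \<in> set [1..<N + 1]" for r
    using Suc.prems that by (auto simp: monotone_on_def intro!: less_imp_le)
  have "?L (Suc N) = ?L N @ replicate ?m (?a, l)" by simp
  then have "real (stab_dim (?L (Suc N))) = real (stab_dim (?L N)) + real (stab_dim (replicate ?m (?a, l)))
     + real ((\<Sum>r\<leftarrow>[1..<N + 1]. m r) * (?m * ?a))"
    using cross[OF less] by (simp only: stab_dim_append of_nat_add)
  also have "(\<Sum>r\<leftarrow>[1..<N + 1]. m r) = (\<Sum>s\<in>{1..<Suc N}. m s)" by (simp only: interv_sum_list_conv_sum_set_nat set_upt Suc_eq_plus1)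
  finally have eq: "real (stab_dim (?L (Suc N))) = real (stab_dim (?L N)) + real ?a * real ?m * (1 / 2 * (real ?m - 1))
     + real ((\<Sum>s\<in>{1..<Suc N}. m s) * (?m * ?a))" by (simp only: stab_dim_replicate)
  have "real ((\<Sum>s\<in>{1..<Suc N}. m s) * (?m * ?a)) = real ?a * real ?m * (\<Sum>s\<in>{1..<Suc N}. real (m s))"
    by (simp only: of_nat_mult of_nat_sum mult_ac)
  then show ?case unfolding eq IH
    by (simp only: sum.cl_ivl_Suc distrib_left add.assoc) (simp add: not_less)
qed simp

lemma diag_block_mat_concat: "diag_block_mat (map diag_block_mat Ass) = diag_block_mat (concat Ass)"
  by (induction Ass) (auto simp: diag_block_mat_append Let_def)

theorem theorem1p1:
  fixes A :: "complex mat" and n :: nat and n_as :: "(nat \<times> complex) list"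
  assumes "A \<in> carrier_mat n n"
    and "A\<^sup>T = A"
    and "jordan_nf A n_as"
  shows
    "dim_stab (sym_canonical n_as) =
       (\<Sum>\<rho>\<in>spectrum A. dim_stab (sym_canonical_part n_as \<rho>)) \<and>
     (\<forall>(l :: complex) (N :: nat) (\<alpha> :: nat \<Rightarrow> nat) (m :: nat \<Rightarrow> nat).
        (\<forall>r\<in>{1..N}. \<alpha> r \<ge> 1 \<and> m r \<ge> 1) \<longrightarrow>
        strict_antimono_on {1..N} \<alpha> \<longrightarrow>
        sym_canonical n_as =
          diag_block_mat (map (\<lambda>r. diag_block_mat (replicate (m r) (sym_block (\<alpha> r) l))) [1..<N + 1]) \<longrightarrow>
        real (dim_stab (sym_canonical n_as)) =
          (\<Sum>r = 1..N. real (\<alpha> r) * real (m r) *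
             (1/2 * (real (m r) - 1) + (\<Sum>s\<in>{1..<r}. real (m s)))))"
proof (intro conjI allI impI)
  have "(\<lambda>(m, z). z = \<rho>) = (\<lambda>x :: nat \<times> complex. snd x = \<rho>)" for \<rho> by auto
  then show "dim_stab (sym_canonical n_as) = (\<Sum>\<rho>\<in>spectrum A. dim_stab (sym_canonical_part n_as \<rho>))"
    unfolding sym_canonical_part_def dim_stab_sym_canonical spectrum_jordan_nf[OF assms(1,3)]
    using stab_dim_eq_sum_filter[of "snd ` set n_as" n_as] by simp
next
  fix l :: complex and N :: nat and \<alpha> m :: "nat \<Rightarrow> nat"
  assume \<alpha>: "strict_antimono_on {1..N} \<alpha>"
    and eq: "sym_canonical n_as =
      diag_block_mat (map (\<lambda>r. diag_block_mat (replicate (m r) (sym_block (\<alpha> r) l))) [1..<N + 1])"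
  \<comment> \<open>The nested direct sum is the canonical form of this flattened list. The matrices
    are identified, not the lists, which suffices because \<open>dim_stab\<close> depends on the
    matrix alone.\<close>
  let ?xs = "concat (map (\<lambda>r. replicate (m r) (\<alpha> r, l)) [1..<N + 1])"
  have "sym_canonical n_as = diag_block_mat (concat (map (\<lambda>r. replicate (m r) (sym_block (\<alpha> r) l)) [1..<N + 1]))"
    unfolding eq diag_block_mat_concat[symmetric] by (simp only: map_map comp_def)
  also have "\<dots> = sym_canonical ?xs"
    by (simp only: sym_canonical_def map_concat map_map comp_def map_replicate case_prod_conv)
  finally have "sym_canonical n_as = sym_canonical ?xs" .
  then show "real (dim_stab (sym_canonical n_as)) = (\<Sum>r = 1..N. real (\<alpha> r) * real (m r) *
             (1/2 * (real (m r) - 1) + (\<Sum>s\<in>{1..<r}. real (m s))))"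
    using stab_dim_concat_replicate[OF \<alpha>] by (simp only: dim_stab_sym_canonical)
qed

end
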